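(* A map $\operatorname{z}\colon\operatorname{Conv}(\mathbb{R}^n;\mathbb{R})\to\mathbb{R}^n$ is a continuous, dually epi-translation invariant valuation that is homogeneous of degree $n$ if and only if there exists $\psi\in C_c(\mathbb{R}^n;\mathbb{R}^n)$ such that $\operatorname{z}(v)=\int_{\mathbb{R}^n}\psi(x)\,\mathrm{d}\operatorname{MA}(v;x)$ for every $v\in\operatorname{Conv}(\mathbb{R}^n;\mathbb{R})$. For $n\geq3$, such a $\operatorname{z}$ is in addition rotation equivariant if and only if there exists $\xi\in C_b((0,\infty))$ with $\lim_{t\to0^+}\xi(t)t=0$ such that $\operatorname{z}=\operatorname{t}^*_{n,\xi}$. For $n\in\{1,2\}$ the same holds with rotation equivariance replaced by $\operatorname{O}(n)$ equivariance.
   Context: $\operatorname{Conv}(\mathbb{R}^n;\mathbb{R})$: convex functions $\mathbb{R}^n\to\mathbb{R}$ with the topology of pointwise convergence. Valuation: $\operatorname{z}(v\vee w)+\operatorname{z}(v\wedge w)=\operatorname{z}(v)+\operatorname{z}(w)$ whenever $v,w,v\vee w,v\wedge w$ are in the space. Dually epi-translation invariant: $\operatorname{z}(v+\ell+c)=\operatorname{z}(v)$ for every linear functional $\ell$ and $c\in\mathbb{R}$. Homogeneous of degree $s$: $\operatorname{z}(\lambda v)=\lambda^s\operatorname{z}(v)$ for $\lambda>0$. Rotation equivariant: $\operatorname{z}(v\circ\vartheta^{-1})=\vartheta\operatorname{z}(v)$, $\vartheta\in\operatorname{SO}(n)$; $\operatorname{O}(n)$ equivariant analogously. $\operatorname{MA}(v;\cdot)$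 is the Monge–Ampère measure of $v$. $C_b((0,\infty))$: continuous with bounded support in $(0,\infty)$. $\operatorname{t}^*_{n,\xi}(v)=\int_{\mathbb{R}^n}\xi(|x|)\,x\,\mathrm{d}\operatorname{MA}(v;x)$, with $x\mapsto\xi(|x|)x$ extended by $o$ at the origin. *)

theory Defs
  imports "HOL-Analysis.Analysis"
begin

definition Conv :: "(real^'n \<Rightarrow> real) set" where
  "Conv = {v. convex_on UNIV v}"

definition Conv_top :: "(real^'n \<Rightarrow> real) topology" where
  "Conv_top = subtopology (powertop_real UNIV) Conv"

definition subdiff :: "(real^'n \<Rightarrow> real) \<Rightarrow> real^'n \<Rightarrow> (real^'n) set" where
  "subdiff v x = {y. \<forall>z. v z \<ge> v x + y \<bullet> (z - x)}"

definition MA :: "(real^'n \<Rightarrow> real) \<Rightarrow> (real^'n) measure" where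
  "MA v = measure_of UNIV (sets borel) (\<lambda>B. emeasure lebesgue (\<Union>x\<in>B. subdiff v x))"

definition is_valuation :: "((real^'n \<Rightarrow> real) \<Rightarrow> real^'n) \<Rightarrow> bool" where
  "is_valuation z \<longleftrightarrow> (\<forall>v\<in>Conv. \<forall>w\<in>Conv.
     (\<lambda>x. max (v x) (w x)) \<in> Conv \<longrightarrow> (\<lambda>x. min (v x) (w x)) \<in> Conv \<longrightarrow>
     z (\<lambda>x. max (v x) (w x)) + z (\<lambda>x. min (v x) (w x)) = z v + z w)"

definition dually_epi_translation_invariant :: "((real^'n \<Rightarrow> real) \<Rightarrow> real^'n) \<Rightarrow> bool" where
  "dually_epi_translation_invariant z \<longleftrightarrow>
     (\<forall>v\<in>Conv. \<forall>y::real^'n. \<forall>c::real. z (\<lambda>x. v x + y \<bullet> x + c) = z v)"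

definition homogeneous_deg :: "nat \<Rightarrow> ((real^'n \<Rightarrow> real) \<Rightarrow> real^'n) \<Rightarrow> bool" where
  "homogeneous_deg s z \<longleftrightarrow> (\<forall>v\<in>Conv. \<forall>r>0. z (\<lambda>x. r * v x) = r ^ s *\<^sub>R z v)"

definition rotation_equivariant :: "((real^'n \<Rightarrow> real) \<Rightarrow> real^'n) \<Rightarrow> bool" where
  "rotation_equivariant z \<longleftrightarrow> (\<forall>\<theta>. orthogonal_transformation \<theta> \<and> det (matrix \<theta>) = 1 \<longrightarrow>
     (\<forall>v\<in>Conv. z (v \<circ> inv \<theta>) = \<theta> (z v)))"

definition O_equivariant :: "((real^'n \<Rightarrow> real) \<Rightarrow> real^'n) \<Rightarrow> bool" where
  "O_equivariant z \<longleftrightarrow> (\<forall>\<theta>. orthogonal_transformation \<theta> \<longrightarrow>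
     (\<forall>v\<in>Conv. z (v \<circ> inv \<theta>) = \<theta> (z v)))"

definition Cc :: "(real^'n \<Rightarrow> real^'n) set" where
  "Cc = {\<psi>. continuous_on UNIV \<psi> \<and> compact (closure {x. \<psi> x \<noteq> 0})}"

text \<open>C_b((0,\<infinity>)): continuous on (0,\<infinity>) with bounded support in (0,\<infinity>).
  Only the values on (0,\<infinity>) are relevant.\<close>
definition Cb_pos :: "(real \<Rightarrow> real) set" where
  "Cb_pos = {\<xi>. continuous_on {0<..} \<xi> \<and> (\<exists>b. \<forall>t>b. \<xi> t = 0)}"

definition tstar :: "(real \<Rightarrow> real) \<Rightarrow> (real^'n \<Rightarrow> real) \<Rightarrow> real^'n" where
  "tstar \<xi> v = integral\<^sup>L (MA v) (\<lambda>x. if x = 0 then 0 else \<xi> (norm x) *\<^sub>R x)"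

end

(* A strongly convex w has a Lipschitz resolvent G = (\<partial>w)^{-1}, and MA(w) is the image of Lebesgue measure
   under G. In general the y lying in two different subdifferentials form a null set (by monotonicity,
   a compact piece of it is disjoint from its translates along an axis), so that
   \<integral>\<psi> dMA(v) = \<integral>\<psi>(G(y)) dy over the range of \<partial>v. In this form continuity is dominated
   convergence and the valuation property is a pointwise statement about minimisers of v - <y,.>.

   Conversely put \<psi>(x) = z(support function of the unit cube, shifted by x). Restrict the conjugate u of a
   strongly convex w to boxes K: K \<mapsto> z(conjugate of u|K) is additive when boxes are cut, up to the value on the
   common face. On a cube of side s at y the function u is affine up to O(s^2), so by homogeneity the
   value is s^n (\<psi>(G(y)) + o(1)). Repeated halving shows first that degenerate boxes have value 0,
   since they split into too few pieces, and then that z(conjugate of u|K) = \<integral>_K \<psi>(G(y)) dy. Exhausting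
   space by cubes gives z(w), and strongly convex functions are dense.

   The functions |. - x| detect \<psi>(x), so equivariance of z is equivariance of \<psi>; reflections, or half turns
   if n \<ge> 3, force \<psi>(x) to be parallel to x. *)
theory Submission
  imports Defs
begin

section \<open>Convex functions and the topology of pointwise convergence\<close>

text \<open>The minimum of two convex functions is seldom convex, so the valuation identity says
  little about arbitrary pairs. It is exploited on the dual side: the conjugates of one convex
  function over two boxes with convex union have as maximum and minimum the conjugates over the
  union and the intersection of the boxes. The unit cube enters because its support function,
  shifted by x, has the unit mass at x as Monge-Ampere measure, so that no density with another
  value at x could represent z. Degree n is what balances the subdivision: halving a d-dimensional
  box k times gives 2^(dk) pieces, each of value O(2^(-nk)); the total tends to 0 for d < n and
  stays of order one for d = n. Compact support of \<psi> needs a separate argument: corners that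
  move to infinity are, on every bounded set, affine in the coordinate in which they escape, so
  stretching them in that coordinate is invisible to pointwise convergence but multiplies the value
  of z.\<close>

lemma Conv_D: "v \<in> Conv \<Longrightarrow> 0 \<le> t \<Longrightarrow> t \<le> 1 \<Longrightarrow>
   v ((1 - t) *\<^sub>R x + t *\<^sub>R y) \<le> (1 - t) * v x + t * v y"
  by (auto simp: Conv_def dest: convex_onD)

lemma Conv_continuous: "v \<in> Conv \<Longrightarrow> continuous_on S v"
  using convex_on_continuous[of UNIV v] continuous_on_subset by (auto simp: Conv_def)

lemma affine_in_Conv: "(\<lambda>x. y \<bullet> x + c) \<in> Conv" for y :: "real^'n"
  unfolding Conv_def by (auto intro!: convex_onI simp: inner_simps algebra_simps)

lemma Conv_add: "v \<in> Conv \<Longrightarrow> w \<in> Conv \<Longrightarrow> (\<lambda>x. v x + w x) \<in> Conv"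
  by (auto simp: Conv_def)

lemma Conv_cmul: "v \<in> Conv \<Longrightarrow> 0 \<le> c \<Longrightarrow> (\<lambda>x. c * v x) \<in> Conv"
  by (auto simp: Conv_def)

lemma Conv_affine: "v \<in> Conv \<Longrightarrow> (\<lambda>x. v x + y \<bullet> x + c) \<in> Conv" for y :: "real^'n"
  using Conv_add[OF _ affine_in_Conv[of y c], of v] by (simp add: add.assoc)

section \<open>Subgradients: existence and bounds\<close>

lemma subdiff_alt: "y \<in> subdiff v x \<longleftrightarrow> (\<forall>p. v x - y \<bullet> x \<le> v p - y \<bullet> p)"
  by (auto simp: subdiff_def inner_simps algebra_simps)

lemma subdiffD: "y \<in> subdiff v x \<Longrightarrow> v x + y \<bullet> (p - x) \<le> v p"
  by (auto simp: subdiff_def)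

lemma subdiff_monotone:
  "y \<in> subdiff v x \<Longrightarrow> y' \<in> subdiff v x' \<Longrightarrow> 0 \<le> (y' - y) \<bullet> (x' - x)"
  using subdiffD[of y v x x'] subdiffD[of y' v x' x] by (simp add: inner_simps algebra_simps)

text \<open>Separate the open strict epigraph from the point (x, v x). Since v is finite everywhere,
  the separating hyperplane is not vertical, and its slope is a subgradient.\<close>

lemma subdiff_nonempty:
  assumes "v \<in> Conv"
  obtains y where "y \<in> subdiff v x"
proof -
  let ?E = "{p. v (fst p) < snd p}"
  have "open ?E"
    by (intro open_Collect_less continuous_intros continuous_on_compose2[OF Conv_continuous[OF assms]]) auto
  have "convex ?E"
  proof (rule convexI, clarsimp)
    fix a b :: "real^'a" and s t \<alpha> \<beta> :: real
    assume *: "v a < s" "v b < t" "0 \<le> \<alpha>" "0 \<le> \<beta>" "\<alpha> + \<beta> = 1"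
    have "v (\<alpha> *\<^sub>R a + \<beta> *\<^sub>R b) \<le> \<alpha> * v a + \<beta> * v b"
      using Conv_D[OF assms, of \<beta> a b] * by (simp add: eq_diff_eq[symmetric])
    moreover have "\<alpha> * v a + \<beta> * v b < \<alpha> * s + \<beta> * t"
    proof (cases "\<alpha> = 0")
      case False
      then have "\<alpha> * v a < \<alpha> * s" "\<beta> * v b \<le> \<beta> * t" using * by (auto simp: mult_left_mono)
      then show ?thesis by simp
    qed (use * in auto)
    ultimately show "v (\<alpha> *\<^sub>R a + \<beta> *\<^sub>R b) < \<alpha> * s + \<beta> * t" by linarith
  qed
  moreover have "(x, v x + 1) \<in> ?E" by simp
  then have "?E \<noteq> {}" by blast
  ultimately have "\<exists>a b. a \<noteq> 0 \<and> (\<forall>p\<in>?E. a \<bullet> p \<le> b) \<and> (\<forall>p\<in>{(x, v x)}. a \<bullet> p \<ge> b)"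
    by (intro separating_hyperplane_sets) auto
  then obtain a b where ab: "a \<noteq> 0" "\<And>p. p \<in> ?E \<Longrightarrow> a \<bullet> p \<le> b" "b \<le> a \<bullet> (x, v x)"
    by blast
  obtain g c where a: "a = (g, c)" by (cases a)
  have ineq: "g \<bullet> p + c * t \<le> g \<bullet> x + c * v x" if "v p < t" for p t
    using ab(2)[of "(p, t)"] ab(3) that by (simp add: a)
  have c_le: "c \<le> 0" using ineq[of x "v x + 1"] by (simp add: algebra_simps)
  have ineq': "g \<bullet> p + c * v p \<le> g \<bullet> x + c * v x" for p
  proof (rule tendsto_upperbound)
    show "((\<lambda>t. g \<bullet> p + c * t) \<longlongrightarrow> g \<bullet> p + c * v p) (at_right (v p))"
      by (intro tendsto_intros)
    show "eventually (\<lambda>t. g \<bullet> p + c * t \<le> g \<bullet> x + c * v x) (at_right (v p))"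
      using ineq by (auto simp: eventually_at_right_field intro: gt_ex)
  qed simp
  \<comment> \<open>A vertical hyperplane would bound g \<bullet> p by g \<bullet> x for all p; the
    choice p = x + g leaves only g = 0, and then the whole normal vanishes.\<close>
  have "c \<noteq> 0"
  proof
    assume "c = 0"
    then have "g \<bullet> g \<le> 0" using ineq'[of "x + g"] by (simp add: inner_simps)
    then have "g = 0" by (metis inner_gt_zero_iff linorder_not_le)
    then show False using ab(1) \<open>c = 0\<close> a by (simp add: zero_prod_def)
  qed
  with c_le have c: "c < 0" by simp
  have "(1 / - c) *\<^sub>R g \<in> subdiff v x"
  proof -
    have "v x + ((1 / - c) *\<^sub>R g) \<bullet> (p - x) \<le> v p" for p
    proof -
      have "(g \<bullet> (p - x)) / - c \<le> v p - v x"
        using ineq'[of p] c by (simp add: inner_simps field_simps)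
      then show ?thesis by simp
    qed
    then show ?thesis by (simp add: subdiff_def)
  qed
  then show thesis using that by blast
qed

text \<open>A unit step from x in the direction of y raises v by at least the norm of y, while v
  changes by at most 2 * B; the unit step explains R + 1. The same bound later confines the supports
  of all integrands.\<close>

lemma subdiff_bound:
  assumes "y \<in> subdiff v x" "norm x \<le> R" "\<And>p. norm p \<le> R + 1 \<Longrightarrow> \<bar>v p\<bar> \<le> B"
  shows "norm y \<le> 2 * B"
proof (cases "y = 0")
  case True
  have "0 \<le> \<bar>v x\<bar>" by simp
  also have "\<dots> \<le> B" using assms by simp
  finally show ?thesis using True by simp
next
  case False
  let ?p = "x + y /\<^sub>R norm y"
  have "norm ?p \<le> R + 1"
    using norm_triangle_ineq[of x "y /\<^sub>R norm y"] assms(2) False by simp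
  then have "\<bar>v ?p\<bar> \<le> B" "\<bar>v x\<bar> \<le> B" using assms(2,3) by auto
  moreover have "y \<bullet> (y /\<^sub>R norm y) = norm y"
    using False by (simp add: power2_norm_eq_inner[symmetric] power2_eq_square)
  then have "v x + norm y \<le> v ?p"
    using subdiffD[OF assms(1), of ?p] by simp
  ultimately show ?thesis by linarith
qed

lemma Conv_lipschitz:
  assumes "v \<in> Conv" "\<And>p. norm p \<le> R + 1 \<Longrightarrow> \<bar>v p\<bar> \<le> B" "norm x \<le> R" "norm x' \<le> R"
  shows "\<bar>v x - v x'\<bar> \<le> 2 * B * norm (x - x')"
proof -
  have *: "v a - v b \<le> 2 * B * norm (a - b)" if "norm a \<le> R" for a b
  proof -
    obtain y where y: "y \<in> subdiff v a" using subdiff_nonempty[OF assms(1)] .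
    have "v a - v b \<le> - (y \<bullet> (b - a))" using subdiffD[OF y, of b] by simp
    also have "\<dots> \<le> norm y * norm (a - b)"
      using norm_cauchy_schwarz[of y "a - b"] by (simp add: inner_simps)
    also have "\<dots> \<le> 2 * B * norm (a - b)"
      by (intro mult_right_mono subdiff_bound[OF y that]) (use assms(2) in auto)
    finally show ?thesis .
  qed
  show ?thesis using *[of x x'] *[of x' x] assms(3,4) by (simp add: abs_le_iff norm_minus_commute)
qed

lemma cball_in_finite_hull:
  obtains S :: "(real^'n) set" where "finite S" "cball 0 R \<subseteq> convex hull S"
proof -
  have "0 < \<bar>R\<bar> + 1" by simp
  from cube_convex_hull[OF this, of 0] obtain S :: "(real^'n) set" where
    S: "finite S" "cbox (0 - (\<Sum>i\<in>Basis. (\<bar>R\<bar> + 1) *\<^sub>R i)) (0 + (\<Sum>i\<in>Basis. (\<bar>R\<bar> + 1) *\<^sub>R i)) = convex hull S"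
    by blast
  have "cball 0 R \<subseteq> cbox (0 - (\<Sum>i\<in>Basis. (\<bar>R\<bar> + 1) *\<^sub>R i)) (0 + (\<Sum>i\<in>Basis. (\<bar>R\<bar> + 1) *\<^sub>R i) :: real^'n)"
  proof
    fix x :: "real^'n" assume "x \<in> cball 0 R"
    then have le: "\<bar>x \<bullet> i\<bar> \<le> R" if "i \<in> Basis" for i using Basis_le_norm[OF that, of x] by simp
    have "- (\<bar>R\<bar> + 1) \<le> x \<bullet> i \<and> x \<bullet> i \<le> \<bar>R\<bar> + 1" if "i \<in> Basis" for i using le[OF that] by linarith
    then show "x \<in> cbox (0 - (\<Sum>i\<in>Basis. (\<bar>R\<bar> + 1) *\<^sub>R i)) (0 + (\<Sum>i\<in>Basis. (\<bar>R\<bar> + 1) *\<^sub>R i))"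
      by (simp add: mem_box)
  qed
  then show thesis using S that by metis
qed

text \<open>Pointwise control on a finite set gives uniform control on balls; this makes sequences
  sufficient for continuity on \<open>Conv_top\<close> although the product topology is not first countable.\<close>
lemma Conv_finite_control:
  fixes v :: "real^'n \<Rightarrow> real"
  assumes v: "v \<in> Conv" and e: "e > 0"
  obtains F d where "finite F" "d > 0"
    "\<And>w x. w \<in> Conv \<Longrightarrow> (\<And>q. q \<in> F \<Longrightarrow> \<bar>w q - v q\<bar> < d) \<Longrightarrow> norm x \<le> R \<Longrightarrow> \<bar>w x - v x\<bar> < e"
proof -
  obtain S :: "(real^'n) set" where S: "finite S" "cball 0 (R + 1) \<subseteq> convex hull S"
    using cball_in_finite_hull .
  obtain M0 where M0: "\<And>x. x \<in> insert 0 S \<Longrightarrow> \<bar>v x\<bar> \<le> M0"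
  proof
    show "\<bar>v x\<bar> \<le> Max ((\<lambda>x. \<bar>v x\<bar>) ` insert 0 S)" if "x \<in> insert 0 S" for x
      using that S by (intro Max_ge) auto
  qed
  \<comment> \<open>On the hull w is at most M0 + 1. Midpoint convexity at 0 gives w x \<ge> 2 * w 0
    - w (- x), hence the lower bound - 3 * (M0 + 1).\<close>
  define B where "B = 3 * (M0 + 1)"
  have "B > 0" using M0[of 0] unfolding B_def by auto
  have bd: "\<bar>w x\<bar> \<le> B" if w: "w \<in> Conv" and wF: "\<And>q. q \<in> insert 0 S \<Longrightarrow> \<bar>w q - v q\<bar> < 1"
    and x: "norm x \<le> R + 1" for w x
  proof -
    have up: "w p \<le> M0 + 1" if "norm p \<le> R + 1" for p
    proof -
      have "convex_on (convex hull S) w"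
        using w by (auto simp: Conv_def intro: convex_on_subset)
      moreover have "\<forall>q\<in>S. w q \<le> M0 + 1" using wF M0 by (smt (verit) insertCI)
      ultimately have "\<forall>q\<in>convex hull S. w q \<le> M0 + 1" by (rule convex_on_convex_hull_bound)
      then show ?thesis using S(2) that by (auto simp: subset_iff)
    qed
    have "w 0 \<le> (w x + w (- x)) / 2"
      using Conv_D[OF w, of "1/2" x "- x"] by simp
    moreover have "\<bar>w 0\<bar> \<le> M0 + 1" using wF[of 0] M0[of 0] by simp
    ultimately show ?thesis using up[of x] up[of "- x"] x unfolding B_def by auto
  qed
  \<comment> \<open>Both functions have Lipschitz constant 2 * B on the ball, so moving to a net
    point costs each of them less than e / 4; the remaining e / 2 is the tolerance at the net
    points.\<close>
  define r where "r = e / (8 * B)"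
  have "r > 0" using e \<open>B > 0\<close> by (simp add: r_def)
  have "compact (cball (0::real^'n) R)" by simp
  then obtain N :: "(real^'n) set" where N: "finite N" "N \<subseteq> cball 0 R" "cball 0 R \<subseteq> (\<Union>q\<in>N. ball q r)"
  proof (rule compactE_image[of "cball (0::real^'n) R" "cball 0 R" "\<lambda>q. ball q r"])
    show "cball 0 R \<subseteq> (\<Union>q\<in>cball (0::real^'n) R. ball q r)" using \<open>r > 0\<close> by force
  next
    fix C' assume C': "C' \<subseteq> cball 0 R" "finite C'" "cball (0::real^'n) R \<subseteq> (\<Union>c\<in>C'. ball c r)"
    show thesis by (rule that[OF C'(2,1,3)])
  qed auto
  show thesis
  proof (rule that[of "insert 0 S \<union> N" "min 1 (e / 2)"])
    fix w :: "real^'n \<Rightarrow> real" and x :: "real^'n" assume w: "w \<in> Conv" and wq: "\<And>q. q \<in> insert 0 S \<union> N \<Longrightarrow> \<bar>w q - v q\<bar> < min 1 (e / 2)"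
      and x: "norm x \<le> R"
    obtain q where q: "q \<in> N" "dist q x < r" using N(3) x by auto
    then have "norm q \<le> R" using N by auto
    have "\<bar>w x - w q\<bar> \<le> 2 * B * norm (x - q)"
      by (rule Conv_lipschitz[OF w _ x \<open>norm q \<le> R\<close>]) (use wq in \<open>auto intro!: bd w\<close>)
    moreover have "\<bar>v x - v q\<bar> \<le> 2 * B * norm (x - q)"
      by (rule Conv_lipschitz[OF v _ x \<open>norm q \<le> R\<close>]) (auto intro!: bd v)
    moreover have "2 * B * norm (x - q) < 2 * B * r"
      using q \<open>B > 0\<close> by (simp add: dist_norm norm_minus_commute)
    moreover have "2 * B * r = e / 4" using \<open>B > 0\<close> by (simp add: r_def)
    moreover have "\<bar>w q - v q\<bar> < e / 2" using wq[of q] q by simp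
    ultimately show "\<bar>w x - v x\<bar> < e" by linarith
  qed (use S N e in auto)
qed

section \<open>Continuity on \<open>Conv_top\<close> through sequences\<close>

definition locally_uniform :: "(nat \<Rightarrow> real^'n \<Rightarrow> real) \<Rightarrow> (real^'n \<Rightarrow> real) \<Rightarrow> bool" where
  "locally_uniform V v \<longleftrightarrow> (\<forall>R. \<forall>e>0. \<forall>\<^sub>F k in sequentially. \<forall>x. norm x \<le> R \<longrightarrow> \<bar>V k x - v x\<bar> < e)"

lemma Conv_pointwise_locally_uniform:
  assumes "v \<in> Conv" "\<And>k. V k \<in> Conv" "\<And>x. (\<lambda>k. V k x) \<longlonglongrightarrow> v x"
  shows "locally_uniform V v"
  unfolding locally_uniform_def
proof (intro allI impI)
  fix R e :: real assume "e > 0"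
  obtain F d where F: "finite F" "d > 0"
    "\<And>w x. w \<in> Conv \<Longrightarrow> (\<And>q. q \<in> F \<Longrightarrow> \<bar>w q - v q\<bar> < d) \<Longrightarrow> norm x \<le> R \<Longrightarrow> \<bar>w x - v x\<bar> < e"
    using Conv_finite_control[OF assms(1) \<open>e > 0\<close>] by metis
  have "\<forall>\<^sub>F k in sequentially. \<forall>q\<in>F. \<bar>V k q - v q\<bar> < d"
    using F(1,2) assms(3) by (intro eventually_ball_finite) (auto simp: tendsto_iff dist_real_def)
  then show "\<forall>\<^sub>F k in sequentially. \<forall>x. norm x \<le> R \<longrightarrow> \<bar>V k x - v x\<bar> < e"
    by eventually_elim (use F(3) assms(2) in auto)
qed

lemma topspace_Conv_top [simp]: "topspace Conv_top = Conv"
  by (auto simp: Conv_top_def)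

lemma continuous_map_Conv_topD:
  fixes z :: "(real^'n \<Rightarrow> real) \<Rightarrow> real^'n"
  assumes "continuous_map Conv_top euclidean z" "v \<in> Conv" "\<And>k. V k \<in> Conv"
    "\<And>x. (\<lambda>k. V k x) \<longlonglongrightarrow> v x"
  shows "(\<lambda>k. z (V k)) \<longlonglongrightarrow> z v"
proof -
  have "limitin Conv_top V v sequentially"
    using assms(2-4) by (auto simp: Conv_top_def limitin_subtopology limitin_componentwise)
  from continuous_map_limit[OF assms(1) this] show ?thesis by (simp add: o_def)
qed

text \<open>The neighbourhoods U k, which force closeness 1 / (k + 1) on the ball of radius k,
  replace a countable base at v: if continuity failed, bad points picked from the U k would form a
  locally uniformly convergent sequence.\<close>

lemma continuous_map_Conv_topI:
  fixes z :: "(real^'n \<Rightarrow> real) \<Rightarrow> real^'n"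
  assumes "\<And>v V. v \<in> Conv \<Longrightarrow> (\<And>k. V k \<in> Conv) \<Longrightarrow> locally_uniform V v \<Longrightarrow> (\<lambda>k. z (V k)) \<longlonglongrightarrow> z v"
  shows "continuous_map Conv_top euclidean z"
  unfolding continuous_map_eq_topcontinuous_at topcontinuous_at_def
proof (intro ballI conjI allI impI)
  fix v :: "real^'n \<Rightarrow> real" and W assume "v \<in> topspace Conv_top" and W: "openin euclidean W \<and> z v \<in> W"
  then have v: "v \<in> Conv" by simp
  define Q where "Q k U \<longleftrightarrow> openin Conv_top U \<and> v \<in> U \<and>
      (\<forall>w\<in>U. \<forall>x. norm x \<le> real k \<longrightarrow> \<bar>w x - v x\<bar> < 1 / (real k + 1))" for k U
  have "\<exists>U. Q k U" for k
  proof -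
    obtain F d where F: "finite F" "d > 0"
      "\<And>w x. w \<in> Conv \<Longrightarrow> (\<And>q. q \<in> F \<Longrightarrow> \<bar>w q - v q\<bar> < d) \<Longrightarrow> norm x \<le> real k \<Longrightarrow>
         \<bar>w x - v x\<bar> < 1 / (real k + 1)"
      using Conv_finite_control[OF v, of "1 / (real k + 1)" "real k"]
      by (metis add_nonneg_pos of_nat_0_le_iff zero_less_divide_1_iff zero_less_one)
    let ?U = "{w \<in> topspace Conv_top. \<forall>q\<in>F. w q \<in> {v q - d <..< v q + d}}"
    have "openin Conv_top {w \<in> topspace Conv_top. w q \<in> {v q - d <..< v q + d}}" for q
    proof (rule openin_continuous_map_preimage)
      show "continuous_map Conv_top euclideanreal (\<lambda>w. w q)"
        unfolding Conv_top_def
        by (intro continuous_map_from_subtopology continuous_map_product_projection) simp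
    qed simp
    then have "openin Conv_top (\<Inter>q\<in>F. {w \<in> topspace Conv_top. w q \<in> {v q - d <..< v q + d}})"
      if "F \<noteq> {}" using F(1) that by (intro openin_Inter) auto
    moreover have "?U = (\<Inter>q\<in>F. {w \<in> topspace Conv_top. w q \<in> {v q - d <..< v q + d}})" if "F \<noteq> {}"
      using that by auto
    moreover have "openin Conv_top ?U" if "F = {}"
      using that openin_topspace[of Conv_top] by simp
    ultimately have "openin Conv_top ?U" by (cases "F = {}") auto
    moreover have "v \<in> ?U" using v F by auto
    moreover have "\<bar>w x - v x\<bar> < 1 / (real k + 1)" if "w \<in> ?U" "norm x \<le> real k" for w x
      using that by (intro F(3)) (auto simp: abs_less_iff)
    ultimately show ?thesis unfolding Q_def by blast
  qed
  then obtain U where U: "\<And>k. Q k (U k)" by metis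
  show "\<exists>U. openin Conv_top U \<and> v \<in> U \<and> (\<forall>w\<in>U. z w \<in> W)"
  proof (rule ccontr)
    assume "\<not> ?thesis"
    then have "\<exists>w. w \<in> U k \<and> z w \<notin> W" for k using U[of k] unfolding Q_def by blast
    then obtain V where V: "\<And>k. V k \<in> U k" "\<And>k. z (V k) \<notin> W" by metis
    have "V k \<in> Conv" for k using U[of k] V(1)[of k] openin_subset[of Conv_top "U k"] by (auto simp: Q_def)
    moreover have "locally_uniform V v"
      unfolding locally_uniform_def
    proof (intro allI impI)
      fix R e :: real assume "e > 0"
      obtain K where K: "R \<le> real K" "1 / e \<le> real K" using real_arch_simple[of "max R (1/e)"] by auto
      show "\<forall>\<^sub>F k in sequentially. \<forall>x. norm x \<le> R \<longrightarrow> \<bar>V k x - v x\<bar> < e"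
      proof (rule eventually_sequentiallyI[of K], intro allI impI)
        fix k and x :: "real^'n" assume "K \<le> k" "norm x \<le> R"
        then have "\<bar>V k x - v x\<bar> < 1 / (real k + 1)"
          using U[of k] V(1)[of k] K by (auto simp: Q_def)
        also have "\<dots> \<le> e"
        proof -
          have "1 / e \<le> real k + 1" using K \<open>K \<le> k\<close> by linarith
          then show ?thesis using \<open>e > 0\<close> by (simp add: field_simps)
        qed
        finally show "\<bar>V k x - v x\<bar> < e" .
      qed
    qed
    ultimately have "(\<lambda>k. z (V k)) \<longlonglongrightarrow> z v" using assms v by blast
    moreover have "open W" "z v \<in> W" using W by auto
    ultimately have "\<forall>\<^sub>F k in sequentially. z (V k) \<in> W" by (rule topological_tendstoD)
    then show False using V(2) by auto
  qed
qed auto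

section \<open>The Monge-Ampere measure as an image of Lebesgue measure\<close>

definition subdiff_image :: "(real^'n \<Rightarrow> real) \<Rightarrow> (real^'n) set \<Rightarrow> (real^'n) set" where
  "subdiff_image v B = (\<Union>x\<in>B. subdiff v x)"

text \<open>In terms of duality, the slopes at which the conjugate of \<open>v\<close> has several
  subgradients. Over these, images of disjoint sets under the subdifferential overlap.\<close>

definition multi_subgrad :: "(real^'n \<Rightarrow> real) \<Rightarrow> (real^'n) set" where
  "multi_subgrad v = {y. \<exists>x x'. x \<noteq> x' \<and> y \<in> subdiff v x \<and> y \<in> subdiff v x'}"

lemma closed_subdiff_graph:
  assumes "v \<in> Conv"
  shows "closed {(x, y). y \<in> subdiff v x}"
proof -
  have eq: "{(x, y). y \<in> subdiff v x} = (\<Inter>p. {q. v (fst q) + snd q \<bullet> (p - fst q) \<le> v p})"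
    by (auto simp: subdiff_def)
  show ?thesis unfolding eq
    by (intro closed_INT ballI closed_Collect_le continuous_intros
        continuous_on_compose2[OF Conv_continuous[OF assms]]) auto
qed

lemma closed_subdiff_image:
  assumes "v \<in> Conv" "compact C"
  shows "closed (subdiff_image v C)"
  using closed_compact_projection[OF assms(2) closed_subdiff_graph[OF assms(1)]]
  by (simp add: subdiff_image_def Bex_def Collect_disj_eq UNION_eq)

lemma Conv_bounded_on_ball:
  assumes "v \<in> Conv"
  obtains B where "\<And>x::real^'n. norm x \<le> R \<Longrightarrow> \<bar>v x\<bar> \<le> B"
proof -
  have "compact (v ` cball 0 R)"
    using assms by (intro compact_continuous_image Conv_continuous) auto
  then have "bounded (v ` cball 0 R)" by (rule compact_imp_bounded)
  then obtain B where "\<forall>x\<in>cball 0 R. \<bar>v x\<bar> \<le> B" by (auto simp: bounded_iff)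
  then show thesis by (intro that[of B]) auto
qed

lemma bounded_subdiff_image:
  assumes "v \<in> Conv" "bounded C"
  shows "bounded (subdiff_image v C)"
proof -
  obtain R where R: "\<And>x. x \<in> C \<Longrightarrow> norm x \<le> R" using assms(2) by (auto simp: bounded_iff)
  obtain B where "\<And>x. norm x \<le> R + 1 \<Longrightarrow> \<bar>v x\<bar> \<le> B" using Conv_bounded_on_ball[OF assms(1)] by metis
  then have "norm y \<le> 2 * B" if "y \<in> subdiff_image v C" for y
    using that R by (auto simp: subdiff_image_def intro: subdiff_bound)
  then show ?thesis by (auto simp: bounded_iff)
qed

text \<open>The translates by e / (k + 1) are pairwise disjoint, have equal measure and lie in one
  ball; infinitely many of them fit only if the measure is 0.\<close>

lemma negligible_of_disjoint_translates:
  fixes S :: "(real^'n) set"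
  assumes "compact S" and disj: "\<And>y t. y \<in> S \<Longrightarrow> t > 0 \<Longrightarrow> y + t *\<^sub>R e \<notin> S"
  shows "negligible S"
proof -
  have lmeas: "S \<in> lmeasurable" using assms(1) by (rule lmeasurable_compact)
  define T where "T = (\<lambda>k::nat. (+) ((1 / (real k + 1)) *\<^sub>R e) ` S)"
  obtain R where R: "\<And>y. y \<in> S \<Longrightarrow> norm y \<le> R"
    using compact_imp_bounded[OF assms(1)] by (auto simp: bounded_iff)
  have T_sub: "T k \<subseteq> cball 0 (R + norm e)" for k
  proof -
    have "norm ((1 / (real k + 1)) *\<^sub>R e + y) \<le> R + norm e" if "y \<in> S" for y
    proof -
      have "norm ((1 / (real k + 1)) *\<^sub>R e + y) \<le> norm ((1 / (real k + 1)) *\<^sub>R e) + norm y"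
        by (rule norm_triangle_ineq)
      also have "norm ((1 / (real k + 1)) *\<^sub>R e) \<le> norm e"
        by (simp add: field_simps mult_left_le)
      finally show ?thesis using R[OF that] by simp
    qed
    then show ?thesis by (auto simp: T_def)
  qed
  have T_meas: "T k \<in> lmeasurable" for k
    unfolding T_def using lmeas by (simp add: measurable_translation)
  have T_measure: "measure lebesgue (T k) = measure lebesgue S" for k
    unfolding T_def by (rule measure_translation)
  have disj_aux: False if T: "a \<in> T k" "a \<in> T l" "k < l" for a k l
  proof -
    obtain y y' where y: "y \<in> S" "y' \<in> S" "a = (1 / (real k + 1)) *\<^sub>R e + y" "a = (1 / (real l + 1)) *\<^sub>R e + y'"
      using T(1,2) unfolding T_def by blast
    then have "y' = y + (1 / (real k + 1) - 1 / (real l + 1)) *\<^sub>R e"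
      by (simp add: algebra_simps)
    moreover have "1 / (real k + 1) - 1 / (real l + 1) > 0" using T(3) by (simp add: frac_less2)
    ultimately show False using disj y(1,2) by metis
  qed
  have "disjoint_family T"
    unfolding disjoint_family_on_def using disj_aux by (metis disjoint_iff linorder_neqE_nat)
  have "real n * measure lebesgue S \<le> measure lebesgue (cball 0 (R + norm e) :: (real^'n) set)" for n
  proof -
    have "real n * measure lebesgue S = (\<Sum>k<n. measure lebesgue (T k))" by (simp add: T_measure)
    also have "\<dots> = measure lebesgue (\<Union>k\<in>{..<n}. T k)"
      using \<open>disjoint_family T\<close> T_meas
      by (intro measure_UNION_AE[symmetric] measure_UNION'[symmetric])
        (auto simp: pairwise_def disjoint_family_on_def disjnt_def)
    also have "\<dots> \<le> measure lebesgue (cball 0 (R + norm e) :: (real^'n) set)"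
      using T_sub T_meas by (intro measure_mono_fmeasurable) (auto intro: lmeasurable_cball fmeasurableD)
    finally show ?thesis .
  qed
  then have "measure lebesgue S = 0"
    by (metis (no_types) linorder_not_le measure_nonneg order_antisym_conv reals_Archimedean3)
  then show ?thesis using lmeas by (simp add: negligible_iff_measure)
qed

lemma negligible_multi_subgrad:
  fixes v :: "real^'n \<Rightarrow> real"
  assumes v: "v \<in> Conv"
  shows "negligible (multi_subgrad v)"
proof -
  \<comment> \<open>Two distinct points differ in some coordinate i and are separated there by
    rationals a < b. With a radius N this covers \<open>multi_subgrad v\<close> by countably many
    compact sets.\<close>
  define A where "A i a N = subdiff_image v (cball 0 (real N) \<inter> {x. x $ i \<le> a})" for i a N
  define B where "B i a N = subdiff_image v (cball 0 (real N) \<inter> {x. a \<le> x $ i})" for i a N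
  have cl: "closed {x::real^'n. x $ i \<le> a}" "closed {x::real^'n. a \<le> x $ i}" for i a
    by (intro closed_Collect_le continuous_intros)+
  have neg: "negligible (A i a N \<inter> B i b N)" if "a < b" for i a b N
  proof (rule negligible_of_disjoint_translates)
    have "closed (A i a N)" "closed (B i b N)"
      unfolding A_def B_def by (intro closed_subdiff_image v compact_Int_closed cl; simp)+
    moreover have "bounded (A i a N)"
      unfolding A_def by (intro bounded_subdiff_image v bounded_Int) simp
    ultimately show "compact (A i a N \<inter> B i b N)"
      by (simp add: compact_eq_bounded_closed bounded_Int closed_Int)
    fix y t assume y: "y \<in> A i a N \<inter> B i b N" and "t > (0::real)"
    show "y + t *\<^sub>R axis i 1 \<notin> A i a N \<inter> B i b N"
    proof
      assume "y + t *\<^sub>R axis i 1 \<in> A i a N \<inter> B i b N"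
      then obtain x' where x': "y + t *\<^sub>R axis i 1 \<in> subdiff v x'" "x' $ i \<le> a"
        by (auto simp: A_def subdiff_image_def)
      obtain x where x: "y \<in> subdiff v x" "b \<le> x $ i" using y by (auto simp: B_def subdiff_image_def)
      have "0 \<le> t * (x' $ i - x $ i)"
        using subdiff_monotone[OF x(1) x'(1)] by (simp add: inner_axis' )
      then have "x $ i \<le> x' $ i" using \<open>t > 0\<close> by (simp add: zero_le_mult_iff)
      then show False using x x' that by linarith
    qed
  qed
  have "multi_subgrad v \<subseteq> (\<Union>(i, a, b, N) \<in> {(i, a, b, N). a \<in> \<rat> \<and> b \<in> \<rat> \<and> a < b}. A i a N \<inter> B i b N)"
  proof
    fix y assume "y \<in> multi_subgrad v"
    then obtain x x' where xx: "x \<noteq> x'" "y \<in> subdiff v x" "y \<in> subdiff v x'"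
      by (auto simp: multi_subgrad_def)
    then obtain i where "x $ i \<noteq> x' $ i" by (auto simp: vec_eq_iff)
    then obtain x x' where xx: "x $ i < x' $ i" "y \<in> subdiff v x" "y \<in> subdiff v x'"
      using xx by (cases "x $ i < x' $ i") (auto simp: not_less le_less)
    obtain b where b: "b \<in> \<rat>" "x $ i < b" "b < x' $ i" using Rats_dense_in_real[OF xx(1)] by blast
    obtain a where a: "a \<in> \<rat>" "x $ i < a" "a < b" using Rats_dense_in_real[OF b(2)] by blast
    obtain N :: nat where N: "norm x \<le> real N" "norm x' \<le> real N"
      using real_arch_simple[of "max (norm x) (norm x')"] by auto
    have "y \<in> A i a N" unfolding A_def subdiff_image_def using xx a N by (auto intro!: bexI[of _ x])
    moreover have "y \<in> B i b N" unfolding B_def subdiff_image_def using xx b N by (auto intro!: bexI[of _ x'])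
    ultimately show "y \<in> (\<Union>(i, a, b, N) \<in> {(i, a, b, N). a \<in> \<rat> \<and> b \<in> \<rat> \<and> a < b}. A i a N \<inter> B i b N)"
      using a b by auto
  qed
  moreover have "negligible (\<Union>(i, a, b, N) \<in> {(i::'n, a, b, N::nat). a \<in> \<rat> \<and> b \<in> \<rat> \<and> a < b}. A i a N \<inter> B i b N)"
  proof (rule negligible_countable_Union)
    have "countable ((UNIV::'n set) \<times> \<rat> \<times> \<rat> \<times> (UNIV::nat set))"
      by (intro countable_SIGMA countable_rat) auto
    then have "countable {(i::'n, a::real, b::real, N::nat). a \<in> \<rat> \<and> b \<in> \<rat> \<and> a < b}"
      by (rule countable_subset[rotated]) auto
    then show "countable ((\<lambda>(i, a, b, N). A i a N \<inter> B i b N) ` {(i::'n, a, b, N::nat). a \<in> \<rat> \<and> b \<in> \<rat> \<and> a < b})"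
      by (rule countable_image)
  qed (use neg in auto)
  ultimately show ?thesis using negligible_subset by blast
qed

section \<open>The resolvent and the image formula for \<open>MA\<close>\<close>

definition grad_domain :: "(real^'n \<Rightarrow> real) \<Rightarrow> (real^'n) set" where
  "grad_domain v = subdiff_image v UNIV"

text \<open>A single-valued selection from the inverse of the subdifferential. Its arbitrariness is
  confined to the null set \<open>multi_subgrad\<close> and to points outside
  \<open>grad_domain\<close>, where integrands are set to 0.\<close>

definition resolvent :: "(real^'n \<Rightarrow> real) \<Rightarrow> real^'n \<Rightarrow> real^'n" where
  "resolvent v y = (SOME x. y \<in> subdiff v x)"

lemma resolvent: "y \<in> grad_domain v \<Longrightarrow> y \<in> subdiff v (resolvent v y)"
  by (auto simp: grad_domain_def subdiff_image_def resolvent_def intro: someI)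

lemma grad_domainI: "y \<in> subdiff v x \<Longrightarrow> y \<in> grad_domain v"
  by (auto simp: grad_domain_def subdiff_image_def)

lemma resolvent_eq: "y \<in> subdiff v x \<Longrightarrow> y \<notin> multi_subgrad v \<Longrightarrow> resolvent v y = x"
  using resolvent[OF grad_domainI, of y v x] by (auto simp: multi_subgrad_def)

lemma subdiff_image_closed_lebesgue:
  assumes "v \<in> Conv" "closed C"
  shows "subdiff_image v C \<in> sets lebesgue"
proof -
  have "subdiff_image v C = (\<Union>N::nat. subdiff_image v (cball 0 (real N) \<inter> C))"
    using real_arch_simple by (fastforce simp: subdiff_image_def)
  also have "\<dots> \<in> sets lebesgue"
    using assms by (intro sets.countable_UN image_subsetI)
      (auto intro!: borel_closed closed_subdiff_image sets_completionI_sets compact_Int_closed)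
  finally show ?thesis .
qed

lemma grad_domain_lebesgue: "v \<in> Conv \<Longrightarrow> grad_domain v \<in> sets lebesgue"
  unfolding grad_domain_def by (intro subdiff_image_closed_lebesgue) auto

text \<open>Preimages under the selection and images under the subdifferential differ only inside a
  null set, so both measurability and measure can be carried from one to the other.\<close>

lemma resolvent_vimage:
  "subdiff_image v B - multi_subgrad v \<subseteq> resolvent v -` B \<inter> grad_domain v"
  "resolvent v -` B \<inter> grad_domain v \<subseteq> subdiff_image v B"
  using resolvent[of _ v] resolvent_eq[of _ v]
  by (auto simp: subdiff_image_def intro: grad_domainI)

lemma lebesgue_set_squeeze:
  assumes "A - N \<subseteq> B" "B \<subseteq> A" "negligible N" "A \<in> sets lebesgue"
  shows "B \<in> sets lebesgue"
proof -
  have "B = A - (A - B)" using assms by auto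
  moreover have "negligible (A - B)" by (rule negligible_subset[OF assms(3)]) (use assms in auto)
  then have "A - B \<in> sets lebesgue" by (simp add: negligible_imp_sets)
  ultimately show ?thesis using assms(4) sets.Diff by metis
qed

lemma emeasure_lebesgue_squeeze:
  assumes "A - N \<subseteq> B" "B \<subseteq> A" "negligible N" "B \<in> sets lebesgue"
  shows "emeasure lebesgue A = emeasure lebesgue B"
proof -
  have "A = B \<union> (A - B)" using assms by auto
  moreover have "negligible (A - B)" by (rule negligible_subset[OF assms(3)]) (use assms in auto)
  then have "A - B \<in> null_sets lebesgue" by (simp add: negligible_iff_null_sets)
  ultimately show ?thesis using assms(4) emeasure_Un_null_set by metis
qed

text \<open>Subdifferential images of closed sets are measurable because they are exhausted by
  images of compact sets; the preimage of an open set is therefore reached through its complement in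
  the domain.\<close>

lemma resolvent_measurable:
  fixes v :: "real^'n \<Rightarrow> real"
  assumes "v \<in> Conv"
  shows "resolvent v \<in> measurable (restrict_space lebesgue (grad_domain v)) borel"
proof (rule borel_measurableI)
  fix U :: "(real^'n) set" assume "open U"
  have "resolvent v -` (- U) \<inter> grad_domain v \<in> sets lebesgue"
    using \<open>open U\<close> assms
    by (intro lebesgue_set_squeeze[OF resolvent_vimage negligible_multi_subgrad]
        subdiff_image_closed_lebesgue) auto
  then have "grad_domain v - (resolvent v -` (- U) \<inter> grad_domain v) \<in> sets lebesgue"
    using grad_domain_lebesgue[OF assms] by (rule sets.Diff[rotated])
  moreover have "resolvent v -` U \<inter> grad_domain v = grad_domain v - (resolvent v -` (- U) \<inter> grad_domain v)"
    by auto
  ultimately show "resolvent v -` U \<inter> space (restrict_space lebesgue (grad_domain v))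
      \<in> sets (restrict_space lebesgue (grad_domain v))"
    using grad_domain_lebesgue[OF assms] by (simp add: sets_restrict_space_iff)
qed

lemma emeasure_distr_resolvent:
  assumes "v \<in> Conv" "B \<in> sets borel"
  shows "emeasure (distr (restrict_space lebesgue (grad_domain v)) borel (resolvent v)) B
    = emeasure lebesgue (subdiff_image v B)"
proof -
  let ?D = "distr (restrict_space lebesgue (grad_domain v)) borel (resolvent v)"
  have D: "grad_domain v \<in> sets lebesgue" using grad_domain_lebesgue[OF assms(1)] .
  have "resolvent v -` B \<inter> grad_domain v \<in> sets (restrict_space lebesgue (grad_domain v))"
    using measurable_sets[OF resolvent_measurable[OF assms(1)] assms(2)] by simp
  then have m: "resolvent v -` B \<inter> grad_domain v \<in> sets lebesgue"
    using D by (simp add: sets_restrict_space_iff)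
  have "emeasure ?D B = emeasure (restrict_space lebesgue (grad_domain v)) (resolvent v -` B \<inter> grad_domain v)"
    using assms(2) by (simp add: emeasure_distr[OF resolvent_measurable[OF assms(1)]])
  also have "\<dots> = emeasure lebesgue (resolvent v -` B \<inter> grad_domain v)"
    using D by (subst emeasure_restrict_space) auto
  also have "\<dots> = emeasure lebesgue (subdiff_image v B)"
    by (rule emeasure_lebesgue_squeeze[OF resolvent_vimage negligible_multi_subgrad[OF assms(1)] m, symmetric])
  finally show ?thesis .
qed

text \<open>\<open>measure_of\<close> keeps the set function in \<open>MA\<close> only if it is
  countably additive, which is not visible from its formula. Agreement on Borel sets with a genuine
  image measure supplies this, and gives integrals over \<open>MA\<close> as Lebesgue
  integrals.\<close>

lemma MA_eq_distr:
  assumes "v \<in> Conv"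
  shows "MA v = distr (restrict_space lebesgue (grad_domain v)) borel (resolvent v)"
proof -
  let ?D = "distr (restrict_space lebesgue (grad_domain v)) borel (resolvent v)"
  have "MA v = measure_of UNIV (sets borel) (emeasure ?D)"
    unfolding MA_def
    by (rule measure_of_eq)
      (use emeasure_distr_resolvent[OF assms] in \<open>auto simp: subdiff_image_def sets.sigma_sets_eq[of borel, simplified]\<close>)
  also have "\<dots> = measure_of (space ?D) (sets ?D) (emeasure ?D)" by simp
  also have "\<dots> = ?D" by (rule measure_of_of_measure)
  finally show ?thesis .
qed

lemma emeasure_MA:
  "v \<in> Conv \<Longrightarrow> B \<in> sets borel \<Longrightarrow> emeasure (MA v) B = emeasure lebesgue (subdiff_image v B)"
  by (simp add: MA_eq_distr emeasure_distr_resolvent)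

definition MA_integrand :: "(real^'n \<Rightarrow> real^'n) \<Rightarrow> (real^'n \<Rightarrow> real) \<Rightarrow> real^'n \<Rightarrow> real^'n" where
  "MA_integrand \<psi> v y = (if y \<in> grad_domain v then \<psi> (resolvent v y) else 0)"

lemma MA_integrand_eq_indicator:
  "MA_integrand \<psi> v = (\<lambda>y. indicator (grad_domain v) y *\<^sub>R \<psi> (resolvent v y))"
  by (auto simp: MA_integrand_def)

lemma Cc_borel: "\<psi> \<in> Cc \<Longrightarrow> \<psi> \<in> borel_measurable borel"
  by (auto simp: Cc_def intro: borel_measurable_continuous_onI)

lemma CcE:
  assumes "\<psi> \<in> Cc"
  obtains R B where "\<And>x. norm (\<psi> x) \<le> B" "\<And>x. \<psi> x \<noteq> 0 \<Longrightarrow> norm x \<le> R" "0 \<le> R"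
proof -
  let ?K = "closure {x. \<psi> x \<noteq> 0}"
  have "compact ?K" using assms by (simp add: Cc_def)
  then have "bounded (\<psi> ` ?K)"
    using assms by (intro compact_imp_bounded compact_continuous_image) (auto simp: Cc_def intro: continuous_on_subset)
  then obtain B where B: "B > 0" "\<And>x. x \<in> ?K \<Longrightarrow> norm (\<psi> x) \<le> B" by (auto simp: bounded_pos)
  obtain R where R: "R > 0" "\<And>x. x \<in> ?K \<Longrightarrow> norm x \<le> R"
    using compact_imp_bounded[OF \<open>compact ?K\<close>] by (auto simp: bounded_pos)
  have "norm (\<psi> x) \<le> B" for x
    using B closure_subset[of "{x. \<psi> x \<noteq> 0}"] by (cases "\<psi> x = 0") auto
  then show thesis using R closure_subset[of "{x. \<psi> x \<noteq> 0}"] by (intro that[of B R]) auto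
qed

lemma Cc_I:
  assumes "continuous_on UNIV \<psi>" "\<And>x. \<psi> x \<noteq> 0 \<Longrightarrow> norm x \<le> R"
  shows "\<psi> \<in> Cc"
proof -
  have "bounded {x. \<psi> x \<noteq> 0}" using assms(2) by (auto simp: bounded_iff)
  then show ?thesis using assms(1) by (simp add: Cc_def compact_closure)
qed

lemma MA_integrand_measurable:
  assumes "v \<in> Conv" "\<psi> \<in> borel_measurable borel"
  shows "MA_integrand \<psi> v \<in> borel_measurable lebesgue"
  unfolding MA_integrand_eq_indicator
  using measurable_comp[OF resolvent_measurable[OF assms(1)] assms(2)] grad_domain_lebesgue[OF assms(1)]
  by (subst borel_measurable_restrict_space_iff[symmetric]) (auto simp: o_def)

lemma integral_MA:
  assumes "v \<in> Conv" "\<psi> \<in> borel_measurable borel"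
  shows "integral\<^sup>L (MA v) \<psi> = integral\<^sup>L lebesgue (MA_integrand \<psi> v)"
proof -
  have "integral\<^sup>L (MA v) \<psi> = integral\<^sup>L (restrict_space lebesgue (grad_domain v)) (\<lambda>y. \<psi> (resolvent v y))"
    unfolding MA_eq_distr[OF assms(1)] by (rule integral_distr[OF resolvent_measurable[OF assms(1)] assms(2)])
  also have "\<dots> = integral\<^sup>L lebesgue (MA_integrand \<psi> v)"
    unfolding MA_integrand_eq_indicator
    using grad_domain_lebesgue[OF assms(1)] by (subst integral_restrict_space) auto
  finally show ?thesis .
qed

text \<open>Where the integrand is not 0, the resolvent lies in the ball of radius R, so
  \<open>subdiff_bound\<close> applies to y. The bound depends on v only through M and thus
  dominates whole sequences.\<close>

lemma MA_integrand_bound: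
  assumes "\<And>x. norm (\<psi> x) \<le> B" "\<And>x. \<psi> x \<noteq> 0 \<Longrightarrow> norm x \<le> R" 
    "\<And>x. norm x \<le> R + 1 \<Longrightarrow> \<bar>v x\<bar> \<le> M"
  shows "norm (MA_integrand \<psi> v y) \<le> B * indicator (cball 0 (2 * M)) y"
proof (cases "MA_integrand \<psi> v y = 0")
  case True
  then show ?thesis using assms(1)[of 0] norm_ge_zero[of "\<psi> 0"] by (auto simp: indicator_def simp del: norm_ge_zero)
next
  case False
  then have y: "y \<in> grad_domain v" "\<psi> (resolvent v y) \<noteq> 0" by (auto simp: MA_integrand_def split: if_splits)
  then have "norm (resolvent v y) \<le> R" using assms(2) by blast
  then have "norm y \<le> 2 * M" using assms(3) by (rule subdiff_bound[OF resolvent[OF y(1)]])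
  then show ?thesis using assms(1) y by (simp add: MA_integrand_def)
qed

lemma integrable_cball_indicator: "integrable lebesgue (\<lambda>y. B * indicator (cball (0::real^'n) M) y :: real)"
  using emeasure_bounded_finite[of "cball (0::real^'n) M"]
  by (intro integrable_mult_right integrable_real_indicator) auto

lemma MA_integrand_integrable:
  assumes "v \<in> Conv" "\<psi> \<in> Cc"
  shows "integrable lebesgue (MA_integrand \<psi> v)"
proof -
  obtain R B where RB: "\<And>x. norm (\<psi> x) \<le> B" "\<And>x. \<psi> x \<noteq> 0 \<Longrightarrow> norm x \<le> R" using CcE[OF assms(2)] by metis
  obtain M where M: "\<And>x. norm x \<le> R + 1 \<Longrightarrow> \<bar>v x\<bar> \<le> M" using Conv_bounded_on_ball[OF assms(1)] by metis
  show ?thesis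
  proof (rule Bochner_Integration.integrable_bound[OF integrable_cball_indicator[of B "2 * M"]])
    show "MA_integrand \<psi> v \<in> borel_measurable lebesgue"
      using assms by (intro MA_integrand_measurable Cc_borel)
    show "AE y in lebesgue. norm (MA_integrand \<psi> v y) \<le> norm (B * indicator (cball 0 (2 * M)) y)"
    proof (rule AE_I2)
      fix y
      have "norm (MA_integrand \<psi> v y) \<le> B * indicator (cball 0 (2 * M)) y"
        using RB M by (rule MA_integrand_bound)
      then show "norm (MA_integrand \<psi> v y) \<le> norm (B * indicator (cball 0 (2 * M)) y)" by simp
    qed
  qed
qed

section \<open>Valuations given by integration\<close>

text \<open>The point x is the strict minimiser of v - <y,.>. The gap to the values on a small
  sphere survives a small uniform perturbation, and convexity then traps all minimisers of the
  perturbed function inside the sphere.\<close>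

lemma grad_domain_convergence:
  assumes v: "v \<in> Conv" and V: "\<And>k. V k \<in> Conv" and lu: "locally_uniform V v"
    and y: "y \<in> subdiff v x" "y \<notin> multi_subgrad v" and r: "r > 0"
  shows "\<forall>\<^sub>F k in sequentially. y \<in> grad_domain (V k) \<and> dist (resolvent (V k) y) x < r"
proof -
  define h where "h w p = w p - y \<bullet> p" for w and p :: "real^'a"
  have h_conv: "h w \<in> Conv" if "w \<in> Conv" for w
    using Conv_affine[OF that, of "- y" 0] by (simp add: h_def[abs_def])
  have min: "h v x < h v p" if "p \<noteq> x" for p
  proof (rule ccontr)
    assume "\<not> h v x < h v p"
    then have "h v p \<le> h v q" for q
      using y(1) unfolding subdiff_alt h_def by (meson linorder_not_less order_trans)
    then have "y \<in> subdiff v p" by (simp add: subdiff_alt h_def)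
    then show False using y that by (auto simp: multi_subgrad_def)
  qed
  let ?S = "sphere x r"
  have "compact ?S" "?S \<noteq> {}" using r by auto
  then obtain p0 where p0: "p0 \<in> ?S" "\<And>p. p \<in> ?S \<Longrightarrow> h v p0 \<le> h v p"
    using continuous_attains_inf[OF _ _ Conv_continuous[OF h_conv[OF v]], of ?S] by blast
  \<comment> \<open>Half of the gap, since the perturbation acts both at x and at the point of the
    sphere.\<close>
  define e where "e = (h v p0 - h v x) / 2"
  have "e > 0" using min[of p0] p0(1) r by (auto simp: e_def)
  have "\<forall>\<^sub>F k in sequentially. \<forall>p. norm p \<le> norm x + r \<longrightarrow> \<bar>V k p - v p\<bar> < e"
    using lu \<open>e > 0\<close> by (auto simp: locally_uniform_def)
  then show ?thesis
  proof eventually_elim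
    fix k assume k: "\<forall>p. norm p \<le> norm x + r \<longrightarrow> \<bar>V k p - v p\<bar> < e"
    have sphere: "h (V k) x < h (V k) p" if "p \<in> ?S" for p
    proof -
      have "norm p \<le> norm x + r"
        using that norm_triangle_ineq[of x "p - x"] by (simp add: dist_norm norm_minus_commute)
      then have "\<bar>V k p - v p\<bar> < e" "\<bar>V k x - v x\<bar> < e" using k r by auto
      moreover have "2 * e \<le> h v p - h v x" using p0(2)[OF that] by (simp add: e_def)
      ultimately show ?thesis by (simp add: h_def)
    qed
    \<comment> \<open>The segment from x to p crosses the sphere, where the function is already
      larger than at x; by convexity it is still larger at p.\<close>
    have outside: "h (V k) x < h (V k) p" if "dist p x \<ge> r" for p
    proof -
      define t where "t = r / dist p x"
      have "dist p x > 0" using that r by linarith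
      then have t: "0 < t" "t \<le> 1" using that r by (simp_all add: t_def)
      have "dist ((1 - t) *\<^sub>R x + t *\<^sub>R p) x = r"
      proof -
        have "(1 - t) *\<^sub>R x + t *\<^sub>R p - x = t *\<^sub>R (p - x)" by (simp add: algebra_simps)
        then show ?thesis using t r \<open>dist p x > 0\<close> by (simp add: dist_norm t_def)
      qed
      then have "h (V k) x < h (V k) ((1 - t) *\<^sub>R x + t *\<^sub>R p)" by (intro sphere) (simp add: dist_commute)
      also have "\<dots> \<le> (1 - t) * h (V k) x + t * h (V k) p"
        using t by (intro Conv_D h_conv V) auto
      finally have "t * h (V k) x < t * h (V k) p" by (simp add: algebra_simps)
      then show ?thesis using t by simp
    qed
    obtain m where m: "m \<in> cball x r" "\<And>p. p \<in> cball x r \<Longrightarrow> h (V k) m \<le> h (V k) p"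
      using continuous_attains_inf[OF _ _ Conv_continuous[OF h_conv[OF V[of k]]], of "cball x r"] r by force
    have "h (V k) m \<le> h (V k) p" for p
      using m(2)[of p] m(2)[of x] outside[of p] r by (cases "dist p x \<ge> r") (auto simp: dist_commute)
    then have "y \<in> subdiff (V k) m" by (simp add: subdiff_alt h_def)
    then have D: "y \<in> grad_domain (V k)" by (rule grad_domainI)
    have "h (V k) (resolvent (V k) y) \<le> h (V k) x"
      using resolvent[OF D] by (simp add: subdiff_alt h_def)
    then have "dist (resolvent (V k) y) x < r"
      using outside[of "resolvent (V k) y"] by (meson linorder_not_le)
    then show "y \<in> grad_domain (V k) \<and> dist (resolvent (V k) y) x < r" using D by simp
  qed
qed

lemma subdiff_limit:
  assumes v: "v \<in> Conv" and lu: "locally_uniform V v"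
    and y: "\<And>k. y \<in> subdiff (V k) (X k)" and X: "X \<longlonglongrightarrow> x"
  shows "y \<in> subdiff v x"
proof -
  have unif: "(\<lambda>k. V k (Z k) - v (Z k)) \<longlonglongrightarrow> 0" if "Z \<longlonglongrightarrow> a" for Z a
  proof -
    have "Bseq Z" using that convergentI convergent_imp_Bseq by blast
    then obtain R where R: "\<And>k. norm (Z k) \<le> R" by (auto simp: Bseq_def)
    show ?thesis
    proof (rule tendstoI)
      fix e :: real assume "e > 0"
      then have "\<forall>\<^sub>F k in sequentially. \<forall>p. norm p \<le> R \<longrightarrow> \<bar>V k p - v p\<bar> < e"
        using lu by (auto simp: locally_uniform_def)
      then show "\<forall>\<^sub>F k in sequentially. dist (V k (Z k) - v (Z k)) 0 < e"
        by eventually_elim (use R in auto)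
    qed
  qed
  have lim: "(\<lambda>k. V k (Z k)) \<longlonglongrightarrow> v a" if "Z \<longlonglongrightarrow> a" for Z a
  proof -
    have "isCont v a" using Conv_continuous[OF v, of UNIV] by (simp add: continuous_on_eq_continuous_at)
    then have "(\<lambda>k. v (Z k)) \<longlonglongrightarrow> v a" using that by (rule isCont_tendsto_compose)
    from tendsto_add[OF unif[OF that] this] show ?thesis by simp
  qed
  have "v x + y \<bullet> (p - x) \<le> v p" for p
  proof (rule LIMSEQ_le)
    show "(\<lambda>k. V k (X k) + y \<bullet> (p - X k)) \<longlonglongrightarrow> v x + y \<bullet> (p - x)"
      by (intro tendsto_intros lim X)
    show "(\<lambda>k. V k p) \<longlonglongrightarrow> v p" by (rule lim) simp
    show "\<exists>N. \<forall>k\<ge>N. V k (X k) + y \<bullet> (p - X k) \<le> V k p" using subdiffD[OF y] by auto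
  qed
  then show ?thesis by (simp add: subdiff_def)
qed

lemma locally_uniform_subseq:
  "locally_uniform V v \<Longrightarrow> strict_mono (r :: nat \<Rightarrow> nat) \<Longrightarrow> locally_uniform (V \<circ> r) v"
  unfolding locally_uniform_def o_def using eventually_subseq by fast

text \<open>If y is attained by v, the resolvents converge. If not, the resolvents of V k may exist
  but must leave the support of \<psi>: otherwise they would accumulate at a point x, and closedness
  under limits would make y a subgradient of v at x.\<close>

lemma MA_integrand_convergence:
  assumes v: "v \<in> Conv" and V: "\<And>k. V k \<in> Conv" and lu: "locally_uniform V v"
    and \<psi>: "\<psi> \<in> Cc" and y: "y \<notin> multi_subgrad v"
  shows "(\<lambda>k. MA_integrand \<psi> (V k) y) \<longlonglongrightarrow> MA_integrand \<psi> v y"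
proof (cases "y \<in> grad_domain v")
  case True
  let ?x = "resolvent v y"
  have x: "y \<in> subdiff v ?x" using resolvent[OF True] .
  have ev: "\<forall>\<^sub>F k in sequentially. y \<in> grad_domain (V k) \<and> dist (resolvent (V k) y) ?x < r" if "r > 0" for r
    using grad_domain_convergence[OF v V lu x y that] .
  have "(\<lambda>k. resolvent (V k) y) \<longlonglongrightarrow> ?x"
    unfolding tendsto_iff using ev eventually_mono by fast
  moreover have "isCont \<psi> ?x" using \<psi> by (auto simp: Cc_def continuous_on_eq_continuous_at)
  ultimately have "(\<lambda>k. \<psi> (resolvent (V k) y)) \<longlonglongrightarrow> \<psi> ?x" by (rule isCont_tendsto_compose[rotated])
  moreover have "\<forall>\<^sub>F k in sequentially. \<psi> (resolvent (V k) y) = MA_integrand \<psi> (V k) y"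
    using ev[of 1] by (auto simp: MA_integrand_def elim!: eventually_mono)
  ultimately show ?thesis
    using True by (simp add: MA_integrand_def[of \<psi> v] Lim_transform_eventually)
next
  case False
  obtain R B where RB: "\<And>x. norm (\<psi> x) \<le> B" "\<And>x. \<psi> x \<noteq> 0 \<Longrightarrow> norm x \<le> R" using CcE[OF \<psi>] by metis
  have "\<forall>\<^sub>F k in sequentially. MA_integrand \<psi> (V k) y = 0"
  proof (rule ccontr)
    assume "\<not> ?thesis"
    then have "\<exists>\<^sub>F k in sequentially. MA_integrand \<psi> (V k) y \<noteq> 0" by (simp add: frequently_def)
    then obtain r :: "nat \<Rightarrow> nat" where r: "strict_mono r" "\<And>k. MA_integrand \<psi> (V (r k)) y \<noteq> 0"
      using infinite_enumerate[of "{k. MA_integrand \<psi> (V k) y \<noteq> 0}"]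
      by (auto simp: frequently_cofinite[symmetric] cofinite_eq_sequentially)
    define X where "X k = resolvent (V (r k)) y" for k
    have X: "y \<in> subdiff (V (r k)) (X k)" "\<psi> (X k) \<noteq> 0" for k
      using r(2)[of k] resolvent[of y "V (r k)"] by (auto simp: MA_integrand_def X_def split: if_splits)
    then have "\<forall>k. X k \<in> cball 0 R" using RB(2) by auto
    then obtain x s where s: "strict_mono (s :: nat \<Rightarrow> nat)" "(X \<circ> s) \<longlonglongrightarrow> x"
      using compact_cball[of 0 R] unfolding compact_def by metis
    have "y \<in> subdiff v x"
    proof (rule subdiff_limit[OF v _ _ s(2)])
      show "locally_uniform (V \<circ> (r \<circ> s)) v"
        using lu r(1) s(1) by (intro locally_uniform_subseq strict_mono_o)
    qed (use X in auto)
    then show False using False grad_domainI by blast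
  qed
  then have "(\<lambda>k. MA_integrand \<psi> (V k) y) \<longlonglongrightarrow> 0" by (rule tendsto_eventually)
  then show ?thesis using False by (simp add: MA_integrand_def[of \<psi> v])
qed

lemma AE_not_negligible: "negligible N \<Longrightarrow> (\<And>y. y \<notin> N \<Longrightarrow> P y) \<Longrightarrow> AE y in lebesgue. P y"
  by (auto simp: negligible_iff_null_sets intro: AE_I'[of N])

lemma integral_MA_locally_uniform:
  assumes v: "v \<in> Conv" and V: "\<And>k. V k \<in> Conv" and lu: "locally_uniform V v" and \<psi>: "\<psi> \<in> Cc"
  shows "(\<lambda>k. integral\<^sup>L (MA (V k)) \<psi>) \<longlonglongrightarrow> integral\<^sup>L (MA v) \<psi>"
proof -
  obtain R B where RB: "\<And>x. norm (\<psi> x) \<le> B" "\<And>x. \<psi> x \<noteq> 0 \<Longrightarrow> norm x \<le> R" using CcE[OF \<psi>] by metis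
  obtain M where M: "\<And>x. norm x \<le> R + 1 \<Longrightarrow> \<bar>v x\<bar> \<le> M" using Conv_bounded_on_ball[OF v] by metis
  have "\<forall>\<^sub>F k in sequentially. \<forall>x. norm x \<le> R + 1 \<longrightarrow> \<bar>V k x - v x\<bar> < 1"
    using lu by (auto simp: locally_uniform_def)
  then obtain K where K: "\<And>k x. K \<le> k \<Longrightarrow> norm x \<le> R + 1 \<Longrightarrow> \<bar>V k x - v x\<bar> < 1"
    unfolding eventually_sequentially by blast
  have VM: "\<bar>V (k + K) x\<bar> \<le> M + 1" if "norm x \<le> R + 1" for x k
    using K[of "k + K" x] M[of x] that by auto
  have "(\<lambda>k. integral\<^sup>L lebesgue (MA_integrand \<psi> (V (k + K)))) \<longlonglongrightarrow> integral\<^sup>L lebesgue (MA_integrand \<psi> v)"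
  proof (rule integral_dominated_convergence[where w = "\<lambda>y. B * indicator (cball 0 (2 * (M + 1))) y"])
    show "AE y in lebesgue. (\<lambda>k. MA_integrand \<psi> (V (k + K)) y) \<longlonglongrightarrow> MA_integrand \<psi> v y"
      using negligible_multi_subgrad[OF v]
      by (rule AE_not_negligible) (intro LIMSEQ_ignore_initial_segment MA_integrand_convergence v V lu \<psi>)
    show "AE y in lebesgue. norm (MA_integrand \<psi> (V (k + K)) y) \<le> B * indicator (cball 0 (2 * (M + 1))) y" for k
      using MA_integrand_bound[of \<psi> B R, OF RB VM] by (intro AE_I2)
    show "integrable lebesgue (\<lambda>y. B * indicator (cball (0::real^'a) (2 * (M + 1))) y :: real)"
      by (rule integrable_cball_indicator)
  qed (use v V \<psi> in \<open>auto intro!: MA_integrand_measurable Cc_borel\<close>)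
  then have "(\<lambda>k. integral\<^sup>L lebesgue (MA_integrand \<psi> (V k))) \<longlonglongrightarrow> integral\<^sup>L lebesgue (MA_integrand \<psi> v)"
    by (rule LIMSEQ_offset)
  then show ?thesis using v V \<psi> by (simp add: integral_MA Cc_borel)
qed

lemma MA_continuous:
  fixes z :: "(real^'n \<Rightarrow> real) \<Rightarrow> real^'n"
  assumes "\<psi> \<in> Cc" "\<And>v. v \<in> Conv \<Longrightarrow> z v = integral\<^sup>L (MA v) \<psi>"
  shows "continuous_map Conv_top euclidean z"
proof (rule continuous_map_Conv_topI)
  fix v :: "real^'n \<Rightarrow> real" and V assume "v \<in> Conv" "\<And>k. V k \<in> Conv" "locally_uniform V v"
  then show "(\<lambda>k. z (V k)) \<longlonglongrightarrow> z v"
    using assms integral_MA_locally_uniform[of v V \<psi>] by simp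
qed

section \<open>The valuation property by comparing minimisers\<close>

text \<open>A crossing point of \<open>f\<close> and \<open>g\<close> on the segment from \<open>p\<close> to \<open>q\<close> does the job.\<close>
lemma min_convex_common_point:
  fixes f g :: "real^'n \<Rightarrow> real"
  assumes f: "f \<in> Conv" and g: "g \<in> Conv" and m: "(\<lambda>x. min (f x) (g x)) \<in> Conv"
  obtains r where "f r \<le> max (f p) (g q)" "g r \<le> max (f p) (g q)"
proof (cases "g p \<le> f p \<or> f q \<le> g q")
  case True
  then show thesis using that[of p] that[of q] by fastforce
next
  case False
  then have lt: "f p < g p" "g q < f q" by auto
  define c where "c t = (1 - t) *\<^sub>R p + t *\<^sub>R q" for t :: real
  have cont: "continuous_on {0..1} (\<lambda>t. g (c t) - f (c t))"
    unfolding c_def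
    by (intro continuous_intros continuous_on_compose2[OF Conv_continuous[OF f, of UNIV]]
        continuous_on_compose2[OF Conv_continuous[OF g, of UNIV]]) auto
  obtain t where t: "0 \<le> t" "t \<le> 1" "g (c t) - f (c t) = 0"
    using IVT2'[of "\<lambda>t. g (c t) - f (c t)" 1 0 0] cont lt by (auto simp: c_def)
  have "min (f (c t)) (g (c t)) \<le> (1 - t) * min (f p) (g p) + t * min (f q) (g q)"
    unfolding c_def by (rule Conv_D[OF m t(1,2)])
  also have "\<dots> \<le> (1 - t) * max (f p) (g q) + t * max (f p) (g q)"
    using t lt by (intro add_mono mult_left_mono) auto
  finally show thesis using t that[of "c t"] by (simp add: algebra_simps)
qed

definition minimizer :: "('a \<Rightarrow> real) \<Rightarrow> 'a \<Rightarrow> bool" where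
  "minimizer h x \<longleftrightarrow> (\<forall>p. h x \<le> h p)"

text \<open>The value f p lies below all values of g, so only f matters for the minimum. For the
  maximum, the common points r show that g can be brought below any of its values without f
  exceeding that value; uniqueness identifies such an r with the minimiser of g.\<close>

lemma minimizer_max_min_less:
  assumes common: "\<And>q. \<exists>r. f r \<le> max (f p) (g q) \<and> g r \<le> max (f p) (g q)"
    and less: "\<And>q. f p < g q"
    and uniq: "\<And>x x'. minimizer g x \<Longrightarrow> minimizer g x' \<Longrightarrow> x = x'"
  shows "minimizer (\<lambda>x. min (f x) (g x)) = minimizer f"
    and "minimizer (\<lambda>x. max (f x) (g x)) = minimizer g"
proof -
  have common': "\<exists>r. f r \<le> g q \<and> g r \<le> g q" for q
    using common[of q] less[of q] by auto
  show "minimizer (\<lambda>x. min (f x) (g x)) = minimizer f"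
  proof (intro ext iffI)
    fix x assume *: "minimizer (\<lambda>x. min (f x) (g x)) x"
    then have "min (f x) (g x) \<le> min (f p) (g p)" by (simp add: minimizer_def)
    then have "f x \<le> g x" using less[of x] by (auto simp: min_def split: if_splits)
    then have "f x \<le> min (f q) (g q)" for q
      using * unfolding minimizer_def by (metis min.absorb1)
    then show "minimizer f x" by (auto simp: minimizer_def)
  next
    fix x assume "minimizer f x"
    then have "f x \<le> f q" "f x < g q" for q using less[of q] by (auto simp: minimizer_def intro: le_less_trans)
    then show "minimizer (\<lambda>x. min (f x) (g x)) x" by (auto simp: minimizer_def intro: less_imp_le min.coboundedI1)
  qed
  show "minimizer (\<lambda>x. max (f x) (g x)) = minimizer g"
  proof (intro ext iffI)
    fix x assume *: "minimizer (\<lambda>x. max (f x) (g x)) x"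
    have "g x \<le> g q" for q
    proof -
      obtain r where "f r \<le> g q" "g r \<le> g q" using common' by blast
      moreover have "max (f x) (g x) \<le> max (f r) (g r)" using * by (simp add: minimizer_def)
      ultimately show ?thesis by linarith
    qed
    then show "minimizer g x" by (simp add: minimizer_def)
  next
    fix x assume *: "minimizer g x"
    obtain r where r: "f r \<le> g x" "g r \<le> g x" using common' by blast
    then have "minimizer g r" using * by (auto simp: minimizer_def intro: order_trans)
    then have "r = x" using uniq * by blast
    then show "minimizer (\<lambda>x. max (f x) (g x)) x" using r * by (auto simp: minimizer_def intro: le_max_iff_disj[THEN iffD2])
  qed
qed

text \<open>The conditions \<open>le\<close> say that f and g have the same infimum and that both or
  neither attain it. Minimisers of either function then minimise the minimum, whose minimiser is
  unique, so they coincide.\<close>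

lemma minimizer_max_min_eq:
  assumes common: "\<And>p q. \<exists>r. f r \<le> max (f p) (g q) \<and> g r \<le> max (f p) (g q)"
    and le: "\<And>p. \<exists>q. g q \<le> f p" "\<And>q. \<exists>p. f p \<le> g q"
    and uniq: "\<And>x x'. minimizer (\<lambda>x. min (f x) (g x)) x \<Longrightarrow> minimizer (\<lambda>x. min (f x) (g x)) x' \<Longrightarrow> x = x'"
  shows "minimizer f = minimizer g" "minimizer (\<lambda>x. min (f x) (g x)) = minimizer g"
    "minimizer (\<lambda>x. max (f x) (g x)) = minimizer g"
proof -
  let ?A = "\<lambda>x. min (f x) (g x)" and ?B = "\<lambda>x. max (f x) (g x)"
  have f_A: "minimizer ?A x" if "minimizer f x" for x
    using that le(2) unfolding minimizer_def by (metis min.coboundedI1 min.boundedI order_trans)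
  have g_A: "minimizer ?A x" if "minimizer g x" for x
    using that le(1) unfolding minimizer_def by (metis min.coboundedI2 min.boundedI order_trans)
  have fg: "minimizer g x" if "minimizer f x" for x
  proof -
    obtain q where q: "g q \<le> f x" using le(1) by blast
    have "g q \<le> g p" for p
      using le(2)[of p] that q unfolding minimizer_def by (meson order_trans)
    then have "minimizer g q" by (simp add: minimizer_def)
    then show ?thesis using uniq f_A[OF that] g_A by blast
  qed
  have gf: "minimizer f x" if "minimizer g x" for x
  proof -
    obtain p where p: "f p \<le> g x" using le(2) by blast
    have "f p \<le> f q" for q
      using le(1)[of q] that p unfolding minimizer_def by (meson order_trans)
    then have "minimizer f p" by (simp add: minimizer_def)
    then show ?thesis using uniq g_A[OF that] f_A by blast
  qed
  show eq: "minimizer f = minimizer g" using fg gf by blast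
  have "minimizer g x" if "minimizer ?A x" for x
  proof (cases "f x \<le> g x")
    case True
    then have "minimizer f x" using that unfolding minimizer_def by (metis min.absorb1 min.boundedE)
    then show ?thesis by (rule fg)
  next
    case False
    then show ?thesis using that unfolding minimizer_def by (metis linorder_le_cases min.absorb2 min.boundedE)
  qed
  then show "minimizer ?A = minimizer g" using g_A by blast
  have "minimizer g x" if "minimizer ?B x" for x
    unfolding minimizer_def
  proof
    fix q
    obtain p where p: "f p \<le> g q" using le(2) by blast
    obtain r where "f r \<le> max (f p) (g q)" "g r \<le> max (f p) (g q)" using common by blast
    moreover have "max (f x) (g x) \<le> max (f r) (g r)" using that by (simp add: minimizer_def)
    ultimately show "g x \<le> g q" using p by linarith
  qed
  moreover have "minimizer ?B x" if "minimizer g x" for x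
    using that gf[OF that] unfolding minimizer_def by (metis max.mono)
  ultimately show "minimizer ?B = minimizer g" by blast
qed

text \<open>Subtracting the linear function with slope y turns subgradients into minimisers. If one
  function has a value below the whole range of the other, minimum and maximum inherit one set of
  minimisers each; otherwise all four sets agree.\<close>

lemma MA_integrand_max_min:
  fixes v w :: "real^'n \<Rightarrow> real"
  assumes v: "v \<in> Conv" and w: "w \<in> Conv" and m: "(\<lambda>x. min (v x) (w x)) \<in> Conv"
    and ex: "y \<notin> multi_subgrad v" "y \<notin> multi_subgrad w" "y \<notin> multi_subgrad (\<lambda>x. min (v x) (w x))"
       "y \<notin> multi_subgrad (\<lambda>x. max (v x) (w x))"
  shows "MA_integrand \<psi> (\<lambda>x. max (v x) (w x)) y + MA_integrand \<psi> (\<lambda>x. min (v x) (w x)) y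
       = MA_integrand \<psi> v y + MA_integrand \<psi> w y"
proof -
  define f g where "f = (\<lambda>p. v p - y \<bullet> p)" and "g = (\<lambda>p. w p - y \<bullet> p)"
  have f: "f \<in> Conv" and g: "g \<in> Conv" and mfg: "(\<lambda>x. min (f x) (g x)) \<in> Conv"
    using Conv_affine[OF v, of "- y" 0] Conv_affine[OF w, of "- y" 0] Conv_affine[OF m, of "- y" 0]
    by (simp_all add: f_def g_def min_diff_distrib_left)
  have sub: "y \<in> subdiff v x \<longleftrightarrow> minimizer f x" "y \<in> subdiff w x \<longleftrightarrow> minimizer g x"
    "y \<in> subdiff (\<lambda>x. min (v x) (w x)) x \<longleftrightarrow> minimizer (\<lambda>x. min (f x) (g x)) x"
    "y \<in> subdiff (\<lambda>x. max (v x) (w x)) x \<longleftrightarrow> minimizer (\<lambda>x. max (f x) (g x)) x" for x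
    by (simp_all add: subdiff_alt minimizer_def f_def g_def min_diff_distrib_left max_diff_distrib_left)
  have uniq: "minimizer f x \<Longrightarrow> minimizer f x' \<Longrightarrow> x = x'" "minimizer g x \<Longrightarrow> minimizer g x' \<Longrightarrow> x = x'"
    "minimizer (\<lambda>x. min (f x) (g x)) x \<Longrightarrow> minimizer (\<lambda>x. min (f x) (g x)) x' \<Longrightarrow> x = x'" for x x'
    using ex unfolding multi_subgrad_def by (auto simp: sub)
  \<comment> \<open>The integrand depends only on the predicate of being a minimiser. Equal
    predicates thus give the same choice under \<open>SOME\<close>, and the cases below need only
    equations between predicates.\<close>
  have val: "MA_integrand \<psi> u y = (if \<exists>x. minimizer h x then \<psi> (SOME x. minimizer h x) else 0)"
    if "\<And>x. y \<in> subdiff u x \<longleftrightarrow> minimizer h x" for u h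
  proof -
    have "y \<in> grad_domain u \<longleftrightarrow> (\<exists>x. minimizer h x)"
      by (auto simp: grad_domain_def subdiff_image_def that)
    moreover have "resolvent u y = (SOME x. minimizer h x)" by (simp add: resolvent_def that)
    ultimately show ?thesis by (simp only: MA_integrand_def)
  qed
  note vals = val[OF sub(1)] val[OF sub(2)] val[OF sub(3)] val[OF sub(4)]
  have common: "\<exists>r. f r \<le> max (f p) (g q) \<and> g r \<le> max (f p) (g q)" for p q
    using min_convex_common_point[OF f g mfg] by metis
  consider (less) p where "\<And>q. f p < g q" | (greater) q where "\<And>p. g q < f p"
    | (eq) "\<And>p. \<exists>q. g q \<le> f p" "\<And>q. \<exists>p. f p \<le> g q"
    by (meson linorder_not_less)
  then show ?thesis
  proof cases
    case less
    have mm: "minimizer (\<lambda>x. min (f x) (g x)) = minimizer f"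
      by (rule minimizer_max_min_less(1)[of f p g, OF common less]) (rule uniq(2))
    have mm': "minimizer (\<lambda>x. max (f x) (g x)) = minimizer g"
      by (rule minimizer_max_min_less(2)[of f p g, OF common less]) (rule uniq(2))
    show ?thesis unfolding vals mm mm' by (simp add: add.commute)
  next
    case greater
    have c: "\<exists>r. g r \<le> max (g q) (f p) \<and> f r \<le> max (g q) (f p)" for p
      using common[of p q] by (auto simp: max.commute)
    have "minimizer (\<lambda>x. min (g x) (f x)) = minimizer g"
      by (rule minimizer_max_min_less(1)[of g q f, OF c greater]) (rule uniq(1))
    then have mm: "minimizer (\<lambda>x. min (f x) (g x)) = minimizer g" by (simp add: min.commute)
    have "minimizer (\<lambda>x. max (g x) (f x)) = minimizer f"
      by (rule minimizer_max_min_less(2)[of g q f, OF c greater]) (rule uniq(1))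
    then have mm': "minimizer (\<lambda>x. max (f x) (g x)) = minimizer f" by (simp add: max.commute)
    show ?thesis unfolding vals mm mm' by simp
  next
    case eq
    have mm: "minimizer f = minimizer g"
      by (rule minimizer_max_min_eq(1)[of f g, OF common eq]) (rule uniq(3))
    have mm': "minimizer (\<lambda>x. min (f x) (g x)) = minimizer g"
      by (rule minimizer_max_min_eq(2)[of f g, OF common eq]) (rule uniq(3))
    have mm'': "minimizer (\<lambda>x. max (f x) (g x)) = minimizer g"
      by (rule minimizer_max_min_eq(3)[of f g, OF common eq]) (rule uniq(3))
    show ?thesis unfolding vals mm mm' mm'' by simp
  qed
qed

lemma MA_valuation:
  fixes v w :: "real^'n \<Rightarrow> real"
  assumes "v \<in> Conv" "w \<in> Conv" "(\<lambda>x. max (v x) (w x)) \<in> Conv" "(\<lambda>x. min (v x) (w x)) \<in> Conv" "\<psi> \<in> Cc"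
  shows "integral\<^sup>L (MA (\<lambda>x. max (v x) (w x))) \<psi> + integral\<^sup>L (MA (\<lambda>x. min (v x) (w x))) \<psi>
       = integral\<^sup>L (MA v) \<psi> + integral\<^sup>L (MA w) \<psi>"
proof -
  let ?A = "\<lambda>x. min (v x) (w x)" and ?B = "\<lambda>x. max (v x) (w x)"
  let ?N = "multi_subgrad v \<union> multi_subgrad w \<union> multi_subgrad ?A \<union> multi_subgrad ?B"
  have "negligible ?N" using assms by (simp add: negligible_multi_subgrad)
  then have "AE y in lebesgue. MA_integrand \<psi> ?B y + MA_integrand \<psi> ?A y = MA_integrand \<psi> v y + MA_integrand \<psi> w y"
    by (rule AE_not_negligible) (use assms in \<open>intro MA_integrand_max_min; simp\<close>)
  then have "(LINT y|lebesgue. MA_integrand \<psi> ?B y + MA_integrand \<psi> ?A y)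
      = (LINT y|lebesgue. MA_integrand \<psi> v y + MA_integrand \<psi> w y)"
    using assms by (intro integral_cong_AE borel_measurable_add MA_integrand_measurable Cc_borel)
  then show ?thesis
    using assms by (simp add: integral_MA Cc_borel MA_integrand_integrable)
qed

section \<open>Affine invariance and homogeneity of \<open>MA\<close>\<close>

lemma MA_affine:
  fixes v :: "real^'n \<Rightarrow> real"
  shows "MA (\<lambda>x. v x + a \<bullet> x + c) = MA v"
proof -
  have sub: "subdiff (\<lambda>x. v x + a \<bullet> x + c) x = (+) a ` subdiff v x" for x
  proof (intro set_eqI iffI)
    fix y assume y: "y \<in> subdiff (\<lambda>x. v x + a \<bullet> x + c) x"
    have "v x + (y - a) \<bullet> (z - x) \<le> v z" for z
      using subdiffD[OF y, of z] by (simp add: inner_simps)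
    then have "y - a \<in> subdiff v x" by (simp add: subdiff_def)
    then show "y \<in> (+) a ` subdiff v x" by (auto intro!: image_eqI[of _ _ "y - a"])
  qed (auto simp: subdiff_def inner_simps)
  have "(\<Union>x\<in>B. subdiff (\<lambda>x. v x + a \<bullet> x + c) x) = (\<lambda>y. 1 *\<^sub>R y + a) ` (\<Union>x\<in>B. subdiff v x)" for B
    unfolding sub by (auto simp: image_iff add.commute)
  then have "emeasure lebesgue (\<Union>x\<in>B. subdiff (\<lambda>x. v x + a \<bullet> x + c) x) = emeasure lebesgue (\<Union>x\<in>B. subdiff v x)" for B
    using emeasure_lebesgue_affine[of 1 a "\<Union>x\<in>B. subdiff v x"] by simp
  then show ?thesis unfolding MA_def by simp
qed

text \<open>Subgradients are dilated by r, so their Lebesgue measure is multiplied by r^n: this is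
  the origin of the degree n.\<close>

lemma MA_scale:
  fixes v :: "real^'n \<Rightarrow> real"
  assumes v: "v \<in> Conv" and r: "r > 0"
  shows "MA (\<lambda>x. r * v x) = density (MA v) (\<lambda>x. ennreal (r ^ CARD('n)))"
proof -
  have rv: "(\<lambda>x. r * v x) \<in> Conv" using v r by (intro Conv_cmul) auto
  have sub: "subdiff (\<lambda>x. r * v x) x = (\<lambda>y. r *\<^sub>R y) ` subdiff v x" for x
  proof (intro set_eqI iffI)
    fix y assume y: "y \<in> subdiff (\<lambda>x. r * v x) x"
    have "v x + (y /\<^sub>R r) \<bullet> (z - x) \<le> v z" for z
      using subdiffD[OF y, of z] r by (simp add: field_simps)
    then have "y /\<^sub>R r \<in> subdiff v x" by (simp add: subdiff_def)
    then show "y \<in> (\<lambda>y. r *\<^sub>R y) ` subdiff v x" using r by (intro image_eqI[of _ _ "y /\<^sub>R r"]) auto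
  next
    fix y assume "y \<in> (\<lambda>y. r *\<^sub>R y) ` subdiff v x"
    then obtain y' where y': "y = r *\<^sub>R y'" "y' \<in> subdiff v x" by blast
    have "r * v x + y \<bullet> (z - x) \<le> r * v z" for z
      using mult_left_mono[OF subdiffD[OF y'(2), of z], of r] r by (simp add: y'(1) algebra_simps)
    then show "y \<in> subdiff (\<lambda>x. r * v x) x" by (simp add: subdiff_def)
  qed
  have im: "(\<Union>x\<in>B. subdiff (\<lambda>x. r * v x) x) = (\<lambda>y. r *\<^sub>R y + 0) ` (\<Union>x\<in>B. subdiff v x)" for B
    unfolding sub by auto
  have em: "emeasure (MA w) B = emeasure lebesgue (\<Union>x\<in>B. subdiff w x)" if "w \<in> Conv" "B \<in> sets borel" for w B
  proof -
    have "emeasure (MA w) B = emeasure lebesgue (subdiff_image w B)"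
      by (rule emeasure_MA[OF that])
    then show ?thesis by (simp add: subdiff_image_def)
  qed
  have sets: "sets (MA w) = sets borel" if "w \<in> Conv" for w :: "real^'n \<Rightarrow> real"
    using that by (simp add: MA_eq_distr)
  show ?thesis
  proof (rule measure_eqI)
    fix B assume "B \<in> sets (MA (\<lambda>x. r * v x))"
    then have B: "B \<in> sets borel" using sets[OF rv] by simp
    have "emeasure (MA (\<lambda>x. r * v x)) B = ennreal (r ^ CARD('n)) * emeasure (MA v) B"
      using B em[OF rv B] em[OF v B] emeasure_lebesgue_affine[of r 0 "\<Union>x\<in>B. subdiff v x"] r
      unfolding im by simp
    then show "emeasure (MA (\<lambda>x. r * v x)) B = emeasure (density (MA v) (\<lambda>x. ennreal (r ^ CARD('n)))) B"
      using B sets[OF v] by (simp add: emeasure_density nn_integral_cmult_indicator)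
  qed (simp add: sets v rv)
qed

lemma MA_homogeneous:
  fixes v :: "real^'n \<Rightarrow> real" and \<psi> :: "real^'n \<Rightarrow> real^'n"
  assumes v: "v \<in> Conv" and r: "r > 0" and \<psi>: "\<psi> \<in> borel_measurable borel"
  shows "integral\<^sup>L (MA (\<lambda>x. r * v x)) \<psi> = r ^ CARD('n) *\<^sub>R integral\<^sup>L (MA v) \<psi>"
proof -
  have "\<psi> \<in> borel_measurable (MA v)" using \<psi> v by (simp add: MA_eq_distr)
  then show ?thesis unfolding MA_scale[OF v r] using r by (subst integral_density) auto
qed

lemma MA_integral_properties:
  fixes z :: "(real^'n \<Rightarrow> real) \<Rightarrow> real^'n"
  assumes \<psi>: "\<psi> \<in> Cc" and z: "\<And>v. v \<in> Conv \<Longrightarrow> z v = integral\<^sup>L (MA v) \<psi>"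
  shows "continuous_map Conv_top euclidean z" "is_valuation z"
    "dually_epi_translation_invariant z" "homogeneous_deg CARD('n) z"
proof -
  show "continuous_map Conv_top euclidean z" using MA_continuous[OF \<psi> z] .
  show "is_valuation z"
    unfolding is_valuation_def using \<psi> by (simp add: z MA_valuation)
  show "dually_epi_translation_invariant z"
    unfolding dually_epi_translation_invariant_def by (simp add: z Conv_affine MA_affine)
  show "homogeneous_deg CARD('n) z"
    unfolding homogeneous_deg_def using \<psi> by (simp add: z Conv_cmul MA_homogeneous Cc_borel)
qed

section \<open>Conjugates restricted to boxes\<close>

definition conj_on :: "(real^'n \<Rightarrow> real) \<Rightarrow> (real^'n) set \<Rightarrow> real^'n \<Rightarrow> real" where
  "conj_on u K x = (SUP y\<in>K. x \<bullet> y - u y)"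

lemma conj_on_attained:
  assumes "compact K" "K \<noteq> {}" "continuous_on K u"
  obtains y where "y \<in> K" "conj_on u K x = x \<bullet> y - u y" "\<And>y'. y' \<in> K \<Longrightarrow> x \<bullet> y' - u y' \<le> x \<bullet> y - u y"
proof -
  have "continuous_on K (\<lambda>y. x \<bullet> y - u y)" using assms(3) by (intro continuous_intros)
  from continuous_attains_sup[OF assms(1,2) this] obtain y where
    y: "y \<in> K" "\<And>y'. y' \<in> K \<Longrightarrow> x \<bullet> y' - u y' \<le> x \<bullet> y - u y" by blast
  then have "conj_on u K x = x \<bullet> y - u y"
    unfolding conj_on_def by (intro cSup_eq_maximum) auto
  then show thesis using y that by blast
qed

lemma conj_on_eqI:
  "y \<in> K \<Longrightarrow> (\<And>y'. y' \<in> K \<Longrightarrow> x \<bullet> y' - u y' \<le> x \<bullet> y - u y) \<Longrightarrow> conj_on u K x = x \<bullet> y - u y"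
  unfolding conj_on_def by (intro cSup_eq_maximum) auto

lemma conj_on_upper:
  assumes "compact K" "continuous_on K u" "y \<in> K"
  shows "x \<bullet> y - u y \<le> conj_on u K x"
  using conj_on_attained[OF assms(1) _ assms(2), of x] assms(3) by (metis empty_iff)

lemma conj_on_Conv:
  assumes "compact K" "K \<noteq> {}" "continuous_on K u"
  shows "conj_on u K \<in> Conv"
proof -
  have "convex_on UNIV (conj_on u K)"
  proof (rule convex_onI)
    fix t :: real and x x' :: "real^'a" assume t: "0 < t" "t < 1"
    obtain y where y: "y \<in> K" "conj_on u K ((1 - t) *\<^sub>R x + t *\<^sub>R x') = ((1 - t) *\<^sub>R x + t *\<^sub>R x') \<bullet> y - u y"
      using conj_on_attained[OF assms] by metis
    have "((1 - t) *\<^sub>R x + t *\<^sub>R x') \<bullet> y - u y = (1 - t) * (x \<bullet> y - u y) + t * (x' \<bullet> y - u y)"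
      by (simp add: inner_simps algebra_simps)
    also have "\<dots> \<le> (1 - t) * conj_on u K x + t * conj_on u K x'"
      using t conj_on_upper[OF assms(1,3) y(1)] by (intro add_mono mult_left_mono) auto
    finally show "conj_on u K ((1 - t) *\<^sub>R x + t *\<^sub>R x') \<le> (1 - t) * conj_on u K x + t * conj_on u K x'"
      using y by simp
  qed simp
  then show ?thesis by (simp add: Conv_def)
qed

lemma conj_on_Un:
  assumes "compact K" "K \<noteq> {}" "compact L" "L \<noteq> {}" "continuous_on (K \<union> L) u"
  shows "conj_on u (K \<union> L) x = max (conj_on u K x) (conj_on u L x)"
proof -
  have cont: "continuous_on K u" "continuous_on L u" using assms(5) continuous_on_subset by blast+
  obtain p where p: "p \<in> K" "conj_on u K x = x \<bullet> p - u p" "\<And>y'. y' \<in> K \<Longrightarrow> x \<bullet> y' - u y' \<le> x \<bullet> p - u p"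
    using conj_on_attained[OF assms(1,2) cont(1)] by metis
  obtain q where q: "q \<in> L" "conj_on u L x = x \<bullet> q - u q" "\<And>y'. y' \<in> L \<Longrightarrow> x \<bullet> y' - u y' \<le> x \<bullet> q - u q"
    using conj_on_attained[OF assms(3,4) cont(2)] by metis
  show ?thesis
  proof (cases "x \<bullet> p - u p \<le> x \<bullet> q - u q")
    case True
    then have "conj_on u (K \<union> L) x = x \<bullet> q - u q"
      using p q by (intro conj_on_eqI) (auto intro: order_trans)
    then show ?thesis using p q True by simp
  next
    case False
    then have "x \<bullet> q - u q \<le> x \<bullet> p - u p" by simp
    then have "conj_on u (K \<union> L) x = x \<bullet> p - u p"
      using p q by (intro conj_on_eqI) (auto intro: order_trans)
    then show ?thesis using p q False by simp
  qed
qed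

text \<open>The segment joining the maximisers over \<open>K\<close> and \<open>L\<close> meets \<open>K \<inter> L\<close>, and concavity applies there.\<close>
lemma conj_on_Int:
  assumes K: "compact K" "K \<noteq> {}" and L: "compact L" "L \<noteq> {}" and KL: "convex (K \<union> L)" and u: "u \<in> Conv"
  shows "K \<inter> L \<noteq> {}" "conj_on u (K \<inter> L) x = min (conj_on u K x) (conj_on u L x)"
proof -
  note cont = Conv_continuous[OF u]
  obtain p where p: "p \<in> K" "conj_on u K x = x \<bullet> p - u p" using conj_on_attained[OF K cont] by metis
  obtain q where q: "q \<in> L" "conj_on u L x = x \<bullet> q - u q" using conj_on_attained[OF L cont] by metis
  have sub: "closed_segment p q \<subseteq> K \<union> L" using p q KL by (intro closed_segment_subset) auto
  have "closed_segment p q \<inter> K \<inter> L \<noteq> {}"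
  proof (rule ccontr)
    assume "\<not> ?thesis"
    then have "K \<inter> L \<inter> closed_segment p q = {}" by blast
    then have "K \<inter> closed_segment p q = {} \<or> L \<inter> closed_segment p q = {}"
      using connected_closedD[OF connected_segment(1)[of p q] _ sub] K(1) L(1) compact_imp_closed by blast
    then show False using p q by auto
  qed
  then obtain r where r: "r \<in> closed_segment p q" "r \<in> K \<inter> L" by blast
  then show "K \<inter> L \<noteq> {}" by blast
  obtain t where t: "0 \<le> t" "t \<le> 1" "r = (1 - t) *\<^sub>R p + t *\<^sub>R q"
    using r(1) by (auto simp: closed_segment_def)
  define m where "m = min (conj_on u K x) (conj_on u L x)"
  have "m = (1 - t) * m + t * m" by (simp add: algebra_simps)
  also have "\<dots> \<le> (1 - t) * (x \<bullet> p - u p) + t * (x \<bullet> q - u q)"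
    using p q t unfolding m_def by (intro add_mono mult_left_mono) auto
  also have "\<dots> = x \<bullet> r - ((1 - t) * u p + t * u q)" by (simp add: t(3) inner_simps algebra_simps)
  also have "\<dots> \<le> x \<bullet> r - u r" using Conv_D[OF u t(1,2), of p q] by (simp add: t(3))
  finally have 1: "m \<le> x \<bullet> r - u r" .
  have comp: "compact (K \<inter> L)" using K L by (simp add: compact_Int)
  have "x \<bullet> r - u r \<le> conj_on u (K \<inter> L) x" using conj_on_upper[OF comp cont r(2)] .
  moreover obtain s where s: "s \<in> K \<inter> L" "conj_on u (K \<inter> L) x = x \<bullet> s - u s"
    using conj_on_attained[OF comp \<open>K \<inter> L \<noteq> {}\<close> cont] by metis
  have "x \<bullet> s - u s \<le> m"
    using conj_on_upper[OF K(1) cont, of s x] conj_on_upper[OF L(1) cont, of s x] s(1) by (auto simp: m_def)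
  ultimately show "conj_on u (K \<inter> L) x = min (conj_on u K x) (conj_on u L x)"
    using 1 s(2) unfolding m_def[symmetric] by linarith
qed

lemma conj_on_approx:
  assumes "compact K" "K \<noteq> {}" "continuous_on K u" "continuous_on K u'"
    and d: "\<And>y. y \<in> K \<Longrightarrow> \<bar>u y - u' y\<bar> \<le> d"
  shows "\<bar>conj_on u K x - conj_on u' K x\<bar> \<le> d"
proof -
  obtain p where p: "p \<in> K" "conj_on u K x = x \<bullet> p - u p" using conj_on_attained[OF assms(1-3)] by metis
  obtain q where q: "q \<in> K" "conj_on u' K x = x \<bullet> q - u' q" using conj_on_attained[OF assms(1,2,4)] by metis
  show ?thesis
    using conj_on_upper[OF assms(1,3) q(1), of x] conj_on_upper[OF assms(1,4) p(1), of x] d[OF p(1)] d[OF q(1)] p q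
    by (auto simp: abs_le_iff)
qed

text \<open>Substituting y = a + s t leaves a factor s and an affine function of x, precisely what
  homogeneity and dual epi-translation invariance of z absorb.\<close>

lemma conj_on_rescale:
  assumes "compact K" "K \<noteq> {}" "continuous_on UNIV u" "s > 0"
  shows "conj_on u ((\<lambda>t. a + s *\<^sub>R t) ` K) x
    = s * conj_on (\<lambda>t. (u (a + s *\<^sub>R t) - u a) / s) K x + a \<bullet> x + (- u a)"
proof -
  have c: "continuous_on K (\<lambda>t. (u (a + s *\<^sub>R t) - u a) / s)"
    using assms(4) by (intro continuous_intros continuous_on_compose2[OF assms(3)]) auto
  obtain t where t: "t \<in> K"
    "conj_on (\<lambda>t. (u (a + s *\<^sub>R t) - u a) / s) K x = x \<bullet> t - (u (a + s *\<^sub>R t) - u a) / s"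
    "\<And>t'. t' \<in> K \<Longrightarrow> x \<bullet> t' - (u (a + s *\<^sub>R t') - u a) / s \<le> x \<bullet> t - (u (a + s *\<^sub>R t) - u a) / s"
    by (rule conj_on_attained[OF assms(1,2) c, of x]) blast
  have eq: "x \<bullet> (a + s *\<^sub>R t') - u (a + s *\<^sub>R t')
      = s * (x \<bullet> t' - (u (a + s *\<^sub>R t') - u a) / s) + a \<bullet> x + (- u a)" for t'
    using assms(4) by (simp add: inner_simps field_simps inner_commute)
  have "conj_on u ((\<lambda>t. a + s *\<^sub>R t) ` K) x = x \<bullet> (a + s *\<^sub>R t) - u (a + s *\<^sub>R t)"
  proof (rule conj_on_eqI)
    show "a + s *\<^sub>R t \<in> (\<lambda>t. a + s *\<^sub>R t) ` K" using t by blast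
    fix y assume "y \<in> (\<lambda>t. a + s *\<^sub>R t) ` K"
    then obtain t' where t': "t' \<in> K" "y = a + s *\<^sub>R t'" by blast
    show "x \<bullet> y - u y \<le> x \<bullet> (a + s *\<^sub>R t) - u (a + s *\<^sub>R t)"
      unfolding t'(2) eq using t(3)[OF t'(1)] assms(4) by simp
  qed
  then show ?thesis unfolding eq t(2) .
qed

text \<open>Support function of the box with opposite corners 0 and \<sigma>, evaluated at x - g.
  Equivalently, the conjugate of the linear function with slope g over that box; sides of length 0
  contribute nothing.\<close>

definition corner :: "real^'n \<Rightarrow> real^'n \<Rightarrow> real^'n \<Rightarrow> real" where
  "corner \<sigma> g x = (\<Sum>j\<in>UNIV. \<sigma> $ j * max 0 (x $ j - g $ j))"

lemma conj_on_linear_box: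
  assumes "\<And>j. 0 \<le> \<sigma> $ j"
  shows "conj_on (\<lambda>t. g \<bullet> t) (cbox 0 \<sigma>) x = corner \<sigma> g x"
proof -
  have inner: "x \<bullet> t - g \<bullet> t = (\<Sum>j\<in>UNIV. t $ j * (x $ j - g $ j))" for t
    by (simp add: inner_vec_def sum_subtractf[symmetric] algebra_simps)
  \<comment> \<open>A linear function is maximised over a box coordinate by coordinate: take the
    full side where its coefficient is nonnegative.\<close>
  define y where "y = (\<chi> j. if x $ j \<ge> g $ j then \<sigma> $ j else 0)"
  have y: "x \<bullet> y - g \<bullet> y = corner \<sigma> g x"
    unfolding inner corner_def by (intro sum.cong) (auto simp: y_def max_def)
  have "conj_on (\<lambda>t. g \<bullet> t) (cbox 0 \<sigma>) x = x \<bullet> y - g \<bullet> y"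
  proof (rule conj_on_eqI)
    show "y \<in> cbox 0 \<sigma>" using assms by (simp add: mem_box_cart y_def)
    fix t assume "t \<in> cbox 0 \<sigma>"
    then have t: "0 \<le> t $ j" "t $ j \<le> \<sigma> $ j" for j by (auto simp: mem_box_cart)
    have "t $ j * (x $ j - g $ j) \<le> \<sigma> $ j * max 0 (x $ j - g $ j)" for j
      using t[of j] by (cases "x $ j \<ge> g $ j") (auto simp: mult_right_mono mult_nonneg_nonpos)
    then have "x \<bullet> t - g \<bullet> t \<le> corner \<sigma> g x"
      unfolding inner corner_def by (intro sum_mono)
    then show "x \<bullet> t - g \<bullet> t \<le> x \<bullet> y - g \<bullet> y" using y by simp
  qed
  then show ?thesis using y by simp
qed

lemma cbox_0_nonempty: "(\<And>j. 0 \<le> \<sigma> $ j) \<Longrightarrow> cbox 0 \<sigma> \<noteq> {}" for \<sigma> :: "real^'n"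
  using mem_box_cart[of 0 0 \<sigma>] by auto

lemma corner_Conv:
  assumes "\<And>j. 0 \<le> \<sigma> $ j"
  shows "corner \<sigma> g \<in> Conv"
proof -
  have "conj_on (\<lambda>t. g \<bullet> t) (cbox 0 \<sigma>) \<in> Conv"
    using assms by (intro conj_on_Conv cbox_0_nonempty continuous_intros) simp_all
  moreover have "conj_on (\<lambda>t. g \<bullet> t) (cbox 0 \<sigma>) = corner \<sigma> g"
    using conj_on_linear_box[OF assms] by (rule ext)
  ultimately show ?thesis by simp
qed

lemma corner_tendsto: "G \<longlonglongrightarrow> g \<Longrightarrow> (\<lambda>k. corner \<sigma> (G k) x) \<longlonglongrightarrow> corner \<sigma> g x"
  unfolding corner_def by (intro tendsto_intros)

section \<open>Cutting boxes\<close>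

definition slab :: "real^'n \<Rightarrow> real^'n \<Rightarrow> (real^'n) set" where
  "slab a \<sigma> = cbox a (a + \<sigma>)"

definition upd :: "real^'n \<Rightarrow> 'n \<Rightarrow> real \<Rightarrow> real^'n" where
  "upd \<sigma> i t = (\<chi> j. if j = i then t else \<sigma> $ j)"

lemma upd_nth [simp]: "upd \<sigma> i t $ j = (if j = i then t else \<sigma> $ j)"
  by (simp add: upd_def)

lemma mem_slab: "x \<in> slab a \<sigma> \<longleftrightarrow> (\<forall>j. a $ j \<le> x $ j \<and> x $ j \<le> a $ j + \<sigma> $ j)"
  by (auto simp: slab_def mem_box_cart)

lemma compact_slab [simp]: "compact (slab a \<sigma>)" and convex_slab [simp]: "convex (slab a \<sigma>)"
  by (simp_all add: slab_def)

lemma slab_nonempty: "(\<And>j. 0 \<le> \<sigma> $ j) \<Longrightarrow> slab a \<sigma> \<noteq> {}"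
  using mem_slab[of a a \<sigma>] by auto

lemma slab_image: 
  assumes "s > 0" shows "slab a (s *\<^sub>R \<sigma>) = (\<lambda>t. a + s *\<^sub>R t) ` cbox 0 \<sigma>"
proof (intro set_eqI iffI)
  fix x assume x: "x \<in> slab a (s *\<^sub>R \<sigma>)"
  have "(x - a) /\<^sub>R s \<in> cbox 0 \<sigma>"
    using x assms by (auto simp: mem_slab mem_box_cart field_simps)
  then show "x \<in> (\<lambda>t. a + s *\<^sub>R t) ` cbox 0 \<sigma>"
    using assms by (intro image_eqI[of _ _ "(x - a) /\<^sub>R s"]) auto
qed (use assms in \<open>auto simp: mem_slab mem_box_cart\<close>)

lemma slab_split:
  assumes "0 \<le> t" "t \<le> \<sigma> $ i"
  shows "slab a \<sigma> = slab a (upd \<sigma> i t) \<union> slab (a + t *\<^sub>R axis i 1) (upd \<sigma> i (\<sigma> $ i - t))"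
    and "slab a (upd \<sigma> i t) \<inter> slab (a + t *\<^sub>R axis i 1) (upd \<sigma> i (\<sigma> $ i - t))
      = slab (a + t *\<^sub>R axis i 1) (upd \<sigma> i 0)"
    and "slab a \<sigma> \<inter> {x. x $ i \<le> a $ i + t} = slab a (upd \<sigma> i t)"
    and "slab a \<sigma> \<inter> {x. a $ i + t \<le> x $ i} = slab (a + t *\<^sub>R axis i 1) (upd \<sigma> i (\<sigma> $ i - t))"
proof -
  have ax: "(a + t *\<^sub>R axis i 1) $ j = (if j = i then a $ i + t else a $ j)" for j
    by (auto simp: axis_def)
  have sets: "x \<in> slab a (upd \<sigma> i t) \<longleftrightarrow> (\<forall>j. j \<noteq> i \<longrightarrow> a $ j \<le> x $ j \<and> x $ j \<le> a $ j + \<sigma> $ j) \<and> a $ i \<le> x $ i \<and> x $ i \<le> a $ i + t"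
    "x \<in> slab (a + t *\<^sub>R axis i 1) (upd \<sigma> i (\<sigma> $ i - t)) \<longleftrightarrow>
      (\<forall>j. j \<noteq> i \<longrightarrow> a $ j \<le> x $ j \<and> x $ j \<le> a $ j + \<sigma> $ j) \<and> a $ i + t \<le> x $ i \<and> x $ i \<le> a $ i + \<sigma> $ i"
    "x \<in> slab (a + t *\<^sub>R axis i 1) (upd \<sigma> i 0) \<longleftrightarrow>
      (\<forall>j. j \<noteq> i \<longrightarrow> a $ j \<le> x $ j \<and> x $ j \<le> a $ j + \<sigma> $ j) \<and> x $ i = a $ i + t"
    "x \<in> slab a \<sigma> \<longleftrightarrow> (\<forall>j. j \<noteq> i \<longrightarrow> a $ j \<le> x $ j \<and> x $ j \<le> a $ j + \<sigma> $ j) \<and> a $ i \<le> x $ i \<and> x $ i \<le> a $ i + \<sigma> $ i" for x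
    unfolding mem_slab ax by (auto split: if_splits intro: antisym)
  show "slab a \<sigma> = slab a (upd \<sigma> i t) \<union> slab (a + t *\<^sub>R axis i 1) (upd \<sigma> i (\<sigma> $ i - t))"
    "slab a (upd \<sigma> i t) \<inter> slab (a + t *\<^sub>R axis i 1) (upd \<sigma> i (\<sigma> $ i - t))
      = slab (a + t *\<^sub>R axis i 1) (upd \<sigma> i 0)"
    "slab a \<sigma> \<inter> {x. x $ i \<le> a $ i + t} = slab a (upd \<sigma> i t)"
    "slab a \<sigma> \<inter> {x. a $ i + t \<le> x $ i} = slab (a + t *\<^sub>R axis i 1) (upd \<sigma> i (\<sigma> $ i - t))"
    unfolding set_eq_iff Un_iff Int_iff mem_Collect_eq sets using assms by auto
qed

text \<open>Says that u is convex with continuous gradient G and second-order error at most L |y' -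
  y|^2, without mentioning derivatives. Conjugates of strongly convex functions are of this
  kind.\<close>

definition quadratic_pair :: "(real^'n \<Rightarrow> real) \<Rightarrow> (real^'n \<Rightarrow> real^'n) \<Rightarrow> real \<Rightarrow> bool" where
  "quadratic_pair u G L \<longleftrightarrow> (\<forall>y y'. u y + G y \<bullet> (y' - y) \<le> u y' \<and> u y' \<le> u y + G y \<bullet> (y' - y) + L * (norm (y' - y))\<^sup>2)
     \<and> continuous_on UNIV G \<and> 0 \<le> L"

lemma quadratic_pairD:
  assumes "quadratic_pair u G L"
  shows "u y + G y \<bullet> (y' - y) \<le> u y'" "u y' \<le> u y + G y \<bullet> (y' - y) + L * (norm (y' - y))\<^sup>2"
  using assms by (auto simp: quadratic_pair_def)

lemma quadratic_pair_Conv: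
  assumes "quadratic_pair u G L"
  shows "u \<in> Conv"
proof -
  have "u ((1 - t) *\<^sub>R x + t *\<^sub>R y) \<le> (1 - t) * u x + t * u y" if "0 < t" "t < 1" for t x y
  proof -
    let ?m = "(1 - t) *\<^sub>R x + t *\<^sub>R y"
    have "(1 - t) * (u ?m + G ?m \<bullet> (x - ?m)) + t * (u ?m + G ?m \<bullet> (y - ?m)) \<le> (1 - t) * u x + t * u y"
      using assms that unfolding quadratic_pair_def by (intro add_mono mult_left_mono) auto
    moreover have "(1 - t) * (u ?m + G ?m \<bullet> (x - ?m)) + t * (u ?m + G ?m \<bullet> (y - ?m)) = u ?m"
      by (simp add: inner_simps algebra_simps)
    ultimately show ?thesis by simp
  qed
  then show ?thesis unfolding Conv_def by (auto intro: convex_onI)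
qed

section \<open>Values of z on conjugates over boxes\<close>

locale top_degree_valuation =
  fixes z :: "(real^'n \<Rightarrow> real) \<Rightarrow> real^'n"
  assumes continuous: "continuous_map Conv_top euclidean z"
    and valuation: "is_valuation z"
    and invariant: "dually_epi_translation_invariant z"
    and homogeneous: "homogeneous_deg CARD('n) z"
begin

lemma affine_invariant: "v \<in> Conv \<Longrightarrow> z (\<lambda>x. v x + a \<bullet> x + c) = z v"
  using invariant by (simp add: dually_epi_translation_invariant_def)

lemma scale: "v \<in> Conv \<Longrightarrow> r > 0 \<Longrightarrow> z (\<lambda>x. r * v x) = r ^ CARD('n) *\<^sub>R z v"
  using homogeneous by (simp add: homogeneous_deg_def)

lemma tendsto:
  "v \<in> Conv \<Longrightarrow> (\<And>k. V k \<in> Conv) \<Longrightarrow> (\<And>x. (\<lambda>k. V k x) \<longlonglongrightarrow> v x) \<Longrightarrow> (\<lambda>k. z (V k)) \<longlonglongrightarrow> z v"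
  using continuous_map_Conv_topD[OF continuous] .

lemma zero: "z (\<lambda>x. 0) = 0"
proof -
  have "(\<lambda>x::real^'n. 0) \<in> Conv" using affine_in_Conv[of 0 0] by simp
  from scale[OF this, of 2] have "z (\<lambda>x. 0) = 2 ^ CARD('n) *\<^sub>R z (\<lambda>x. 0)" by simp
  then have "(2 ^ CARD('n) - 1) *\<^sub>R z (\<lambda>x. 0) = 0" by (simp add: algebra_simps)
  moreover have "1 < (2::real) ^ CARD('n)" by (rule one_less_power) auto
  ultimately show ?thesis by simp
qed

text \<open>Union of domains corresponds to the maximum of conjugates and intersection to their
  minimum, the latter because the union is convex. All four functions are convex, so the valuation
  identity becomes inclusion-exclusion for sets.\<close>

lemma conj_on_additive:
  assumes "compact K" "K \<noteq> {}" "compact L" "L \<noteq> {}" "convex (K \<union> L)" "u \<in> Conv"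
  shows "z (conj_on u (K \<union> L)) = z (conj_on u K) + z (conj_on u L) - z (conj_on u (K \<inter> L))"
proof -
  have eqs: "conj_on u (K \<union> L) = (\<lambda>x. max (conj_on u K x) (conj_on u L x))"
    "conj_on u (K \<inter> L) = (\<lambda>x. min (conj_on u K x) (conj_on u L x))"
    using conj_on_Un[OF assms(1-4) Conv_continuous[OF assms(6)]] conj_on_Int(2)[OF assms] by auto
  have "conj_on u K \<in> Conv" "conj_on u L \<in> Conv" "conj_on u (K \<union> L) \<in> Conv" "conj_on u (K \<inter> L) \<in> Conv"
    using assms conj_on_Int(1)[OF assms]
    by (auto intro!: conj_on_Conv Conv_continuous[OF assms(6)] compact_Un compact_Int)
  then show ?thesis
    using valuation unfolding is_valuation_def eqs by (simp add: algebra_simps)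
qed

definition slab_val :: "(real^'n \<Rightarrow> real) \<Rightarrow> real^'n \<Rightarrow> real^'n \<Rightarrow> real^'n" where
  "slab_val u a \<sigma> = z (conj_on u (slab a \<sigma>))"

lemma slab_val_split:
  assumes "u \<in> Conv" "\<And>j. 0 \<le> \<sigma> $ j" "0 \<le> t" "t \<le> \<sigma> $ i"
  shows "slab_val u a \<sigma> = slab_val u a (upd \<sigma> i t)
    + slab_val u (a + t *\<^sub>R axis i 1) (upd \<sigma> i (\<sigma> $ i - t)) - slab_val u (a + t *\<^sub>R axis i 1) (upd \<sigma> i 0)"
proof -
  have "convex (slab a (upd \<sigma> i t) \<union> slab (a + t *\<^sub>R axis i 1) (upd \<sigma> i (\<sigma> $ i - t)))"
    using slab_split(1)[OF assms(3,4), of a] convex_slab by metis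
  from conj_on_additive[OF _ _ _ _ this assms(1)] show ?thesis
    unfolding slab_val_def slab_split(2)[OF assms(3,4)] slab_split(1)[OF assms(3,4), of a, symmetric]
    using assms by (simp add: slab_nonempty)
qed

text \<open>Sequential continuity of z at each corner becomes uniform in g by compactness of X:
  along a counterexample sequence, after passing to a subsequence, the functions V and the corners
  have the same pointwise limit. The uniformity is needed because the local slopes vary from box to
  box.\<close>

lemma corner_uniform:
  assumes \<sigma>: "\<And>j. 0 \<le> \<sigma> $ j" and X: "compact X" and e: "e > 0"
  obtains d where "d > 0" "\<And>g V. g \<in> X \<Longrightarrow> V \<in> Conv \<Longrightarrow> (\<And>x. \<bar>V x - corner \<sigma> g x\<bar> \<le> d) \<Longrightarrow>
     norm (z V - z (corner \<sigma> g)) \<le> e"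
proof (rule ccontr)
  assume neg: "\<not> thesis"
  have "\<exists>g V. g \<in> X \<and> V \<in> Conv \<and> (\<forall>x. \<bar>V x - corner \<sigma> g x\<bar> \<le> 1 / (real k + 1)) \<and>
    norm (z V - z (corner \<sigma> g)) > e" for k :: nat
  proof (rule ccontr)
    assume "\<not> ?thesis"
    then have "\<And>g V. g \<in> X \<Longrightarrow> V \<in> Conv \<Longrightarrow> (\<And>x. \<bar>V x - corner \<sigma> g x\<bar> \<le> 1 / (real k + 1)) \<Longrightarrow>
      norm (z V - z (corner \<sigma> g)) \<le> e" by (simp add: linorder_not_less) blast
    then have thesis by (intro that[of "1 / (real k + 1)"]) simp_all
    then show False using neg by simp
  qed
  then obtain g V where gV: "\<And>k. g k \<in> X" "\<And>k. V k \<in> Conv"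
    "\<And>k x. \<bar>V k x - corner \<sigma> (g k) x\<bar> \<le> 1 / (real k + 1)" "\<And>k. norm (z (V k) - z (corner \<sigma> (g k))) > e"
    by metis
  obtain g0 s where s: "g0 \<in> X" "strict_mono (s :: nat \<Rightarrow> nat)" "(g \<circ> s) \<longlonglongrightarrow> g0"
    using X gV(1) unfolding compact_def by metis
  have c: "(\<lambda>k. corner \<sigma> (g (s k)) x) \<longlonglongrightarrow> corner \<sigma> g0 x" for x
    using corner_tendsto[OF s(3)] by (simp add: o_def)
  have diff: "(\<lambda>k. V (s k) x - corner \<sigma> (g (s k)) x) \<longlonglongrightarrow> 0" for x
  proof (rule Lim_null_comparison)
    show "\<forall>\<^sub>F k in sequentially. norm (V (s k) x - corner \<sigma> (g (s k)) x) \<le> 1 / (real (s k) + 1)"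
      using gV(3) by simp
    have "(\<lambda>k. 1 / (real k + 1)) \<longlonglongrightarrow> 0"
      using LIMSEQ_inverse_real_of_nat by (simp add: inverse_eq_divide add.commute)
    from LIMSEQ_subseq_LIMSEQ[OF this s(2)] show "(\<lambda>k. 1 / (real (s k) + 1)) \<longlonglongrightarrow> 0" by (simp add: o_def)
  qed
  have V: "(\<lambda>k. V (s k) x) \<longlonglongrightarrow> corner \<sigma> g0 x" for x
    using tendsto_add[OF diff[of x] c[of x]] by simp
  have "(\<lambda>k. z (V (s k)) - z (corner \<sigma> (g (s k)))) \<longlonglongrightarrow> z (corner \<sigma> g0) - z (corner \<sigma> g0)"
    by (intro tendsto_diff tendsto V c corner_Conv \<sigma> gV)
  then have "(\<lambda>k. norm (z (V (s k)) - z (corner \<sigma> (g (s k))))) \<longlonglongrightarrow> 0"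
    by (simp add: tendsto_norm_zero)
  then have "\<forall>\<^sub>F k in sequentially. norm (z (V (s k)) - z (corner \<sigma> (g (s k)))) < e"
    using e by (rule order_tendstoD)
  then show False using gV(4) by (meson eventually_sequentially le_refl less_asym)
qed

lemma corner_continuous:
  assumes "\<And>j. 0 \<le> \<sigma> $ j"
  shows "continuous_on UNIV (\<lambda>g. z (corner \<sigma> g))"
proof (rule continuous_on_sequentiallyI)
  fix g a assume "\<forall>k. g k \<in> (UNIV :: (real^'n) set)" "g \<longlonglongrightarrow> a"
  then show "(\<lambda>k. z (corner \<sigma> (g k))) \<longlonglongrightarrow> z (corner \<sigma> a)"
    using assms by (intro tendsto corner_tendsto corner_Conv)
qed

text \<open>On a box of size \<open>s\<close> the function \<open>u\<close> is affine up to \<open>O(s\<^sup>2)\<close>; after rescaling by \<open>1 / s\<close>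
  the error is \<open>O(s)\<close>.\<close>
lemma slab_val_local:
  assumes u: "quadratic_pair u G L" and \<sigma>: "\<And>j. 0 \<le> \<sigma> $ j" and A: "compact A" and e: "e > 0"
  obtains r where "r > 0" "\<And>a s. a \<in> A \<Longrightarrow> 0 < s \<Longrightarrow> s < r \<Longrightarrow>
     norm (slab_val u a (s *\<^sub>R \<sigma>) - s ^ CARD('n) *\<^sub>R z (corner \<sigma> (G a))) \<le> e * s ^ CARD('n)"
proof -
  have uC: "u \<in> Conv" using quadratic_pair_Conv[OF u] .
  have "compact (G ` A)" using u A by (auto simp: quadratic_pair_def intro: compact_continuous_image continuous_on_subset)
  from corner_uniform[OF \<sigma> this e] obtain d where d: "d > 0"
    "\<And>g V. g \<in> G ` A \<Longrightarrow> V \<in> Conv \<Longrightarrow> (\<And>x. \<bar>V x - corner \<sigma> g x\<bar> \<le> d) \<Longrightarrow> norm (z V - z (corner \<sigma> g)) \<le> e"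
    by metis
  obtain M where M: "M > 0" "\<And>t. t \<in> cbox 0 \<sigma> \<Longrightarrow> norm t \<le> M"
    using bounded_cbox[of 0 \<sigma>] by (auto simp: bounded_pos)
  have L: "0 \<le> L" using u by (simp add: quadratic_pair_def)
  \<comment> \<open>After rescaling, the deviation from the linear function is at most L * s * M^2,
    which is at most d for s < r. The summand 1 keeps the denominator positive.\<close>
  define r where "r = d / (L * M\<^sup>2 + 1)"
  have LM: "L * M\<^sup>2 + 1 > 0" using L by (simp add: add_nonneg_pos)
  have "r > 0" unfolding r_def using d(1) LM by simp
  moreover have "norm (slab_val u a (s *\<^sub>R \<sigma>) - s ^ CARD('n) *\<^sub>R z (corner \<sigma> (G a))) \<le> e * s ^ CARD('n)"
    if as: "a \<in> A" "0 < s" "s < r" for a s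
  proof -
    define U where "U t = (u (a + s *\<^sub>R t) - u a) / s" for t
    let ?B = "cbox 0 \<sigma>"
    have B: "?B \<noteq> {}" using cbox_0_nonempty[OF \<sigma>] .
    have contU: "continuous_on ?B U"
      unfolding U_def using as(2)
      by (intro continuous_intros continuous_on_compose2[OF Conv_continuous[OF uC, of UNIV]]) auto
    have near: "\<bar>U t - G a \<bullet> t\<bar> \<le> d" if t: "t \<in> ?B" for t
    proof -
      have q: "u a + G a \<bullet> (s *\<^sub>R t) \<le> u (a + s *\<^sub>R t)" "u (a + s *\<^sub>R t) \<le> u a + G a \<bullet> (s *\<^sub>R t) + L * (norm (s *\<^sub>R t))\<^sup>2"
        using quadratic_pairD(1)[OF u, of a "a + s *\<^sub>R t"] quadratic_pairD(2)[OF u, of "a + s *\<^sub>R t" a] by simp_all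
      have sU: "s * U t = u (a + s *\<^sub>R t) - u a" using as(2) by (simp add: U_def)
      have "0 \<le> s * (U t - G a \<bullet> t)" using q(1) sU by (simp add: right_diff_distrib)
      then have 1: "0 \<le> U t - G a \<bullet> t" using as(2) by (simp add: zero_le_mult_iff)
      have "s * (U t - G a \<bullet> t) \<le> s * (L * s * (norm t)\<^sup>2)"
        using q(2) sU by (simp add: right_diff_distrib power2_eq_square mult_ac)
      then have "U t - G a \<bullet> t \<le> L * s * (norm t)\<^sup>2" using as(2) by simp
      also have "\<dots> \<le> L * s * M\<^sup>2"
        using M(2)[OF t] L as(2) by (intro mult_left_mono power_mono) auto
      also have "\<dots> \<le> (L * M\<^sup>2 + 1) * s" using as(2) by (simp add: algebra_simps)
      also have "\<dots> \<le> (L * M\<^sup>2 + 1) * r" using as LM by (intro mult_left_mono) auto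
      also have "\<dots> = d" using LM by (simp add: r_def)
      finally show ?thesis using 1 by simp
    qed
    have UC: "conj_on U ?B \<in> Conv" using conj_on_Conv[OF _ B contU] by simp
    have "norm (z (conj_on U ?B) - z (corner \<sigma> (G a))) \<le> e"
    proof (rule d(2))
      show "\<bar>conj_on U ?B x - corner \<sigma> (G a) x\<bar> \<le> d" for x
        unfolding conj_on_linear_box[OF \<sigma>, symmetric]
        by (rule conj_on_approx[OF _ B contU]) (auto intro!: near continuous_intros)
    qed (use as UC in auto)
    moreover have "slab_val u a (s *\<^sub>R \<sigma>) = s ^ CARD('n) *\<^sub>R z (conj_on U ?B)"
    proof -
      have "conj_on u (slab a (s *\<^sub>R \<sigma>)) = (\<lambda>x. s * conj_on U ?B x + a \<bullet> x + (- u a))"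
        unfolding slab_image[OF as(2)] U_def
        using conj_on_rescale[OF _ B Conv_continuous[OF uC] as(2), of a] by (intro ext) simp
      moreover have "(\<lambda>x. s * conj_on U ?B x) \<in> Conv" using Conv_cmul[OF UC] as(2) by simp
      ultimately show ?thesis
        unfolding slab_val_def using affine_invariant[of "\<lambda>x. s * conj_on U ?B x" a "- u a"] scale[OF UC as(2)] by simp
    qed
    ultimately show ?thesis
      using as(2) by (simp add: scaleR_diff_right[symmetric] mult.commute mult_left_mono)
  qed
  ultimately show thesis using that by blast
qed

end

section \<open>Subdivision of boxes\<close>

text \<open>Only coordinates of positive length are cut, one after the other, and each cut doubles
  the number of pieces; hence the exponent is the dimension of the box. The condition on \<tau>
  ensures that cuts are made only between boxes of that same dimension.\<close>

lemma halving_step: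
  fixes f :: "real^'n \<Rightarrow> real^'n \<Rightarrow> 'b::real_normed_vector"
  assumes \<sigma>: "\<And>j. 0 \<le> \<sigma> $ j" and s: "s > 0"
    and split: "\<And>a \<tau> i. (\<And>j. 0 \<le> \<tau> $ j) \<Longrightarrow> {j. 0 < \<tau> $ j} = {j. 0 < \<sigma> $ j} \<Longrightarrow> 0 < \<tau> $ i \<Longrightarrow>
      f a \<tau> = f a (upd \<tau> i (\<tau> $ i / 2)) + f (a + (\<tau> $ i / 2) *\<^sub>R axis i 1) (upd \<tau> i (\<tau> $ i / 2))"
    and E: "\<And>a. slab a ((s / 2) *\<^sub>R \<sigma>) \<subseteq> C \<Longrightarrow> norm (f a ((s / 2) *\<^sub>R \<sigma>)) \<le> E"
    and sub: "slab a (s *\<^sub>R \<sigma>) \<subseteq> C"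
  shows "norm (f a (s *\<^sub>R \<sigma>)) \<le> 2 ^ card {j. 0 < \<sigma> $ j} * E"
proof -
  let ?P = "{j. 0 < \<sigma> $ j}"
  \<comment> \<open>Intermediate shapes: the coordinates in J still have full length, the others are
    already halved. The induction over J starts at the half-size box.\<close>
  define sh where "sh J = (\<chi> j. if j \<in> J then s * \<sigma> $ j else (s / 2) * \<sigma> $ j)" for J
  have "norm (f a (sh J)) \<le> 2 ^ card J * E" if "J \<subseteq> ?P" "slab a (sh J) \<subseteq> C" for J a
    using finite_subset[OF that(1) finite] that
  proof (induction J arbitrary: a rule: finite_induct)
    case empty
    have "sh {} = (s / 2) *\<^sub>R \<sigma>" by (simp add: sh_def vec_eq_iff)
    then show ?case using E empty by simp
  next
    case (insert i J)
    let ?\<tau> = "sh (insert i J)"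
    have nn: "0 \<le> ?\<tau> $ j" for j using \<sigma>[of j] s by (simp add: sh_def)
    have pos: "{j. 0 < ?\<tau> $ j} = ?P"
      using s by (auto simp: sh_def zero_less_mult_iff)
    have i: "0 < ?\<tau> $ i" using insert.prems(1) s by (simp add: sh_def)
    have half: "upd ?\<tau> i (?\<tau> $ i / 2) = sh J" using insert.hyps by (auto simp: vec_eq_iff sh_def)
    have sl: "slab a ?\<tau> = slab a (sh J) \<union> slab (a + (?\<tau> $ i / 2) *\<^sub>R axis i 1) (sh J)"
      using slab_split(1)[of "?\<tau> $ i / 2" ?\<tau> i a] i by (simp add: half)
    have "norm (f a ?\<tau>) \<le> norm (f a (sh J)) + norm (f (a + (?\<tau> $ i / 2) *\<^sub>R axis i 1) (sh J))"
      unfolding split[OF nn pos i, of a, unfolded half] by (rule norm_triangle_ineq)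
    also have "\<dots> \<le> 2 ^ card J * E + 2 ^ card J * E"
      using insert.prems sl by (intro add_mono insert.IH) auto
    finally show ?case using insert.hyps by (simp add: mult_ac)
  qed
  moreover have "sh ?P = s *\<^sub>R \<sigma>" using \<sigma> by (auto simp: sh_def vec_eq_iff not_less intro: antisym)
  ultimately show ?thesis using sub by (metis subset_refl)
qed

text \<open>A box splits into \<open>2 ^ (d k)\<close> boxes of relative size \<open>1 / 2 ^ k\<close>, where \<open>d\<close> is its dimension.\<close>
lemma halving_zero:
  fixes f :: "real^'n \<Rightarrow> real^'n \<Rightarrow> 'b::real_normed_vector"
  assumes \<sigma>: "\<And>j. 0 \<le> \<sigma> $ j" and s: "s > 0"
    and split: "\<And>a \<tau> i. (\<And>j. 0 \<le> \<tau> $ j) \<Longrightarrow> {j. 0 < \<tau> $ j} = {j. 0 < \<sigma> $ j} \<Longrightarrow> 0 < \<tau> $ i \<Longrightarrow>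
      f a \<tau> = f a (upd \<tau> i (\<tau> $ i / 2)) + f (a + (\<tau> $ i / 2) *\<^sub>R axis i 1) (upd \<tau> i (\<tau> $ i / 2))"
    and loc: "\<And>e. e > 0 \<Longrightarrow> \<exists>r>0. \<forall>a s. 0 < s \<and> s < r \<and> slab a (s *\<^sub>R \<sigma>) \<subseteq> C \<longrightarrow>
      norm (f a (s *\<^sub>R \<sigma>)) \<le> e * s ^ card {j. 0 < \<sigma> $ j}"
    and sub: "slab a (s *\<^sub>R \<sigma>) \<subseteq> C"
  shows "f a (s *\<^sub>R \<sigma>) = 0"
proof -
  let ?d = "card {j. 0 < \<sigma> $ j}"
  have iter: "norm (f a (s *\<^sub>R \<sigma>)) \<le> 2 ^ (?d * k) * E"
    if "s > 0" "\<And>a. slab a ((s / 2 ^ k) *\<^sub>R \<sigma>) \<subseteq> C \<Longrightarrow> norm (f a ((s / 2 ^ k) *\<^sub>R \<sigma>)) \<le> E"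
      "slab a (s *\<^sub>R \<sigma>) \<subseteq> C" for k E s a
    using that
  proof (induction k arbitrary: s a)
    case (Suc k)
    have half: "s / 2 / 2 ^ k = s / 2 ^ Suc k" by simp
    have "norm (f a (s *\<^sub>R \<sigma>)) \<le> 2 ^ ?d * (2 ^ (?d * k) * E)"
    proof (rule halving_step[OF \<sigma> Suc.prems(1) split _ Suc.prems(3)])
      fix b assume b: "slab b ((s / 2) *\<^sub>R \<sigma>) \<subseteq> C"
      show "norm (f b ((s / 2) *\<^sub>R \<sigma>)) \<le> 2 ^ (?d * k) * E"
        by (rule Suc.IH[of "s / 2" b, unfolded half, OF _ Suc.prems(2) b]) (use Suc.prems(1) in simp)
    qed
    then show ?case by (simp add: power_add)
  qed simp
  have "norm (f a (s *\<^sub>R \<sigma>)) \<le> e" if e: "e > 0" for e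
  proof -
    have "e / s ^ ?d > 0" using e s by simp
    from loc[OF this] obtain r where r: "r > 0"
      "\<And>a t. 0 < t \<Longrightarrow> t < r \<Longrightarrow> slab a (t *\<^sub>R \<sigma>) \<subseteq> C \<Longrightarrow> norm (f a (t *\<^sub>R \<sigma>)) \<le> e / s ^ ?d * t ^ ?d"
      by blast
    \<comment> \<open>After k halvings the pieces have size s / 2^k < r. Their number 2^(d k)
      cancels against the factor (1 / 2^k)^d of the local bound, and the tolerance e / s^d was
      chosen so that e remains.\<close>
    obtain k where k: "(1 / 2) ^ k < r / s"
      using real_arch_pow_inv[of "r / s" "1 / 2"] r s by auto
    have "s * (1 / 2) ^ k < r" using k s by (simp add: pos_less_divide_eq mult.commute)
    then have small: "s / 2 ^ k < r" by (simp add: power_one_over)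
    have "norm (f a (s *\<^sub>R \<sigma>)) \<le> 2 ^ (?d * k) * (e / s ^ ?d * (s / 2 ^ k) ^ ?d)"
      by (rule iter[OF s _ sub]) (use small s in \<open>intro r(2); simp\<close>)
    also have "\<dots> = e"
      using s by (simp add: power_divide power_mult[symmetric] mult.commute)
    finally show ?thesis .
  qed
  then have "norm (f a (s *\<^sub>R \<sigma>)) \<le> 0" by (rule field_le_epsilon[of _ 0, simplified])
  then show ?thesis by simp
qed

context top_degree_valuation
begin

text \<open>Induction on the dimension: the common face of a cut has one positive side less, so its
  value is already 0 and halving is exactly additive. The local estimate gives O(s^n), which is
  o(s^d) because d < n. In dimension 0 there are no cuts, and the local estimate alone yields
  0.\<close>

lemma slab_val_degenerate:
  assumes u: "quadratic_pair u G L" and "\<And>j. 0 \<le> \<sigma> $ j" "{j. 0 < \<sigma> $ j} \<noteq> UNIV"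
  shows "slab_val u a \<sigma> = 0"
  using assms(2,3)
proof (induction "card {j. 0 < \<sigma> $ j}" arbitrary: a \<sigma> rule: less_induct)
  case less
  let ?P = "{j. 0 < \<sigma> $ j}"
  note uC = quadratic_pair_Conv[OF u]
  have "slab_val u a (1 *\<^sub>R \<sigma>) = 0"
  proof (rule halving_zero[where f = "slab_val u" and \<sigma> = \<sigma> and C = "slab a \<sigma>"])
    fix b \<tau> :: "real^'n" and i assume \<tau>: "\<And>j. 0 \<le> \<tau> $ j" "{j. 0 < \<tau> $ j} = ?P" "0 < \<tau> $ i"
    let ?b = "b + (\<tau> $ i / 2) *\<^sub>R axis i 1"
    have "{j. 0 < upd \<tau> i 0 $ j} = {j. 0 < \<tau> $ j} - {i}" by auto
    then have "{j. 0 < upd \<tau> i 0 $ j} = ?P - {i}" by (simp only: \<tau>(2))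
    moreover have "i \<in> ?P" using \<tau>(2,3) by blast
    then have "card (?P - {i}) < card ?P" by (rule card_Diff1_less[OF finite])
    ultimately have "card {j. 0 < upd \<tau> i 0 $ j} < card ?P" by (simp only:)
    moreover have "i \<notin> {j. 0 < upd \<tau> i 0 $ j}" by simp
    then have "{j. 0 < upd \<tau> i 0 $ j} \<noteq> UNIV" by blast
    ultimately have "slab_val u ?b (upd \<tau> i 0) = 0"
      by (intro less.hyps) (simp_all add: \<tau>(1))
    then show "slab_val u b \<tau> = slab_val u b (upd \<tau> i (\<tau> $ i / 2)) + slab_val u ?b (upd \<tau> i (\<tau> $ i / 2))"
      using slab_val_split[OF uC \<tau>(1), of "\<tau> $ i / 2" i b] \<tau>(3) by simp
  next
    fix e :: real assume e: "e > 0"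
    have cG: "continuous_on UNIV G" using u by (simp add: quadratic_pair_def)
    have comp: "compact ((\<lambda>b. z (corner \<sigma> (G b))) ` slab a \<sigma>)"
      by (intro compact_continuous_image continuous_on_compose2[OF corner_continuous[OF less.prems(1)]]
          continuous_on_subset[OF cG]) auto
    obtain B where B0: "B > 0" "\<forall>x\<in>(\<lambda>b. z (corner \<sigma> (G b))) ` slab a \<sigma>. norm x \<le> B"
      using compact_imp_bounded[OF comp] unfolding bounded_pos by blast
    then have B: "\<And>b. b \<in> slab a \<sigma> \<Longrightarrow> norm (z (corner \<sigma> (G b))) \<le> B" "B > 0" by auto
    obtain r where r: "r > 0" "\<And>b s. b \<in> slab a \<sigma> \<Longrightarrow> 0 < s \<Longrightarrow> s < r \<Longrightarrow>
        norm (slab_val u b (s *\<^sub>R \<sigma>) - s ^ CARD('n) *\<^sub>R z (corner \<sigma> (G b))) \<le> 1 * s ^ CARD('n)"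
      using slab_val_local[OF u less.prems(1) compact_slab zero_less_one] by metis
    have "card ?P < CARD('n)" using less.prems(2) by (intro psubset_card_mono) auto
    then have card: "s ^ CARD('n) \<le> s * s ^ card ?P" if "0 < s" "s < 1" for s :: real
      using that by (metis Suc_leI less_imp_le power_Suc power_decreasing)
    \<comment> \<open>The three bounds serve the local estimate, the inequality s^n \<le> s * s^d,
      and (B + 1) * s \<le> e.\<close>
    define r' where "r' = min r (min 1 (e / (B + 1)))"
    have "r' > 0" using r e B by (simp add: r'_def)
    moreover have "norm (slab_val u b (s *\<^sub>R \<sigma>)) \<le> e * s ^ card ?P"
      if s: "0 < s" "s < r'" and sub: "slab b (s *\<^sub>R \<sigma>) \<subseteq> slab a \<sigma>" for b s
    proof -
      have "b \<in> slab b (s *\<^sub>R \<sigma>)" using s less.prems(1) by (simp add: mem_slab)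
      then have b: "b \<in> slab a \<sigma>" using sub by blast
      have "norm (slab_val u b (s *\<^sub>R \<sigma>)) \<le> norm (s ^ CARD('n) *\<^sub>R z (corner \<sigma> (G b))) + 1 * s ^ CARD('n)"
        using r(2)[OF b s(1)] s(2) norm_triangle_sub[of "slab_val u b (s *\<^sub>R \<sigma>)" "s ^ CARD('n) *\<^sub>R z (corner \<sigma> (G b))"]
        by (simp add: r'_def)
      also have "\<dots> \<le> (B + 1) * s ^ CARD('n)"
        using B(1)[OF b] s by (simp add: algebra_simps)
      also have "\<dots> \<le> (B + 1) * (s * s ^ card ?P)"
        using card s B by (intro mult_left_mono) (auto simp: r'_def)
      also have "\<dots> \<le> e * s ^ card ?P"
      proof -
        have "(B + 1) * s \<le> e" using s B by (simp add: r'_def field_simps)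
        then show ?thesis using s by (simp add: mult.assoc[symmetric] mult_right_mono)
      qed
      finally show ?thesis .
    qed
    ultimately show "\<exists>r>0. \<forall>b s. 0 < s \<and> s < r \<and> slab b (s *\<^sub>R \<sigma>) \<subseteq> slab a \<sigma> \<longrightarrow>
      norm (slab_val u b (s *\<^sub>R \<sigma>)) \<le> e * s ^ card ?P" by blast
  qed (use less.prems in auto)
  then show ?case by simp
qed

definition density_fn :: "real^'n \<Rightarrow> real^'n" where
  "density_fn g = z (corner 1 g)"

lemma density_fn_continuous: "continuous_on S density_fn"
  unfolding density_fn_def using corner_continuous[of 1] continuous_on_subset by auto

text \<open>\<open>halving_zero\<close> is applied to the defect between the value of z and the
  integral. The defect is additive because common faces have value 0 and measure 0, and on small
  cubes it is o(s^n): one half of the tolerance comes from \<open>slab_val_local\<close>, the other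
  from uniform continuity of the integrand.\<close>

lemma slab_val_cube:
  assumes u: "quadratic_pair u G L" and s: "s > 0"
  shows "slab_val u a (s *\<^sub>R 1) = integral (slab a (s *\<^sub>R 1)) (\<lambda>y. density_fn (G y))"
proof -
  note uC = quadratic_pair_Conv[OF u]
  let ?h = "\<lambda>y. density_fn (G y)"
  have cG: "continuous_on UNIV G" using u by (simp add: quadratic_pair_def)
  have ch: "continuous_on S ?h" for S
    by (rule continuous_on_compose2[OF density_fn_continuous continuous_on_subset[OF cG]]) auto
  have P: "{j. 0 < (1::real^'n) $ j} = UNIV" by simp
  define f where "f b \<tau> = slab_val u b \<tau> - integral (slab b \<tau>) ?h" for b \<tau>
  have "f a (s *\<^sub>R 1) = 0"
  proof (rule halving_zero[where f = f and \<sigma> = 1 and C = "slab a (s *\<^sub>R 1)"])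
    fix b \<tau> :: "real^'n" and i assume \<tau>: "\<And>j. 0 \<le> \<tau> $ j" "{j. 0 < \<tau> $ j} = {j. 0 < (1::real^'n) $ j}" "0 < \<tau> $ i"
    let ?b = "b + (\<tau> $ i / 2) *\<^sub>R axis i 1"
    have "slab_val u ?b (upd \<tau> i 0) = 0"
      using \<tau>(1) by (intro slab_val_degenerate[OF u]) auto
    then have 1: "slab_val u b \<tau> = slab_val u b (upd \<tau> i (\<tau> $ i / 2)) + slab_val u ?b (upd \<tau> i (\<tau> $ i / 2))"
      using slab_val_split[OF uC \<tau>(1), of "\<tau> $ i / 2" i b] \<tau>(3) by simp
    have half: "\<tau> $ i - \<tau> $ i / 2 = \<tau> $ i / 2" by simp
    have sets: "slab b \<tau> \<inter> {x. x \<bullet> axis i 1 \<le> b $ i + \<tau> $ i / 2} = slab b (upd \<tau> i (\<tau> $ i / 2))"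
      "slab b \<tau> \<inter> {x. x \<bullet> axis i 1 \<ge> b $ i + \<tau> $ i / 2} = slab ?b (upd \<tau> i (\<tau> $ i / 2))"
      using slab_split(3,4)[of "\<tau> $ i / 2" \<tau> i b] \<tau>(3) by (simp_all add: inner_axis half)
    have "integral (slab b \<tau>) ?h = integral (slab b (upd \<tau> i (\<tau> $ i / 2))) ?h
        + integral (slab ?b (upd \<tau> i (\<tau> $ i / 2))) ?h"
      unfolding sets[symmetric] unfolding slab_def
      by (rule integral_split) (auto intro!: integrable_continuous ch)
    with 1 show "f b \<tau> = f b (upd \<tau> i (\<tau> $ i / 2)) + f ?b (upd \<tau> i (\<tau> $ i / 2))"
      by (simp add: f_def)
  next
    fix e :: real assume e: "e > 0"
    let ?C = "slab a (s *\<^sub>R 1)"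
    have one: "0 \<le> (1::real^'n) $ j" for j by simp
    obtain r where r: "r > 0" "\<And>b t. b \<in> ?C \<Longrightarrow> 0 < t \<Longrightarrow> t < r \<Longrightarrow>
        norm (slab_val u b (t *\<^sub>R 1) - t ^ CARD('n) *\<^sub>R z (corner 1 (G b))) \<le> (e / 2) * t ^ CARD('n)"
      using slab_val_local[where A = ?C, OF u one compact_slab half_gt_zero[OF e]] by metis
    have "uniformly_continuous_on ?C ?h" by (intro compact_uniformly_continuous ch compact_slab)
    then obtain d where d: "d > 0" "\<And>x y. x \<in> ?C \<Longrightarrow> y \<in> ?C \<Longrightarrow> dist x y < d \<Longrightarrow> dist (?h x) (?h y) < e / 2"
      unfolding uniformly_continuous_on_def using half_gt_zero[OF e] by metis
    \<comment> \<open>Points of a cube of side t differ by at most n * t in the l1 norm, which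
      bounds the Euclidean norm.\<close>
    define r' where "r' = min r (d / real CARD('n))"
    have "r' > 0" using r d by (simp add: r'_def)
    moreover have "norm (f b (t *\<^sub>R 1)) \<le> e * t ^ CARD('n)"
      if t: "0 < t" "t < r'" and sub: "slab b (t *\<^sub>R 1) \<subseteq> ?C" for b t
    proof -
      have bb: "b \<in> slab b (t *\<^sub>R 1)" using t by (simp add: mem_slab)
      then have b: "b \<in> ?C" using sub by blast
      have near: "norm (?h y - ?h b) \<le> e / 2" if y: "y \<in> slab b (t *\<^sub>R 1)" for y
      proof -
        have "norm (y - b) \<le> (\<Sum>j\<in>UNIV. \<bar>(y - b) $ j\<bar>)" by (rule norm_le_l1_cart)
        also have "\<dots> \<le> (\<Sum>j\<in>(UNIV::'n set). t)"
          using y by (intro sum_mono) (auto simp: mem_slab abs_le_iff diff_le_eq le_diff_eq add.commute)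
        also have "\<dots> < d" using t(2) by (simp add: r'_def pos_less_divide_eq mult.commute)
        finally have "dist (?h y) (?h b) < e / 2" using y sub b by (intro d(2)) (auto simp: dist_norm)
        then show ?thesis by (simp add: dist_norm)
      qed
      have content: "measure lborel (slab b (t *\<^sub>R 1)) = t ^ CARD('n)"
        using bb t unfolding slab_def by (subst content_cbox_cart) auto
      have int: "?h integrable_on slab b (t *\<^sub>R 1)" unfolding slab_def by (intro integrable_continuous ch)
      have "((\<lambda>y. ?h y - ?h b) has_integral (integral (slab b (t *\<^sub>R 1)) ?h - t ^ CARD('n) *\<^sub>R ?h b)) (slab b (t *\<^sub>R 1))"
        using has_integral_diff[OF integrable_integral[OF int], of "\<lambda>_. ?h b"]
          has_integral_const[of "?h b" b "b + t *\<^sub>R 1"] content by (simp add: slab_def)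
      then have "norm (integral (slab b (t *\<^sub>R 1)) ?h - t ^ CARD('n) *\<^sub>R ?h b) \<le> (e / 2) * measure lborel (slab b (t *\<^sub>R 1))"
        using near e unfolding slab_def by (intro has_integral_bound) auto
      moreover have "norm (slab_val u b (t *\<^sub>R 1) - t ^ CARD('n) *\<^sub>R ?h b) \<le> (e / 2) * t ^ CARD('n)"
        unfolding density_fn_def using t by (intro r(2) b) (auto simp: r'_def)
      moreover have "f b (t *\<^sub>R 1) = (slab_val u b (t *\<^sub>R 1) - t ^ CARD('n) *\<^sub>R ?h b)
          - (integral (slab b (t *\<^sub>R 1)) ?h - t ^ CARD('n) *\<^sub>R ?h b)" by (simp add: f_def)
      then have "norm (f b (t *\<^sub>R 1)) \<le> norm (slab_val u b (t *\<^sub>R 1) - t ^ CARD('n) *\<^sub>R ?h b)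
          + norm (integral (slab b (t *\<^sub>R 1)) ?h - t ^ CARD('n) *\<^sub>R ?h b)"
        using norm_triangle_ineq4 by metis
      ultimately show ?thesis unfolding content by (simp add: field_simps)
    qed
    ultimately show "\<exists>r>0. \<forall>b t. 0 < t \<and> t < r \<and> slab b (t *\<^sub>R 1) \<subseteq> ?C \<longrightarrow>
        norm (f b (t *\<^sub>R 1)) \<le> e * t ^ card {j. 0 < (1::real^'n) $ j}" by auto
  qed (use s in auto)
  then show ?thesis by (simp add: f_def)
qed

end

section \<open>The density and the representation\<close>

lemma norm_convex_combination:
  fixes x y :: "'a::real_inner"
  shows "(norm ((1 - t) *\<^sub>R x + t *\<^sub>R y))\<^sup>2 = (1 - t) * (norm x)\<^sup>2 + t * (norm y)\<^sup>2 - t * (1 - t) * (norm (y - x))\<^sup>2"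
  unfolding power2_norm_eq_inner by (simp add: inner_simps inner_commute algebra_simps)

lemma norm_square_Conv: "(\<lambda>x::real^'n. (norm x)\<^sup>2) \<in> Conv"
  unfolding Conv_def by (auto intro!: convex_onI simp: norm_convex_combination)

text \<open>Makes the results on boxes applicable to corners themselves, which are conjugates of
  linear functions over boxes.\<close>

lemma linear_quadratic_pair: "quadratic_pair (\<lambda>y. g \<bullet> y) (\<lambda>_. g) 0"
  by (simp add: quadratic_pair_def inner_simps)

context top_degree_valuation
begin

lemma slab_val_linear:
  assumes "\<And>j. 0 \<le> \<sigma> $ j"
  shows "slab_val (\<lambda>y. g \<bullet> y) a \<sigma> = z (corner \<sigma> g)"
proof -
  have "conj_on (\<lambda>y. g \<bullet> y) (slab a \<sigma>) x = corner \<sigma> g x + a \<bullet> x + (- (g \<bullet> a))" for x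
    using conj_on_rescale[of "cbox 0 \<sigma>" "\<lambda>y. g \<bullet> y" 1 a x] slab_image[of 1 a \<sigma>] cbox_0_nonempty[OF assms]
      conj_on_linear_box[OF assms, of g x]
    by (simp add: inner_simps continuous_intros)
  then have "conj_on (\<lambda>y. g \<bullet> y) (slab a \<sigma>) = (\<lambda>x. corner \<sigma> g x + a \<bullet> x + (- (g \<bullet> a)))" by (rule ext)
  then show ?thesis
    unfolding slab_val_def by (simp only: affine_invariant[OF corner_Conv[OF assms]])
qed

lemma corner_degenerate:
  assumes "\<And>j. 0 \<le> \<sigma> $ j" "\<sigma> $ i = 0"
  shows "z (corner \<sigma> g) = 0"
proof -
  have "i \<notin> {j. 0 < \<sigma> $ j}" using assms by simp
  then have "{j. 0 < \<sigma> $ j} \<noteq> UNIV" by blast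
  from slab_val_degenerate[OF linear_quadratic_pair assms(1) this, of g 0]
  show ?thesis using slab_val_linear[OF assms(1)] by simp
qed

text \<open>A stack of N unit cubes in direction i: moving a cube changes the conjugate of a linear
  function only by an affine function, and the faces between the cubes contribute 0.\<close>

lemma corner_stretch: "z (corner (upd 1 i (real N)) g) = real N *\<^sub>R density_fn g"
proof (induction N)
  case 0
  then show ?case using corner_degenerate[of "upd 1 i 0" i g] by simp
next
  case (Suc N)
  let ?\<sigma> = "upd 1 i (real (Suc N)) :: real^'n"
  have nn: "0 \<le> ?\<sigma> $ j" for j by simp
  have upds: "upd ?\<sigma> i (real N) = upd 1 i (real N)" "upd ?\<sigma> i (?\<sigma> $ i - real N) = 1" "upd ?\<sigma> i 0 = upd 1 i 0"
    by (simp_all add: vec_eq_iff)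
  have lin: "quadratic_pair (\<lambda>y. g \<bullet> y) (\<lambda>_. g) 0" by (rule linear_quadratic_pair)
  have "z (corner ?\<sigma> g) = z (corner (upd 1 i (real N)) g) + z (corner 1 g) - z (corner (upd 1 i 0) g)"
    using slab_val_split[OF quadratic_pair_Conv[OF lin] nn, of "real N" i 0] unfolding upds
    by (simp add: slab_val_linear)
  also have "z (corner (upd 1 i 0) g) = 0" by (rule corner_degenerate[of _ i]) auto
  finally show ?case using Suc by (simp add: density_fn_def algebra_simps)
qed

text \<open>If the support were unbounded, corners at \<open>X k\<close> far away in direction \<open>I k\<close>, stretched enough in
  that direction to have values of norm at least \<open>1\<close>, would converge to \<open>0\<close> modulo affine functions.\<close>
lemma density_fn_bounded_support: "\<exists>R. \<forall>x. density_fn x \<noteq> 0 \<longrightarrow> norm x \<le> R"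
proof (rule ccontr)
  assume neg: "\<not> ?thesis"
  have "\<exists>x i. density_fn x \<noteq> 0 \<and> \<bar>x $ i\<bar> > real k" for k :: nat
  proof -
    obtain x where x: "density_fn x \<noteq> 0" "norm x > real CARD('n) * real k"
      using neg by (meson linorder_not_less)
    have "\<exists>i. \<bar>x $ i\<bar> > real k"
    proof (rule ccontr)
      assume "\<not> ?thesis"
      then have "(\<Sum>i\<in>UNIV. \<bar>x $ i\<bar>) \<le> (\<Sum>i\<in>(UNIV::'n set). real k)" by (intro sum_mono) (auto simp: not_less)
      then show False using x(2) norm_le_l1_cart[of x] by simp
    qed
    then show ?thesis using x by blast
  qed
  then obtain X I where XI: "\<And>k. density_fn (X k) \<noteq> 0" "\<And>k. \<bar>X k $ I k\<bar> > real k" by metis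
  \<comment> \<open>Stretching by N multiplies the value by N, while the damping factor r k below
    costs r k ^ n. This N keeps the norm of the product at least 1.\<close>
  have "\<exists>N::nat. (real k + 1) ^ CARD('n) / norm (density_fn (X k)) \<le> real N" for k
    by (rule real_arch_simple)
  then obtain N :: "nat \<Rightarrow> nat" where N: "\<And>k. (real k + 1) ^ CARD('n) / norm (density_fn (X k)) \<le> real (N k)" by metis
  define r where "r k = 1 / (real k + 1)" for k
  have r: "r k > 0" for k by (simp add: r_def)
  \<comment> \<open>On the ball of radius k the term of the corner in coordinate I k is affine,
    since X k lies beyond the ball in that coordinate: it has slope N k on one side and vanishes on
    the other.\<close>
  define c where "c k = (if X k $ I k < 0 then 1 else 0 :: real)" for k
  \<comment> \<open>The affine part removes the stretched term on the ball and normalises the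
    remaining terms to vanish at 0. What is left there is at most n * norm p, and the factor r k
    sends it to 0.\<close>
  define V where "V k p = r k * corner (upd 1 (I k) (real (N k))) (X k) p
      + (- (r k * real (N k) * c k)) *\<^sub>R axis (I k) 1 \<bullet> p
      + (r k * real (N k) * c k * X k $ I k - r k * (\<Sum>j\<in>UNIV - {I k}. max 0 (- X k $ j)))" for k p
  have nn: "0 \<le> upd 1 (I k) (real (N k)) $ j" for k j by simp
  have VC: "V k \<in> Conv" for k
    unfolding V_def using r by (intro Conv_affine Conv_cmul corner_Conv nn less_imp_le)
  have zV: "z (V k) = r k ^ CARD('n) *\<^sub>R (real (N k) *\<^sub>R density_fn (X k))" for k
  proof -
    have cC: "corner (upd 1 (I k) (real (N k))) (X k) \<in> Conv" by (intro corner_Conv nn)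
    then have "(\<lambda>p. r k * corner (upd 1 (I k) (real (N k))) (X k) p) \<in> Conv"
      using r[of k] by (intro Conv_cmul less_imp_le)
    then have "z (V k) = z (\<lambda>p. r k * corner (upd 1 (I k) (real (N k))) (X k) p)"
      unfolding V_def by (rule affine_invariant)
    also have "\<dots> = r k ^ CARD('n) *\<^sub>R z (corner (upd 1 (I k) (real (N k))) (X k))"
      by (rule scale[OF cC r])
    finally show ?thesis by (simp only: corner_stretch)
  qed
  have big: "norm (z (V k)) \<ge> 1" for k
  proof -
    have "1 = r k ^ CARD('n) * (real k + 1) ^ CARD('n)" by (simp add: r_def power_one_over)
    also have "\<dots> \<le> r k ^ CARD('n) * (real (N k) * norm (density_fn (X k)))"
      using N[of k] XI(1)[of k] r by (intro mult_left_mono) (auto simp: pos_divide_le_eq less_imp_le)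
    also have "\<dots> = norm (z (V k))" using r[of k] by (simp add: zV)
    finally show ?thesis .
  qed
  have lim: "(\<lambda>k. V k p) \<longlonglongrightarrow> 0" for p
  proof (rule Lim_null_comparison)
    obtain K :: nat where K: "norm p \<le> real K" using real_arch_simple by blast
    show "\<forall>\<^sub>F k in sequentially. norm (V k p) \<le> r k * (real CARD('n) * norm p)"
    proof (rule eventually_sequentiallyI[of K])
      fix k assume "K \<le> k"
      let ?i = "I k"
      have "\<bar>p $ ?i\<bar> \<le> real k" using component_le_norm_cart[of p ?i] K \<open>K \<le> k\<close> by linarith
      then have i: "max 0 (p $ ?i - X k $ ?i) = c k * (p $ ?i - X k $ ?i)"
        using XI(2)[of k] by (auto simp: c_def max_def)
      have "corner (upd 1 ?i (real (N k))) (X k) p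
          = real (N k) * max 0 (p $ ?i - X k $ ?i) + (\<Sum>j\<in>UNIV - {?i}. max 0 (p $ j - X k $ j))"
        unfolding corner_def by (subst sum.remove[of _ ?i]) (auto intro!: sum.cong)
      then have corner_eq: "corner (upd 1 ?i (real (N k))) (X k) p
          = real (N k) * (c k * (p $ ?i - X k $ ?i)) + (\<Sum>j\<in>UNIV - {?i}. max 0 (p $ j - X k $ j))"
        by (simp only: i)
      have "V k p = r k * (corner (upd 1 ?i (real (N k))) (X k) p - real (N k) * (c k * (p $ ?i - X k $ ?i))
          - (\<Sum>j\<in>UNIV - {?i}. max 0 (- X k $ j)))"
        unfolding V_def by (simp add: inner_axis' algebra_simps)
      also have "\<dots> = r k * (\<Sum>j\<in>UNIV - {?i}. max 0 (p $ j - X k $ j) - max 0 (- X k $ j))"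
        unfolding corner_eq by (simp add: sum_subtractf)
      finally have V_eq: "V k p = r k * (\<Sum>j\<in>UNIV - {?i}. max 0 (p $ j - X k $ j) - max 0 (- X k $ j))" .
      have "norm (V k p) = r k * \<bar>\<Sum>j\<in>UNIV - {?i}. max 0 (p $ j - X k $ j) - max 0 (- X k $ j)\<bar>"
        unfolding V_eq using r[of k] by (simp add: abs_mult)
      also have "\<bar>\<Sum>j\<in>UNIV - {?i}. max 0 (p $ j - X k $ j) - max 0 (- X k $ j)\<bar>
          \<le> (\<Sum>j\<in>UNIV - {?i}. \<bar>max 0 (p $ j - X k $ j) - max 0 (- X k $ j)\<bar>)" by (rule sum_abs)
      also have "\<dots> \<le> (\<Sum>j\<in>UNIV - {?i}. norm p)"
      proof (rule sum_mono)
        fix j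
        have "\<bar>max 0 (p $ j - X k $ j) - max 0 (- X k $ j)\<bar> \<le> \<bar>p $ j\<bar>" by (auto simp: max_def)
        then show "\<bar>max 0 (p $ j - X k $ j) - max 0 (- X k $ j)\<bar> \<le> norm p"
          using component_le_norm_cart[of p j] by linarith
      qed
      also have "\<dots> \<le> real CARD('n) * norm p"
        by (simp add: mult_right_mono card_Diff_subset)
      finally show "norm (V k p) \<le> r k * (real CARD('n) * norm p)"
        using r[of k] by (simp add: mult_left_mono)
    qed
    have "r \<longlonglongrightarrow> 0"
      unfolding r_def using LIMSEQ_inverse_real_of_nat by (simp add: inverse_eq_divide add.commute)
    then show "(\<lambda>k. r k * (real CARD('n) * norm p)) \<longlonglongrightarrow> 0" by (rule tendsto_mult_left_zero)
  qed
  have "(\<lambda>x::real^'n. 0) \<in> Conv" using affine_in_Conv[of 0 0] by simp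
  from tendsto[of _ V, OF this VC lim] have "(\<lambda>k. z (V k)) \<longlonglongrightarrow> 0" by (simp add: zero)
  then have "(\<lambda>k. norm (z (V k))) \<longlonglongrightarrow> 0" by (simp add: tendsto_norm_zero)
  then have "\<forall>\<^sub>F k in sequentially. norm (z (V k)) < 1" by (rule order_tendstoD) simp
  then show False using big by (meson eventually_sequentially le_refl linorder_not_less)
qed

lemma density_fn_Cc: "density_fn \<in> Cc"
  using density_fn_bounded_support density_fn_continuous Cc_I by metis

end

section \<open>Strongly convex functions and their conjugates\<close>

lemma strongly_convex_subdiff:
  fixes v :: "real^'n \<Rightarrow> real"
  assumes v: "v \<in> Conv" and y: "y \<in> subdiff (\<lambda>x. v x + e * (norm x)\<^sup>2) x"
  shows "v x + e * (norm x)\<^sup>2 + y \<bullet> (p - x) + e / 2 * (norm (p - x))\<^sup>2 \<le> v p + e * (norm p)\<^sup>2"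
proof -
  \<comment> \<open>At the midpoint the squared norm gains e * |p - x|^2 / 4 over linear
    interpolation; doubling the inequality gives the constant e / 2.\<close>
  let ?m = "(1 - 1 / 2) *\<^sub>R x + (1 / 2) *\<^sub>R p :: real^'n"
  have "v x + e * (norm x)\<^sup>2 + y \<bullet> (?m - x) \<le> v ?m + e * (norm ?m)\<^sup>2" using subdiffD[OF y] .
  moreover have "?m - x = (1 / 2) *\<^sub>R (p - x)" by (simp add: algebra_simps vec_eq_iff) 
  moreover have "v ?m \<le> (1 - 1 / 2) * v x + 1 / 2 * v p" by (rule Conv_D[OF v]) auto
  moreover have "e * (norm ?m)\<^sup>2 = e * (norm x)\<^sup>2 / 2 + e * (norm p)\<^sup>2 / 2 - e * (norm (p - x))\<^sup>2 / 4"
    unfolding norm_convex_combination by (simp add: algebra_simps)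
  ultimately show ?thesis by simp
qed

text \<open>Coercivity makes every slope attained. Adding the strong subgradient inequalities at two
  points gives e |x' - x|^2 \<le> (y' - y) \<bullet> (x' - x), whence uniqueness and the Lipschitz
  constant 1 / e.\<close>

lemma strongly_convex_resolvent:
  fixes v :: "real^'n \<Rightarrow> real"
  assumes v: "v \<in> Conv" and e: "e > 0"
  defines "w \<equiv> \<lambda>x. v x + e * (norm x)\<^sup>2"
  shows "grad_domain w = UNIV" "y \<in> subdiff w x \<Longrightarrow> resolvent w y = x"
    "norm (resolvent w y' - resolvent w y) \<le> norm (y' - y) / e"
proof -
  have wC: "w \<in> Conv" unfolding w_def using v e by (intro Conv_add Conv_cmul norm_square_Conv) auto
  have strong: "w x + y \<bullet> (p - x) + e / 2 * (norm (p - x))\<^sup>2 \<le> w p" if "y \<in> subdiff w x" for x y p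
    using strongly_convex_subdiff[OF v that[unfolded w_def], of p] by (simp add: w_def)
  have lip: "e * norm (x' - x) \<le> norm (y' - y)" if "y \<in> subdiff w x" "y' \<in> subdiff w x'" for x y x' y'
  proof -
    have "e * (norm (x' - x))\<^sup>2 \<le> (y' - y) \<bullet> (x' - x)"
      using strong[OF that(1), of x'] strong[OF that(2), of x] by (simp add: inner_simps norm_minus_commute)
    also have "\<dots> \<le> norm (y' - y) * norm (x' - x)" by (rule norm_cauchy_schwarz)
    finally show ?thesis by (cases "x' = x") (simp_all add: power2_eq_square)
  qed
  show dom: "grad_domain w = UNIV"
  proof (intro set_eqI iffI UNIV_I)
    fix y
    obtain g where g: "g \<in> subdiff v 0" using subdiff_nonempty[OF v] .
    define h where "h p = w p - y \<bullet> p" for p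
    \<comment> \<open>Beyond this radius the term e |p|^2 outweighs the linear term (g - y)
      \<bullet> p left by a subgradient g of v at 0, so a minimiser may be sought in the
      ball.\<close>
    define R where "R = norm (g - y) / e"
    have R: "R \<ge> 0" using e by (simp add: R_def)
    have far: "h 0 \<le> h p" if "norm p \<ge> R" for p
    proof -
      have "- (norm (g - y) * norm p) \<le> (g - y) \<bullet> p"
        using norm_cauchy_schwarz[of "g - y" "- p"] by simp
      moreover have "norm (g - y) * norm p \<le> e * (norm p)\<^sup>2"
      proof -
        have "norm (g - y) \<le> e * norm p" using that e by (simp add: R_def pos_divide_le_eq mult.commute)
        from mult_right_mono[OF this, of "norm p"] show ?thesis by (simp add: power2_eq_square mult.assoc)
      qed
      moreover have "v 0 + g \<bullet> p \<le> v p" using subdiffD[OF g, of p] by simp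
      ultimately show ?thesis by (simp add: h_def w_def inner_simps)
    qed
    have "continuous_on (cball 0 R) h"
      unfolding h_def by (intro continuous_intros Conv_continuous wC)
    then obtain m where m: "m \<in> cball 0 R" "\<And>p. p \<in> cball 0 R \<Longrightarrow> h m \<le> h p"
      using continuous_attains_inf[of "cball 0 R" h] R by auto
    have "h m \<le> h p" for p
      using m(2)[of p] m(2)[of 0] far[of p] R by (cases "norm p \<le> R") auto
    then have "y \<in> subdiff w m" by (simp add: subdiff_alt h_def)
    then show "y \<in> grad_domain w" by (rule grad_domainI)
  qed
  show "resolvent w y = x" if "y \<in> subdiff w x"
  proof -
    have "y \<in> subdiff w (resolvent w y)" by (rule resolvent) (simp add: dom)
    from lip[OF this that] show ?thesis using e by (simp add: mult_le_0_iff)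
  qed
  have "e * norm (resolvent w y' - resolvent w y) \<le> norm (y' - y)"
    by (rule lip) (auto intro!: resolvent simp: dom)
  then show "norm (resolvent w y' - resolvent w y) \<le> norm (y' - y) / e"
    using e by (simp add: pos_le_divide_eq mult.commute)
qed

text \<open>The function is the conjugate of w, by equality in Fenchel's inequality at the
  resolvent. The lower bound is the subgradient inequality for w; exchanging y and y' in it and
  using the Lipschitz bound gives the upper one.\<close>

lemma strongly_convex_quadratic_pair:
  fixes v :: "real^'n \<Rightarrow> real"
  assumes v: "v \<in> Conv" and e: "e > 0"
  defines "w \<equiv> \<lambda>x. v x + e * (norm x)\<^sup>2"
  shows "quadratic_pair (\<lambda>y. y \<bullet> resolvent w y - w (resolvent w y)) (resolvent w) (1 / e)"
proof -
  note sc = strongly_convex_resolvent[OF v e, folded w_def]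
  define u where "u y = y \<bullet> resolvent w y - w (resolvent w y)" for y
  have sub: "y \<in> subdiff w (resolvent w y)" for y by (rule resolvent) (simp add: sc(1))
  have lower: "u y + resolvent w y \<bullet> (y' - y) \<le> u y'" for y y'
    using subdiffD[OF sub[of y'], of "resolvent w y"] by (simp add: u_def inner_simps inner_commute)
  have upper: "u y' \<le> u y + resolvent w y \<bullet> (y' - y) + 1 / e * (norm (y' - y))\<^sup>2" for y y'
  proof -
    have "u y' \<le> u y + resolvent w y' \<bullet> (y' - y)" using lower[of y' y] by (simp add: inner_simps)
    also have "\<dots> = u y + resolvent w y \<bullet> (y' - y) + (resolvent w y' - resolvent w y) \<bullet> (y' - y)"
      by (simp add: inner_simps)
    also have "(resolvent w y' - resolvent w y) \<bullet> (y' - y) \<le> norm (resolvent w y' - resolvent w y) * norm (y' - y)"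
      by (rule norm_cauchy_schwarz)
    also have "\<dots> \<le> norm (y' - y) / e * norm (y' - y)" by (intro mult_right_mono sc(3)) simp
    finally show ?thesis by (simp add: power2_eq_square)
  qed
  have "(1 / e)-lipschitz_on UNIV (resolvent w)"
    using sc(3) e by (intro lipschitz_onI) (auto simp: dist_norm)
  then have "continuous_on UNIV (resolvent w)" by (rule lipschitz_on_continuous_on)
  then show ?thesis using lower upper e unfolding quadratic_pair_def u_def by simp
qed

context top_degree_valuation
begin

text \<open>Along growing cubes both sides become stationary: the conjugate at each x once the cube
  contains a subgradient of w at x, and the integral once the cube contains the bounded set where
  the integrand is not 0.\<close>

lemma strongly_convex_representation:
  assumes v: "v \<in> Conv" and e: "e > 0"
  defines "w \<equiv> \<lambda>x. v x + e * (norm x)\<^sup>2"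
  shows "z w = integral\<^sup>L (MA w) density_fn"
proof -
  note sc = strongly_convex_resolvent[OF v e, folded w_def]
  have wC: "w \<in> Conv" unfolding w_def using v e by (intro Conv_add Conv_cmul norm_square_Conv) auto
  define u where "u y = y \<bullet> resolvent w y - w (resolvent w y)" for y
  have qp: "quadratic_pair u (resolvent w) (1 / e)"
    using strongly_convex_quadratic_pair[OF v e] unfolding u_def[abs_def] w_def .
  note uC = quadratic_pair_Conv[OF qp]
  have sub: "y \<in> subdiff w (resolvent w y)" for y by (rule resolvent) (simp add: sc(1))
  \<comment> \<open>Half-width k + 1 rather than k, so that the side is positive already for k =
    0.\<close>
  define Q where "Q k = slab (- (real (Suc k) *\<^sub>R 1)) ((2 * real (Suc k)) *\<^sub>R 1 :: real^'n)" for k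
  have memQ: "y \<in> Q k" if "norm y \<le> real k" for y k
  proof -
    have "- real (Suc k) \<le> y $ j \<and> y $ j \<le> real (Suc k)" for j
      using component_le_norm_cart[of y j] that unfolding of_nat_Suc by linarith
    then show ?thesis by (auto simp: Q_def mem_slab)
  qed
  have Qn: "Q k \<noteq> {}" "compact (Q k)" for k using memQ[of 0 k] by (auto simp: Q_def)
  have "(\<lambda>k. z (conj_on u (Q k))) \<longlonglongrightarrow> z w"
  proof (rule tendsto[OF wC])
    show "conj_on u (Q k) \<in> Conv" for k by (intro conj_on_Conv Qn Conv_continuous uC)
    fix x
    obtain y where y: "y \<in> subdiff w x" using subdiff_nonempty[OF wC] .
    obtain K :: nat where K: "norm y \<le> real K" using real_arch_simple by blast
    have Ry: "resolvent w y = x" by (rule sc(2)[OF y])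
    have xy: "x \<bullet> y - u y = w x" by (simp add: u_def Ry inner_commute)
    \<comment> \<open>The supremum of x \<bullet> y' - u y' over all y' is attained at the
      subgradient y, so restricting it to a cube containing y changes nothing.\<close>
    have "conj_on u (Q k) x = w x" if "K \<le> k" for k
    proof -
      have "conj_on u (Q k) x = x \<bullet> y - u y"
      proof (rule conj_on_eqI)
        show "y \<in> Q k" using K that by (intro memQ) simp
        fix y'
        show "x \<bullet> y' - u y' \<le> x \<bullet> y - u y"
          unfolding xy using subdiffD[OF sub[of y'], of x] by (simp add: u_def inner_simps inner_commute)
      qed
      then show ?thesis by (simp add: xy)
    qed
    then show "(\<lambda>k. conj_on u (Q k) x) \<longlonglongrightarrow> w x"
      by (intro tendsto_eventually eventually_sequentiallyI[of K]) auto
  qed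
  moreover have "\<forall>\<^sub>F k in sequentially. z (conj_on u (Q k)) = integral\<^sup>L (MA w) density_fn"
  proof -
    let ?h = "\<lambda>y. density_fn (resolvent w y)"
    have MI: "MA_integrand density_fn w = ?h" by (auto simp: MA_integrand_def sc(1))
    have int: "integrable lebesgue ?h" using MA_integrand_integrable[OF wC density_fn_Cc] by (simp add: MI)
    have MAw: "integral\<^sup>L (MA w) density_fn = integral UNIV ?h"
      using integral_MA[OF wC Cc_borel[OF density_fn_Cc]] integral_lebesgue[OF int] by (simp add: MI)
    obtain R where R: "\<And>x. density_fn x \<noteq> 0 \<Longrightarrow> norm x \<le> R" using density_fn_bounded_support by blast
    obtain M where M: "\<And>x. norm x \<le> R + 1 \<Longrightarrow> \<bar>w x\<bar> \<le> M" using Conv_bounded_on_ball[OF wC] by metis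
    \<comment> \<open>By \<open>subdiff_bound\<close>, the slopes whose resolvent lies in the
      support of the density have norm at most 2 * M.\<close>
    obtain K :: nat where K: "2 * M \<le> real K" using real_arch_simple by blast
    have "z (conj_on u (Q k)) = integral\<^sup>L (MA w) density_fn" if "K \<le> k" for k
    proof -
      have supp: "?h y = 0" if "y \<notin> Q k" for y
      proof (rule ccontr)
        assume "?h y \<noteq> 0"
        then have "norm (resolvent w y) \<le> R" by (rule R)
        then have "norm y \<le> 2 * M" using M by (rule subdiff_bound[OF sub])
        then show False using memQ[of y k] that K \<open>K \<le> k\<close> by (simp add: order_trans)
      qed
      have "z (conj_on u (Q k)) = integral (Q k) ?h"
        using slab_val_cube[OF qp, of "2 * real (Suc k)" "- (real (Suc k) *\<^sub>R 1)"]
        unfolding slab_val_def Q_def by simp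
      also have "\<dots> = integral UNIV (\<lambda>y. if y \<in> Q k then ?h y else 0)" by (rule integral_restrict_UNIV[symmetric])
      also have "(\<lambda>y. if y \<in> Q k then ?h y else 0) = ?h" using supp by auto
      finally show ?thesis by (simp add: MAw)
    qed
    then show ?thesis by (rule eventually_sequentiallyI)
  qed
  then have "(\<lambda>k. z (conj_on u (Q k))) \<longlonglongrightarrow> integral\<^sup>L (MA w) density_fn" by (rule tendsto_eventually)
  ultimately show ?thesis by (rule LIMSEQ_unique)
qed

lemma representation:
  assumes v: "v \<in> Conv"
  shows "z v = integral\<^sup>L (MA v) density_fn"
proof -
  define V where "V k x = v x + (1 / (real k + 1)) * (norm x)\<^sup>2" for k x
  have VC: "V k \<in> Conv" for k
    unfolding V_def using v by (intro Conv_add Conv_cmul norm_square_Conv) auto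
  have lim: "(\<lambda>k. V k x) \<longlonglongrightarrow> v x" for x
  proof -
    have "(\<lambda>k. 1 / (real k + 1)) \<longlonglongrightarrow> 0"
      using LIMSEQ_inverse_real_of_nat by (simp add: inverse_eq_divide add.commute)
    from tendsto_add[OF tendsto_const tendsto_mult_left_zero[OF this], of "v x" "(norm x)\<^sup>2"]
    show ?thesis by (simp add: V_def)
  qed
  have "(\<lambda>k. z (V k)) \<longlonglongrightarrow> z v" by (rule tendsto[OF v VC lim])
  moreover have "z (V k) = integral\<^sup>L (MA (V k)) density_fn" for k
    unfolding V_def by (rule strongly_convex_representation[OF v]) simp
  moreover have "(\<lambda>k. integral\<^sup>L (MA (V k)) density_fn) \<longlonglongrightarrow> integral\<^sup>L (MA v) density_fn"
    by (intro integral_MA_locally_uniform Conv_pointwise_locally_uniform v VC lim density_fn_Cc)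
  ultimately show ?thesis using LIMSEQ_unique by simp
qed

end

section \<open>Equivariance\<close>

lemma norm_diff_Conv: "(\<lambda>p. norm (p - x)) \<in> Conv" for x :: "real^'n"
  using convex_on_dist[of UNIV x] by (simp add: Conv_def dist_norm norm_minus_commute)

text \<open>The Monge-Ampere measure of a cone with apex x is a point mass there: every y in the
  unit ball is a subgradient at x, and a subgradient at any point has norm at most 1.\<close>

lemma integral_MA_norm:
  fixes \<psi> :: "real^'n \<Rightarrow> real^'n"
  assumes "\<psi> \<in> borel_measurable borel"
  shows "integral\<^sup>L (MA (\<lambda>p. norm (p - x))) \<psi> = measure lebesgue (cball (0::real^'n) 1) *\<^sub>R \<psi> x"
proof -
  let ?v = "\<lambda>p. norm (p - x)"
  have C: "?v \<in> Conv" by (rule norm_diff_Conv)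
  have in_x: "y \<in> subdiff ?v x" if "norm y \<le> 1" for y
    using norm_cauchy_schwarz[of y] that mult_right_mono[OF that norm_ge_zero]
    by (auto simp: subdiff_def intro: order_trans)
  have dom: "grad_domain ?v = cball 0 1"
  proof (intro set_eqI iffI)
    fix y assume "y \<in> grad_domain ?v"
    then obtain p where "y \<in> subdiff ?v p" using resolvent by blast
    from subdiffD[OF this, of "p + y"] have "norm (p - x) + (norm y)\<^sup>2 \<le> norm (p + y - x)"
      by (simp add: power2_norm_eq_inner)
    also have "\<dots> \<le> norm (p - x) + norm y" using norm_triangle_ineq[of "p - x" y] by (simp add: algebra_simps)
    finally have "norm y * norm y \<le> norm y * 1" by (simp add: power2_eq_square)
    then have "norm y \<le> 1" by (cases "y = 0") simp_all
    then show "y \<in> cball 0 1" by simp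
  next
    fix y :: "real^'n" assume "y \<in> cball 0 1"
    then have "norm y \<le> 1" by simp
    then show "y \<in> grad_domain ?v" by (rule grad_domainI[OF in_x])
  qed
  have ae: "AE y in lebesgue. MA_integrand \<psi> ?v y = indicator (cball 0 1) y *\<^sub>R \<psi> x"
    using negligible_multi_subgrad[OF C]
  proof (rule AE_not_negligible)
    fix y assume y: "y \<notin> multi_subgrad ?v"
    show "MA_integrand \<psi> ?v y = indicator (cball 0 1) y *\<^sub>R \<psi> x"
      using resolvent_eq[OF in_x y] unfolding MA_integrand_def dom by (simp add: indicator_def)
  qed
  have "integral\<^sup>L lebesgue (MA_integrand \<psi> ?v) = (LINT y|lebesgue. indicator (cball (0::real^'n) 1) y *\<^sub>R \<psi> x)"
    by (rule integral_cong_AE[OF MA_integrand_measurable[OF C assms] _ ae]) (intro borel_measurable_scaleR borel_measurable_indicator; simp)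
  then show ?thesis using integral_MA[OF C assms] emeasure_bounded_finite[of "cball (0::real^'n) 1"] by simp
qed

lemma measure_unit_ball_pos: "measure lebesgue (cball (0::real^'n) 1) > 0"
  using content_cball_pos[of 1 "0::real^'n"] by simp

lemma orthogonal_inner: "orthogonal_transformation \<theta> \<Longrightarrow> \<theta> x \<bullet> \<theta> y = x \<bullet> y"
  by (simp add: orthogonal_transformation_def)

lemma orthogonal_inv:
  assumes "orthogonal_transformation (\<theta> :: real^'n \<Rightarrow> real^'n)"
  shows "\<theta> (inv \<theta> x) = x" "inv \<theta> (\<theta> x) = x" "orthogonal_transformation (inv \<theta>)" "inv (inv \<theta>) = \<theta>"
  using orthogonal_transformation_bij[OF assms] orthogonal_transformation_inv[OF assms]
  by (simp_all add: bij_is_surj surj_f_inv_f bij_is_inj inv_inv_eq)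

lemma Conv_comp_orthogonal:
  fixes \<theta> :: "real^'n \<Rightarrow> real^'n"
  assumes "v \<in> Conv" "orthogonal_transformation \<theta>"
  shows "v \<circ> \<theta> \<in> Conv"
proof -
  have "linear \<theta>" using assms(2) by (simp add: orthogonal_transformation_def)
  then have "convex_on UNIV (v \<circ> \<theta>)"
    using Conv_D[OF assms(1)] by (intro convex_onI) (simp_all add: linear_add linear_cmul)
  then show ?thesis by (simp add: Conv_def)
qed

context top_degree_valuation
begin

lemma density_fn_unique:
  assumes "\<psi> \<in> Cc" "\<And>v. v \<in> Conv \<Longrightarrow> z v = integral\<^sup>L (MA v) \<psi>"
  shows "\<psi> = density_fn"
proof
  fix x
  have "measure lebesgue (cball (0::real^'n) 1) *\<^sub>R \<psi> x = measure lebesgue (cball (0::real^'n) 1) *\<^sub>R density_fn x"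
    using integral_MA_norm[OF Cc_borel[OF assms(1)], of x] integral_MA_norm[OF Cc_borel[OF density_fn_Cc], of x]
      assms(2)[OF norm_diff_Conv[of x]] representation[OF norm_diff_Conv[of x]] by simp
  then show "\<psi> x = density_fn x" using measure_unit_ball_pos[where 'n = 'n] by simp
qed

lemma norm_test: "z (\<lambda>p. norm (p - x)) = measure lebesgue (cball (0::real^'n) 1) *\<^sub>R density_fn x"
  using representation[OF norm_diff_Conv[of x]] integral_MA_norm[OF Cc_borel[OF density_fn_Cc]] by simp

text \<open>Conjugating z by \<theta> stays within the class, so the representation applies to the
  conjugate too. This replaces a change of variables for \<open>MA\<close> under \<theta>.\<close>

lemma conjugate_valuation:
  fixes \<theta> :: "real^'n \<Rightarrow> real^'n"
  assumes \<theta>: "orthogonal_transformation \<theta>"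
  shows "top_degree_valuation (\<lambda>v. inv \<theta> (z (v \<circ> inv \<theta>)))"
proof -
  let ?i = "inv \<theta>"
  note i = orthogonal_inv[OF \<theta>]
  have lin: "linear ?i" using i(3) by (simp add: orthogonal_transformation_def)
  have C: "v \<circ> ?i \<in> Conv" if "v \<in> Conv" for v using Conv_comp_orthogonal[OF that i(3)] .
  show ?thesis
  proof
    show "continuous_map Conv_top euclidean (\<lambda>v. ?i (z (v \<circ> ?i)))"
    proof (rule continuous_map_Conv_topI)
      fix v :: "real^'n \<Rightarrow> real" and V assume v: "v \<in> Conv" "\<And>k. V k \<in> Conv" and lu: "locally_uniform V v"
      have "(\<lambda>k. V k x) \<longlonglongrightarrow> v x" for x
      proof (rule tendstoI)
        fix e :: real assume "e > 0"
        then have "\<forall>\<^sub>F k in sequentially. \<forall>p. norm p \<le> norm x \<longrightarrow> \<bar>V k p - v p\<bar> < e"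
          using lu by (auto simp: locally_uniform_def)
        then show "\<forall>\<^sub>F k in sequentially. dist (V k x) (v x) < e"
          by eventually_elim (simp add: dist_real_def)
      qed
      then have "(\<lambda>k. z (V k \<circ> ?i)) \<longlonglongrightarrow> z (v \<circ> ?i)"
        using v C by (intro tendsto) auto
      then show "(\<lambda>k. ?i (z (V k \<circ> ?i))) \<longlonglongrightarrow> ?i (z (v \<circ> ?i))"
        by (rule linear_continuous_at[OF linear_conv_bounded_linear[THEN iffD1, OF lin], THEN isCont_tendsto_compose])
    qed
    show "is_valuation (\<lambda>v. ?i (z (v \<circ> ?i)))"
      unfolding is_valuation_def
    proof (intro ballI impI)
      fix v w :: "real^'n \<Rightarrow> real"
      assume vw: "v \<in> Conv" "w \<in> Conv" "(\<lambda>x. max (v x) (w x)) \<in> Conv" "(\<lambda>x. min (v x) (w x)) \<in> Conv"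
      have "z (\<lambda>x. max ((v \<circ> ?i) x) ((w \<circ> ?i) x)) + z (\<lambda>x. min ((v \<circ> ?i) x) ((w \<circ> ?i) x)) = z (v \<circ> ?i) + z (w \<circ> ?i)"
        using valuation C[OF vw(1)] C[OF vw(2)] C[OF vw(3)] C[OF vw(4)]
        unfolding is_valuation_def by (simp add: o_def)
      then show "?i (z ((\<lambda>x. max (v x) (w x)) \<circ> ?i)) + ?i (z ((\<lambda>x. min (v x) (w x)) \<circ> ?i))
          = ?i (z (v \<circ> ?i)) + ?i (z (w \<circ> ?i))"
        by (simp add: o_def linear_add[OF lin, symmetric])
    qed
    show "dually_epi_translation_invariant (\<lambda>v. ?i (z (v \<circ> ?i)))"
      unfolding dually_epi_translation_invariant_def
    proof (intro ballI allI)
      fix v :: "real^'n \<Rightarrow> real" and y c assume v: "v \<in> Conv"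
      have "y \<bullet> ?i x = \<theta> y \<bullet> x" for x using orthogonal_inner[OF \<theta>, of y "?i x"] by (simp add: i(1))
      then have "(\<lambda>x. v x + y \<bullet> x + c) \<circ> ?i = (\<lambda>x. (v \<circ> ?i) x + \<theta> y \<bullet> x + c)" by (simp add: o_def)
      then show "?i (z ((\<lambda>x. v x + y \<bullet> x + c) \<circ> ?i)) = ?i (z (v \<circ> ?i))"
        using affine_invariant[OF C[OF v], of "\<theta> y" c] by simp
    qed
    show "homogeneous_deg CARD('n) (\<lambda>v. ?i (z (v \<circ> ?i)))"
      unfolding homogeneous_deg_def
    proof (intro ballI allI impI)
      fix v :: "real^'n \<Rightarrow> real" and r :: real assume "v \<in> Conv" "r > 0"
      then show "?i (z ((\<lambda>x. r * v x) \<circ> ?i)) = r ^ CARD('n) *\<^sub>R ?i (z (v \<circ> ?i))"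
        using scale[OF C, of v r] by (simp add: o_def linear_cmul[OF lin])
    qed
  qed
qed

text \<open>Equivariance of z at the cones |. - x| is equivariance of the density. Conversely, an
  equivariant density is also the density of the conjugated valuation, and the representation then
  identifies the two valuations.\<close>

lemma equivariant_iff:
  fixes \<theta> :: "real^'n \<Rightarrow> real^'n"
  assumes \<theta>: "orthogonal_transformation \<theta>"
  shows "(\<forall>v\<in>Conv. z (v \<circ> inv \<theta>) = \<theta> (z v)) \<longleftrightarrow> (\<forall>x. density_fn (\<theta> x) = \<theta> (density_fn x))"
proof -
  let ?i = "inv \<theta>" and ?\<kappa> = "measure lebesgue (cball (0::real^'n) 1)"
  note i = orthogonal_inv[OF \<theta>]
  have lin: "linear \<theta>" "linear ?i" using \<theta> i(3) by (simp_all add: orthogonal_transformation_def)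
  have test: "(\<lambda>p. norm (p - x)) \<circ> ?i = (\<lambda>p. norm (p - \<theta> x))" for x
  proof
    fix p
    have "norm (?i p - x) = norm (\<theta> (?i p - x))" using orthogonal_transformation_norm[OF \<theta>] by simp
    then show "((\<lambda>p. norm (p - x)) \<circ> ?i) p = norm (p - \<theta> x)" by (simp add: linear_diff[OF lin(1)] i(1))
  qed
  show ?thesis
  proof
    assume eq: "\<forall>v\<in>Conv. z (v \<circ> ?i) = \<theta> (z v)"
    show "\<forall>x. density_fn (\<theta> x) = \<theta> (density_fn x)"
    proof
      fix x
      have "?\<kappa> *\<^sub>R density_fn (\<theta> x) = ?\<kappa> *\<^sub>R \<theta> (density_fn x)"
        using bspec[OF eq norm_diff_Conv[of x]] by (simp add: test norm_test linear_cmul[OF lin(1)])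
      then show "density_fn (\<theta> x) = \<theta> (density_fn x)" using measure_unit_ball_pos[where 'n = 'n] by simp
    qed
  next
    assume eq: "\<forall>x. density_fn (\<theta> x) = \<theta> (density_fn x)"
    interpret c: top_degree_valuation "\<lambda>v. ?i (z (v \<circ> ?i))" using conjugate_valuation[OF \<theta>] .
    have "c.density_fn = density_fn"
    proof
      fix x
      have "?\<kappa> *\<^sub>R c.density_fn x = ?\<kappa> *\<^sub>R density_fn x"
        using c.norm_test[of x] by (simp add: test norm_test eq linear_cmul[OF lin(2)] i(2))
      then show "c.density_fn x = density_fn x" using measure_unit_ball_pos[where 'n = 'n] by simp
    qed
    then have "?i (z (v \<circ> ?i)) = z v" if "v \<in> Conv" for v
      using c.representation[OF that] representation[OF that] by simp
    then show "\<forall>v\<in>Conv. z (v \<circ> ?i) = \<theta> (z v)" using i(1) by metis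
  qed
qed

end

section \<open>Radial vector fields\<close>

definition radial :: "(real \<Rightarrow> real) \<Rightarrow> real^'n \<Rightarrow> real^'n" where
  "radial \<xi> x = (if x = 0 then 0 else \<xi> (norm x) *\<^sub>R x)"

lemma tstar_radial: "tstar \<xi> v = integral\<^sup>L (MA v) (radial \<xi>)"
  by (simp add: tstar_def radial_def[abs_def])

lemma radial_equivariant:
  assumes "orthogonal_transformation \<theta>"
  shows "radial \<xi> (\<theta> x) = \<theta> (radial \<xi> x)"
proof -
  have lin: "linear \<theta>" using assms by (simp add: orthogonal_transformation_def)
  have "\<theta> x = 0 \<longleftrightarrow> x = 0" using orthogonal_transformation_norm[OF assms, of x] norm_eq_zero by metis
  then show ?thesis
    using orthogonal_transformation_norm[OF assms, of x] by (simp add: radial_def linear_cmul[OF lin] linear_0[OF lin])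
qed

lemma radial_Cc:
  assumes \<xi>: "\<xi> \<in> Cb_pos" and lim: "((\<lambda>t. \<xi> t * t) \<longlongrightarrow> 0) (at_right 0)"
  shows "radial \<xi> \<in> (Cc :: (real^'n \<Rightarrow> real^'n) set)"
proof -
  have c: "continuous_on {0<..} \<xi>" using \<xi> by (simp add: Cb_pos_def)
  obtain b where b: "\<And>t. t > b \<Longrightarrow> \<xi> t = 0" using \<xi> by (auto simp: Cb_pos_def)
  have "isCont (radial \<xi>) x" for x :: "real^'n"
  proof (cases "x = 0")
    case True
    have "filterlim norm (at_right 0) (at (0::real^'n))"
      unfolding filterlim_at by (auto intro!: tendsto_norm_zero simp: eventually_at_filter)
    from filterlim_compose[OF lim this] have "((\<lambda>x::real^'n. norm (\<xi> (norm x) * norm x)) \<longlongrightarrow> 0) (at 0)"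
      by (rule tendsto_norm_zero)
    then have "((\<lambda>x::real^'n. norm (radial \<xi> x)) \<longlongrightarrow> 0) (at 0)"
      by (rule Lim_transform_eventually) (auto simp: radial_def eventually_at_filter abs_mult)
    then have "(radial \<xi> \<longlongrightarrow> 0) (at (0::real^'n))" by (rule tendsto_norm_zero_cancel)
    then show ?thesis using True by (simp add: isCont_def radial_def)
  next
    case False
    have "continuous_on (- {0}) (\<lambda>x::real^'n. \<xi> (norm x) *\<^sub>R x)"
      by (intro continuous_intros continuous_on_compose2[OF c]) auto
    then have "isCont (\<lambda>x::real^'n. \<xi> (norm x) *\<^sub>R x) x"
      using False by (simp add: continuous_on_eq_continuous_at open_Compl)
    moreover have "\<forall>\<^sub>F y in nhds x. \<xi> (norm y) *\<^sub>R y = radial \<xi> y"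
      using False t1_space_nhds[of x 0] by (auto simp: radial_def elim: eventually_mono)
    ultimately show ?thesis
      using isCont_cong[of "\<lambda>x. \<xi> (norm x) *\<^sub>R x" "radial \<xi>" x] by simp
  qed
  then have "continuous_on UNIV (radial \<xi> :: real^'n \<Rightarrow> _)" by (simp add: continuous_at_imp_continuous_on)
  moreover have "norm x \<le> b" if "radial \<xi> x \<noteq> 0" for x :: "real^'n"
    using b[of "norm x"] that by (cases "norm x \<le> b") (auto simp: radial_def split: if_splits)
  ultimately show ?thesis by (rule Cc_I)
qed

text \<open>Parallelism determines \<psi> on one ray as a multiple of its direction; the commuting
  orthogonal maps carry this from the ray to every sphere. The limit condition on \<xi> is
  continuity of \<psi> at the origin.\<close>

lemma radial_profile_exists:
  fixes \<psi> :: "real^'n \<Rightarrow> real^'n"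
  assumes \<psi>: "\<psi> \<in> Cc" and parallel: "\<And>x w. w \<bullet> x = 0 \<Longrightarrow> \<psi> x \<bullet> w = 0"
    and transitive: "\<And>a b. norm a = norm b \<Longrightarrow> \<exists>\<theta>. orthogonal_transformation \<theta> \<and> \<theta> a = b \<and> (\<forall>x. \<psi> (\<theta> x) = \<theta> (\<psi> x))"
  shows "\<exists>\<xi>\<in>Cb_pos. ((\<lambda>t. \<xi> t * t) \<longlongrightarrow> 0) (at_right 0) \<and> \<psi> = radial \<xi>"
proof -
  define e where "e = (axis undefined 1 :: real^'n)"
  have e: "norm e = 1" "e \<bullet> e = 1" by (simp_all add: e_def inner_axis_axis)
  have c: "continuous_on UNIV \<psi>" using \<psi> by (simp add: Cc_def)
  obtain R B where R: "\<And>x. \<psi> x \<noteq> 0 \<Longrightarrow> norm x \<le> R" "0 \<le> R" using CcE[OF \<psi>] by metis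
  define \<xi> where "\<xi> t = (\<psi> (t *\<^sub>R e) \<bullet> e) / t" for t
  \<comment> \<open>At the origin every w is orthogonal to x, in particular \<psi> 0 itself.\<close>
  have \<psi>0: "\<psi> 0 = 0" using parallel[of "\<psi> 0" 0] by simp
  have ray: "\<psi> (t *\<^sub>R e) = (\<xi> t * t) *\<^sub>R e" if "t > 0" for t
  proof -
    let ?w = "\<psi> (t *\<^sub>R e) - (\<psi> (t *\<^sub>R e) \<bullet> e) *\<^sub>R e"
    have we: "?w \<bullet> e = 0" using e by (simp add: inner_simps)
    then have "\<psi> (t *\<^sub>R e) \<bullet> ?w = 0" by (intro parallel) simp
    then have "?w \<bullet> ?w = 0" using we by (simp add: inner_diff_left inner_commute)
    then show ?thesis using that by (simp add: \<xi>_def)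
  qed
  have "\<psi> x = radial \<xi> x" for x
  proof (cases "x = 0")
    case False
    have "norm (norm x *\<^sub>R e) = norm x" using e by simp
    then obtain \<theta> where \<theta>: "orthogonal_transformation \<theta>" "\<theta> (norm x *\<^sub>R e) = x" "\<And>y. \<psi> (\<theta> y) = \<theta> (\<psi> y)"
      using transitive by blast
    have lin: "linear \<theta>" using \<theta>(1) by (simp add: orthogonal_transformation_def)
    have "\<psi> x = \<theta> (\<psi> (norm x *\<^sub>R e))" using \<theta>(2,3) by metis
    also have "\<dots> = \<theta> (\<xi> (norm x) *\<^sub>R (norm x *\<^sub>R e))" using ray[of "norm x"] False by simp
    also have "\<dots> = \<xi> (norm x) *\<^sub>R x" by (simp only: linear_cmul[OF lin, of "\<xi> (norm x)"] \<theta>(2))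
    finally show ?thesis using False by (simp add: radial_def)
  qed (simp add: \<psi>0 radial_def)
  then have "\<psi> = radial \<xi>" by (rule ext)
  moreover have "\<xi> \<in> Cb_pos"
  proof -
    have "continuous_on {0<..} \<xi>"
      unfolding \<xi>_def by (intro continuous_intros continuous_on_compose2[OF c]) auto
    moreover have "\<xi> t = 0" if "t > R" for t
    proof -
      have "norm (t *\<^sub>R e) > R" using R(2) that e by simp
      then have "\<psi> (t *\<^sub>R e) = 0" using R(1) linorder_not_less by blast
      then show ?thesis by (simp add: \<xi>_def)
    qed
    ultimately show ?thesis by (auto simp: Cb_pos_def)
  qed
  moreover have "((\<lambda>t. \<xi> t * t) \<longlongrightarrow> 0) (at_right 0)"
  proof -
    have "continuous_on UNIV (\<lambda>t::real. \<psi> (t *\<^sub>R e) \<bullet> e)"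
      by (intro continuous_intros continuous_on_compose2[OF c]) auto
    then have "isCont (\<lambda>t::real. \<psi> (t *\<^sub>R e) \<bullet> e) 0" by (simp add: continuous_on_eq_continuous_at)
    then have "((\<lambda>t::real. \<psi> (t *\<^sub>R e) \<bullet> e) \<longlongrightarrow> 0) (at_right 0)"
      unfolding isCont_def by (simp add: \<psi>0 filterlim_at_split)
    then show ?thesis
      by (rule Lim_transform_eventually) (auto simp: \<xi>_def eventually_at_filter)
  qed
  ultimately show ?thesis by blast
qed

lemma reflection_orthogonal:
  fixes w :: "real^'n"
  assumes "norm w = 1"
  shows "orthogonal_transformation (\<lambda>p. p - (2 * (p \<bullet> w)) *\<^sub>R w)"
proof -
  have "w \<bullet> w = 1" using assms by (simp add: norm_eq_1)
  then show ?thesis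
    unfolding orthogonal_transformation_def
    by (auto intro!: linearI simp: inner_simps algebra_simps inner_commute)
qed

text \<open>The half turn in the plane spanned by \<open>w\<close> and \<open>e\<close> is the square of a quarter turn,
  so its determinant is \<open>1\<close>.\<close>
lemma half_turn_rotation:
  fixes w e :: "real^'n"
  assumes "norm w = 1" "norm e = 1" "w \<bullet> e = 0"
  defines "\<theta> \<equiv> \<lambda>p. p - (2 * (p \<bullet> w)) *\<^sub>R w - (2 * (p \<bullet> e)) *\<^sub>R e"
  shows "orthogonal_transformation \<theta>" "det (matrix \<theta>) = 1"
proof -
  define S where "S p = p - (p \<bullet> w) *\<^sub>R w - (p \<bullet> e) *\<^sub>R e + (p \<bullet> w) *\<^sub>R e - (p \<bullet> e) *\<^sub>R w" for p
  have one: "w \<bullet> w = 1" "e \<bullet> e = 1" "e \<bullet> w = 0" using assms by (simp_all add: norm_eq_1 inner_commute)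
  have S: "orthogonal_transformation S"
    unfolding orthogonal_transformation_def S_def
    by (auto intro!: linearI simp: inner_simps algebra_simps inner_commute one assms(3))
  have SS: "\<theta> = S \<circ> S"
    by (rule ext) (simp add: \<theta>_def S_def inner_simps one assms(3) vec_eq_iff algebra_simps)
  show "orthogonal_transformation \<theta>" unfolding SS by (rule orthogonal_transformation_compose[OF S S])
  have lin: "linear S" using S by (simp add: orthogonal_transformation_def)
  have "det (matrix S) = 1 \<or> det (matrix S) = - 1"
    using S by (intro det_orthogonal_matrix) (simp add: orthogonal_transformation_matrix)
  then show "det (matrix \<theta>) = 1"
    unfolding SS matrix_compose[OF lin lin] by (auto simp: det_mul)
qed

lemma third_direction:
  fixes x w :: "real^'n"
  assumes "CARD('n) \<ge> 3"
  obtains e where "norm e = 1" "e \<bullet> x = 0" "e \<bullet> w = 0"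
proof -
  have "dim {x, w} \<le> card {x, w}" by (rule dim_le_card) (auto intro: span_base)
  also have "\<dots> \<le> 2" by (simp add: card_insert_if)
  finally have "dim {x, w} < DIM(real^'n)" using assms by simp
  from orthogonal_to_subspace_exists[OF this] obtain a where
    a: "a \<noteq> 0" "\<And>y. y \<in> span {x, w} \<Longrightarrow> orthogonal a y" by metis
  then have "a \<bullet> x = 0" "a \<bullet> w = 0" by (auto simp: orthogonal_def span_base)
  then show thesis using a(1) by (intro that[of "a /\<^sub>R norm a"]) auto
qed

text \<open>The term in e lets one computation serve both the reflection, where it is 0, and the
  half turn, where e is the second direction turned.\<close>

lemma vector_fixed_by_reflection:
  assumes "\<psi> = \<psi> - (2 * (\<psi> \<bullet> w)) *\<^sub>R w - c *\<^sub>R e" "norm w = 1" "e \<bullet> w = 0"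
  shows "\<psi> \<bullet> w = (0::real)"
proof -
  have "\<psi> \<bullet> w = (\<psi> - (2 * (\<psi> \<bullet> w)) *\<^sub>R w - c *\<^sub>R e) \<bullet> w"
    by (rule arg_cong[OF assms(1), of "\<lambda>u. u \<bullet> w"])
  also have "\<dots> = - (\<psi> \<bullet> w)" using assms(2,3) by (simp add: inner_simps norm_eq_1)
  finally show ?thesis by simp
qed

context top_degree_valuation
begin

lemma radial_imp_equivariant:
  assumes "\<xi> \<in> Cb_pos" "((\<lambda>t. \<xi> t * t) \<longlongrightarrow> 0) (at_right 0)" "\<forall>v\<in>Conv. z v = tstar \<xi> v"
    and "orthogonal_transformation \<theta>"
  shows "\<forall>v\<in>Conv. z (v \<circ> inv \<theta>) = \<theta> (z v)"
proof -
  have "radial \<xi> = density_fn"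
    using assms(3) by (intro density_fn_unique radial_Cc assms(1,2)) (simp add: tstar_radial)
  then show ?thesis
    unfolding equivariant_iff[OF assms(4)] using radial_equivariant[OF assms(4), of \<xi>] by simp
qed

lemma radial_representation:
  assumes "\<And>x w. norm w = 1 \<Longrightarrow> w \<bullet> x = 0 \<Longrightarrow> density_fn x \<bullet> w = 0"
    and "\<And>a b. norm a = norm b \<Longrightarrow>
      \<exists>\<theta>. orthogonal_transformation \<theta> \<and> \<theta> a = b \<and> (\<forall>x. density_fn (\<theta> x) = \<theta> (density_fn x))"
  shows "\<exists>\<xi>\<in>Cb_pos. ((\<lambda>t. \<xi> t * t) \<longlongrightarrow> 0) (at_right 0) \<and> (\<forall>v\<in>Conv. z v = tstar \<xi> v)"
proof -
  have "density_fn x \<bullet> w = 0" if "w \<bullet> x = 0" for x w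
  proof (cases "w = 0")
    case False
    then have "density_fn x \<bullet> (w /\<^sub>R norm w) = 0" using that by (intro assms(1)) auto
    then show ?thesis using False by simp
  qed simp
  then obtain \<xi> where "\<xi> \<in> Cb_pos" "((\<lambda>t. \<xi> t * t) \<longlongrightarrow> 0) (at_right 0)" "density_fn = radial \<xi>"
    using radial_profile_exists[OF density_fn_Cc _ assms(2)] by blast
  then show ?thesis using representation by (auto simp: tstar_radial)
qed

text \<open>For a unit vector w orthogonal to x, dimension at least 3 leaves a direction e
  orthogonal to both. The half turn in the plane of w and e fixes x, hence the density at x, but
  reverses its component along w.\<close>

lemma rotation_equivariant_iff:
  assumes "CARD('n) \<ge> 3"
  shows "rotation_equivariant z \<longleftrightarrow>
    (\<exists>\<xi>\<in>Cb_pos. ((\<lambda>t. \<xi> t * t) \<longlongrightarrow> 0) (at_right 0) \<and> (\<forall>v\<in>Conv. z v = tstar \<xi> v))"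
proof
  assume "rotation_equivariant z"
  then have eq: "density_fn (\<theta> x) = \<theta> (density_fn x)" if "orthogonal_transformation \<theta>" "det (matrix \<theta>) = 1" for \<theta> x
    using equivariant_iff[OF that(1)] that unfolding rotation_equivariant_def by blast
  show "\<exists>\<xi>\<in>Cb_pos. ((\<lambda>t. \<xi> t * t) \<longlongrightarrow> 0) (at_right 0) \<and> (\<forall>v\<in>Conv. z v = tstar \<xi> v)"
  proof (rule radial_representation)
    fix x w :: "real^'n" assume w: "norm w = 1" "w \<bullet> x = 0"
    obtain e where e: "norm e = 1" "e \<bullet> x = 0" "e \<bullet> w = 0" using third_direction[OF assms] .
    define \<theta> where "\<theta> p = p - (2 * (p \<bullet> w)) *\<^sub>R w - (2 * (p \<bullet> e)) *\<^sub>R e" for p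
    have "w \<bullet> e = 0" using e by (simp add: inner_commute)
    from half_turn_rotation[OF w(1) e(1) this] have "density_fn (\<theta> x) = \<theta> (density_fn x)"
      by (intro eq) (simp_all add: \<theta>_def[abs_def])
    moreover have "\<theta> x = x" using w e by (simp add: \<theta>_def inner_commute)
    ultimately have "density_fn x = \<theta> (density_fn x)" by simp
    then have "density_fn x = density_fn x - (2 * (density_fn x \<bullet> w)) *\<^sub>R w - (2 * (density_fn x \<bullet> e)) *\<^sub>R e"
      unfolding \<theta>_def .
    then show "density_fn x \<bullet> w = 0" using w(1) e(3) by (rule vector_fixed_by_reflection)
  next
    fix a b :: "real^'n" assume "norm a = norm b"
    then obtain \<theta> where "orthogonal_transformation \<theta>" "det (matrix \<theta>) = 1" "\<theta> a = b"
      using rotation_exists[of a b] assms by auto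
    then show "\<exists>\<theta>. orthogonal_transformation \<theta> \<and> \<theta> a = b \<and> (\<forall>x. density_fn (\<theta> x) = \<theta> (density_fn x))"
      using eq by blast
  qed
qed (use radial_imp_equivariant in \<open>auto simp: rotation_equivariant_def\<close>)

text \<open>The reflection in the hyperplane orthogonal to w takes the place of the half turn. In
  the plane rotations would not suffice: they also commute with fields having a component
  perpendicular to x.\<close>

lemma O_equivariant_iff:
  "O_equivariant z \<longleftrightarrow>
    (\<exists>\<xi>\<in>Cb_pos. ((\<lambda>t. \<xi> t * t) \<longlongrightarrow> 0) (at_right 0) \<and> (\<forall>v\<in>Conv. z v = tstar \<xi> v))"
proof
  assume "O_equivariant z"
  then have eq: "density_fn (\<theta> x) = \<theta> (density_fn x)" if "orthogonal_transformation \<theta>" for \<theta> x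
    using equivariant_iff[OF that] that unfolding O_equivariant_def by blast
  show "\<exists>\<xi>\<in>Cb_pos. ((\<lambda>t. \<xi> t * t) \<longlongrightarrow> 0) (at_right 0) \<and> (\<forall>v\<in>Conv. z v = tstar \<xi> v)"
  proof (rule radial_representation)
    fix x w :: "real^'n" assume w: "norm w = 1" "w \<bullet> x = 0"
    have "density_fn x = density_fn x - (2 * (density_fn x \<bullet> w)) *\<^sub>R w - 0 *\<^sub>R 0"
      using eq[OF reflection_orthogonal[OF w(1)], of x] w(2) by (simp add: inner_commute)
    then show "density_fn x \<bullet> w = 0" using w(1) by (rule vector_fixed_by_reflection) simp
  next
    fix a b :: "real^'n" assume "norm a = norm b"
    then obtain \<theta> where "orthogonal_transformation \<theta>" "\<theta> a = b"
      using orthogonal_transformation_exists[of a b] by auto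
    then show "\<exists>\<theta>. orthogonal_transformation \<theta> \<and> \<theta> a = b \<and> (\<forall>x. density_fn (\<theta> x) = \<theta> (density_fn x))"
      using eq by blast
  qed
qed (use radial_imp_equivariant in \<open>auto simp: O_equivariant_def\<close>)

end

theorem theorem5p7:
  fixes z :: "(real^'n \<Rightarrow> real) \<Rightarrow> real^'n"
  defines "P \<equiv> continuous_map Conv_top euclidean z \<and> is_valuation z \<and>
                dually_epi_translation_invariant z \<and> homogeneous_deg CARD('n) z"
  shows "(P \<longleftrightarrow> (\<exists>\<psi>\<in>Cc. \<forall>v\<in>Conv. z v = integral\<^sup>L (MA v) \<psi>))
    \<and> (CARD('n) \<ge> 3 \<longrightarrow> P \<longrightarrow>
        (rotation_equivariant z \<longleftrightarrow>
          (\<exists>\<xi>\<in>Cb_pos. ((\<lambda>t. \<xi> t * t) \<longlongrightarrow> 0) (at_right 0) \<and> (\<forall>v\<in>Conv. z v = tstar \<xi> v))))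
    \<and> (CARD('n) \<le> 2 \<longrightarrow> P \<longrightarrow>
        (O_equivariant z \<longleftrightarrow>
          (\<exists>\<xi>\<in>Cb_pos. ((\<lambda>t. \<xi> t * t) \<longlongrightarrow> 0) (at_right 0) \<and> (\<forall>v\<in>Conv. z v = tstar \<xi> v))))"
proof -
  have P: "P \<longleftrightarrow> top_degree_valuation z" by (simp add: P_def top_degree_valuation_def)
  have "P \<longleftrightarrow> (\<exists>\<psi>\<in>Cc. \<forall>v\<in>Conv. z v = integral\<^sup>L (MA v) \<psi>)"
  proof
    assume P
    then interpret top_degree_valuation z by (simp add: P)
    show "\<exists>\<psi>\<in>Cc. \<forall>v\<in>Conv. z v = integral\<^sup>L (MA v) \<psi>" using density_fn_Cc representation by blast
  next
    assume "\<exists>\<psi>\<in>Cc. \<forall>v\<in>Conv. z v = integral\<^sup>L (MA v) \<psi>"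
    then show P unfolding P_def using MA_integral_properties[of _ z] by blast
  qed
  then show ?thesis
    using top_degree_valuation.rotation_equivariant_iff[of z] top_degree_valuation.O_equivariant_iff[of z]
    unfolding P by blast
qed

end
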